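(* Let $d,n>1$ be integers with $n\equiv 1 \pmod{2d}$. Then, modulo $\Phi_{n}(q)^3$, \[ \sum_{k=0}^{(n-1)/d}[3dk+1]\frac{(q;q^{2d})_{k}(q^{d-1};q^{d})_{k}(q;q^{d})_{k}^2}{(q^{d};q^{d})_{k}(q^{d+2};q^{2d})_{k}(q^{2d};q^{2d})_{k}^2}q^{d(k^{2}+k)/2} \equiv \frac{(q^{d};q^{2d})_{(n-1)/(2d)}}{(q^{d+2};q^{2d})_{(n-1)/(2d)}}[n]\,q^{-(n-1)(d-1)/(2d)}, \] and, modulo $\Phi_{n}(q)^3$, \[ \sum_{k=0}^{n-1}[3dk+1]\frac{(q;q^{2d})_{k}(q^{d-1};q^{d})_{k}(q;q^{d})_{k}^2}{(q^{d};q^{d})_{k}(q^{d+2};q^{2d})_{k}(q^{2d};q^{2d})_{k}^2}q^{d(k^{2}+k)/2} \equiv \frac{(q^{d};q^{2d})_{(n-1)/(2d)}}{(q^{d+2};q^{2d})_{(n-1)/(2d)}}[n]\,q^{-(n-1)(d-1)/(2d)}. \]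
   Context: For an indeterminate $q$, $(x;q)_k=(1-x)(1-xq)\cdots(1-xq^{k-1})$ (with $(x;q)_0=1$). $[m]=(1-q^m)/(1-q)$ is the $q$-integer and $\Phi_n(q)$ is the $n$-th cyclotomic polynomial. A congruence between rational functions in $q$ modulo a polynomial $P(q)$ means that the difference is $P(q)$ times a rational function whose denominator is coprime to $P(q)$. *)

theory Defs
  imports
    "HOL-Computational_Algebra.Computational_Algebra"
    "HOL-Number_Theory.Cong"
begin

definition qvar :: "rat poly fract" where
  "qvar = to_fract [:0, 1:]"

definition qpoch :: "'a::comm_ring_1 \<Rightarrow> 'a \<Rightarrow> nat \<Rightarrow> 'a" where
  "qpoch x q k = (\<Prod>j<k. 1 - x * q ^ j)"

definition qint :: "'a::field \<Rightarrow> nat \<Rightarrow> 'a" where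
  "qint q m = (1 - q ^ m) / (1 - q)"

definition primitive_roots :: "nat \<Rightarrow> complex set" where
  "primitive_roots n = {z. z ^ n = 1 \<and> (\<forall>m. 0 < m \<and> m < n \<longrightarrow> z ^ m \<noteq> 1)}"

text \<open>
  The polynomial with roots the primitive \<open>n\<close>-th roots of unity, viewed over the rationals;
  lemma \<open>of_rat_cyclotomic\<close> below shows that the description is proper.
\<close>
definition cyclotomic :: "nat \<Rightarrow> rat poly" where
  "cyclotomic n = (THE p. map_poly of_rat p = (\<Prod>z\<in>primitive_roots n. [:-z, 1:]))"

definition ratfun_cong :: "rat poly fract \<Rightarrow> rat poly fract \<Rightarrow> rat poly \<Rightarrow> bool" where
  "ratfun_cong f g P \<longleftrightarrow>
     (\<exists>u v. v \<noteq> 0 \<and> coprime v P \<and> f - g = to_fract P * (to_fract u / to_fract v))"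

lemma map_poly_of_rat_add:
  "map_poly (of_rat :: rat \<Rightarrow> complex) (p + r) = map_poly of_rat p + map_poly of_rat r"
  by (rule poly_eqI) (simp add: coeff_map_poly of_rat_add)

lemma map_poly_of_rat_mult:
  "map_poly (of_rat :: rat \<Rightarrow> complex) (p * r) = map_poly of_rat p * map_poly of_rat r"
  by (rule poly_eqI) (simp add: coeff_map_poly coeff_mult of_rat_sum of_rat_mult)

lemma map_poly_of_rat_inj:
  "map_poly (of_rat :: rat \<Rightarrow> complex) p = map_poly of_rat r \<Longrightarrow> p = r"
  by (metis (no_types, lifting) coeff_map_poly of_rat_0 of_rat_eq_iff poly_eqI)

lemma finite_primitive_roots: "n > 0 \<Longrightarrow> finite (primitive_roots n)"
  unfolding primitive_roots_def
  by (rule finite_subset[of _ "{z. z ^ n = 1}"]) (auto intro: finite_roots_unity)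

lemma primitive_root_pow_eq_1_iff:
  assumes "z \<in> primitive_roots m" and "m > 0"
  shows "z ^ k = 1 \<longleftrightarrow> m dvd k"
proof -
  have z: "z ^ m = 1" and *: "\<And>j. 0 < j \<Longrightarrow> j < m \<Longrightarrow> z ^ j \<noteq> 1"
    using assms by (auto simp: primitive_roots_def)
  have "z ^ k = z ^ (m * (k div m) + k mod m)" by simp
  also have "\<dots> = z ^ (k mod m)" by (simp only: power_add power_mult z) simp
  finally have "z ^ k = z ^ (k mod m)" .
  thus ?thesis using *[of "k mod m"] \<open>m > 0\<close>
    by (metis dvd_eq_mod_eq_0 mod_less_divisor neq0_conv power_0)
qed

lemma roots_unity_eq_Union_primitive_roots:
  assumes "n > 0"
  shows "{z::complex. z ^ n = 1} = (\<Union>m\<in>{m. m dvd n}. primitive_roots m)"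
proof (intro equalityI subsetI)
  fix z :: complex assume "z \<in> {z. z ^ n = 1}"
  hence zn: "z ^ n = 1" by simp
  define m where "m = (LEAST m. 0 < m \<and> z ^ m = 1)"
  have m: "0 < m \<and> z ^ m = 1"
    unfolding m_def by (rule LeastI[of _ n]) (use assms zn in auto)
  have "\<forall>j. 0 < j \<and> j < m \<longrightarrow> z ^ j \<noteq> 1"
    unfolding m_def using not_less_Least by blast
  hence mem: "z \<in> primitive_roots m" using m by (auto simp: primitive_roots_def)
  with zn m have "m dvd n" using primitive_root_pow_eq_1_iff by blast
  with mem show "z \<in> (\<Union>m\<in>{m. m dvd n}. primitive_roots m)" by blast
next
  fix z assume "z \<in> (\<Union>m\<in>{m. m dvd n}. primitive_roots m)"
  then obtain m where "m dvd n" "z \<in> primitive_roots m" by blast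
  thus "z \<in> {z. z ^ n = 1}"
    using primitive_root_pow_eq_1_iff[of z m n] dvd_pos_nat[OF assms] by blast
qed

lemma prod_roots_unity:
  assumes "n > 0"
  shows "(\<Prod>z\<in>{z::complex. z ^ n = 1}. [:-z, 1:]) = monom 1 n - 1"
proof -
  let ?R = "{z::complex. z ^ n = 1}" and ?P = "monom 1 n - 1 :: complex poly"
  let ?Q = "\<Prod>z\<in>?R. [:-z, 1:]"
  have fin: "finite ?R" using assms by (intro finite_roots_unity) auto
  have card: "card ?R = n" using assms by (rule card_roots_unity_eq)
  have degQ: "degree ?Q = n"
    using card by (subst degree_prod_sum_eq) auto
  have lcQ: "coeff ?Q n = 1"
    using lead_coeff_prod[of "\<lambda>z. [:-z, 1:]" ?R] degQ by simp
  have degP: "degree ?P \<le> n"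
    by (intro degree_diff_le) (auto simp: degree_monom_le)
  have lcP: "coeff ?P n = 1" using assms by (simp add: coeff_1)
  show ?thesis
  proof (rule ccontr)
    assume "?Q \<noteq> ?P"
    hence nz: "?Q - ?P \<noteq> 0" by simp
    have "degree (?Q - ?P) \<le> n" using degQ degP by (metis degree_diff_le order_refl)
    moreover have "coeff (?Q - ?P) n = 0" using lcQ lcP by simp
    ultimately have "degree (?Q - ?P) < n"
      using nz by (metis leading_coeff_0_iff le_neq_implies_less)
    moreover have "?R \<subseteq> {z. poly (?Q - ?P) z = 0}"
      using fin by (auto simp: poly_prod poly_monom prod_zero_iff)
    hence "n \<le> card {z. poly (?Q - ?P) z = 0}"
      using card poly_roots_finite[OF nz] by (metis card_mono)
    ultimately show False using card_poly_roots_bound[OF nz] by linarith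
  qed
qed

lemma cyclotomic_exists:
  "n > 0 \<Longrightarrow> \<exists>p. map_poly of_rat p = (\<Prod>z\<in>primitive_roots n. [:-z, 1:])"
proof (induction n rule: less_induct)
  case (less n)
  define C where "C m = (\<Prod>z\<in>primitive_roots m. [:-z, 1:])" for m
  define D where "D = {m. m dvd n \<and> m \<noteq> n}"
  have finD: "finite D"
    by (rule finite_subset[of _ "{..n}"]) (use less.prems in \<open>auto simp: D_def dest: dvd_imp_le\<close>)
  have D: "m > 0 \<and> m < n" if "m \<in> D" for m
    using that less.prems dvd_pos_nat[of n m] dvd_imp_le[of m n] by (auto simp: D_def)
  have "\<exists>p. map_poly of_rat p = C m" if "m \<in> D" for m
    using less.IH[of m] D[OF that] by (auto simp: C_def)
  then obtain f where f: "\<And>m. m \<in> D \<Longrightarrow> map_poly of_rat (f m) = C m" by metis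
  define b where "b = (\<Prod>m\<in>D. f m)"
  have "map_poly of_rat (\<Prod>m\<in>E. f m) = (\<Prod>m\<in>E. C m)" if "E \<subseteq> D" for E
    using finite_subset[OF that finD] that
    by (induction E rule: finite_induct) (auto simp: map_poly_of_rat_mult f)
  hence b: "map_poly of_rat b = (\<Prod>m\<in>D. C m)" by (simp add: b_def)
  define a :: "rat poly" where "a = monom 1 n - 1"
  have a: "map_poly of_rat a = (monom 1 n - 1 :: complex poly)"
    by (rule poly_eqI) (simp add: a_def coeff_map_poly coeff_1 of_rat_diff)
  have divs: "{m. m dvd n} = insert n D" by (auto simp: D_def)
  have disj: "primitive_roots i \<inter> primitive_roots j = {}"
    if "i dvd n" "j dvd n" "i \<noteq> j" for i j
  proof -
    have "i > 0" "j > 0" using that less.prems by (simp_all add: dvd_pos_nat)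
    thus ?thesis using that(3)
      by (metis disjoint_iff dvd_antisym dvd_refl primitive_root_pow_eq_1_iff)
  qed
  have "monom 1 n - 1 = (\<Prod>z\<in>(\<Union>m\<in>{m. m dvd n}. primitive_roots m). [:-z, 1:])"
    using prod_roots_unity[OF less.prems]
    by (simp add: roots_unity_eq_Union_primitive_roots[OF less.prems])
  also have "\<dots> = (\<Prod>m\<in>{m. m dvd n}. C m)"
    unfolding C_def
  proof (rule prod.UNION_disjoint)
    show "finite {m. m dvd n}" using less.prems by simp
    show "\<forall>i\<in>{m. m dvd n}. finite (primitive_roots i)"
      using less.prems dvd_pos_nat finite_primitive_roots by blast
  qed (use disj in auto)
  also have "\<dots> = C n * map_poly of_rat b"
    unfolding divs b using finD by (subst prod.insert) (auto simp: D_def)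
  finally have eq: "map_poly of_rat a = C n * map_poly of_rat b" using a by simp
  have nz: "map_poly (of_rat :: rat \<Rightarrow> complex) b \<noteq> 0"
  proof -
    have "C m \<noteq> 0" if "m \<in> D" for m
      unfolding C_def using finite_primitive_roots[of m] D[OF that] by simp
    thus ?thesis unfolding b using finD by simp
  qed
  have deg: "degree (map_poly (of_rat :: rat \<Rightarrow> complex) p) = degree p" for p
    by (intro degree_map_poly) auto
  have "map_poly of_rat a =
      map_poly of_rat (a div b) * map_poly of_rat b + (map_poly of_rat (a mod b) :: complex poly)"
    by (metis div_mult_mod_eq map_poly_of_rat_add map_poly_of_rat_mult)
  hence *: "(C n - map_poly of_rat (a div b)) * map_poly of_rat b = map_poly of_rat (a mod b)"
    using eq by (simp add: algebra_simps)
  have "C n - map_poly of_rat (a div b) = 0"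
  proof (rule ccontr)
    assume ne: "\<not> ?thesis"
    have "b \<noteq> 0" using nz by auto
    have "degree (map_poly (of_rat :: rat \<Rightarrow> complex) (a mod b)) =
        degree (C n - map_poly of_rat (a div b)) + degree b"
      using * ne nz degree_mult_eq deg by metis
    hence "degree b \<le> degree (a mod b)" using deg by simp
    moreover have "a mod b \<noteq> 0" using * ne nz by auto
    ultimately show False using degree_mod_less[OF \<open>b \<noteq> 0\<close>, of a] by simp
  qed
  thus ?case unfolding C_def by (intro exI[of _ "a div b"]) simp
qed

lemma of_rat_cyclotomic:
  assumes "n > 0"
  shows "map_poly of_rat (cyclotomic n) = (\<Prod>z\<in>primitive_roots n. [:-z, 1:])"
proof -
  obtain p where p: "map_poly of_rat p = (\<Prod>z\<in>primitive_roots n. [:-z, 1:])"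
    using cyclotomic_exists[OF assms] by blast
  show ?thesis unfolding cyclotomic_def
    by (rule theI[of _ p]) (use p map_poly_of_rat_inj in auto)
qed

end

theory Submission
  imports Defs
begin

text \<open>
  Put \<open>p = q\<^sup>d\<close>, \<open>n = 2dm + 1\<close> and \<open>Y = q\<^sup>n = q p\<^bsup>2m\<^esup>\<close>. The summand is the case \<open>a = b = d = q\<close> of
  the summand of a quadratic summation of Rahman in base \<open>p\<close> with three free parameters. If one of
  \<open>a\<close>, \<open>b\<close>, \<open>d\<close> equals \<open>p\<^bsup>-2m\<^esup> = q / Y\<close>, the sum over \<open>k \<le> 2m\<close> terminates and has a closed form
  (a WZ argument for \<open>b\<close> and \<open>d\<close>, and a density argument giving \<open>0\<close> for \<open>a\<close>). One product agrees with
  these three closed forms, so on a curve through \<open>(q, q, q)\<close> that meets the three planes the difference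
  of sum and product is divisible by three factors, each divisible by \<open>1 - Y\<close> at the base point.

  For \<open>2m < k < n\<close> the terms contain the factor \<open>(1 - Y)\<^sup>2 (1 - bp\<^bsup>2m\<^esup>)\<close>, but one denominator factor is
  also divisible by \<open>1 - Y\<close>. The missing factor comes from the second terminating value
  \<open>b = p\<^bsup>2M+1\<^esup> = q Y\<^bsup>d-1\<^esup>\<close>, \<open>M = m(d - 1)\<close>, where the full sum is known as well.
\<close>

section \<open>A terminating quadratic summation\<close>

text \<open>The modulus is a cube, so three zeros in one variable \<open>x\<close> are wanted, all
  lying in the ideal of \<open>1 - Y\<close> and pairwise different. If \<open>a\<close> and
  \<open>d\<close> moved along the curve at equal speed, their zeros would coincide; this is why the
  slopes are unequal. The base value of \<open>b\<close> is kept as \<open>q * \<beta>\<close> with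
  \<open>\<beta>\<close> merely congruent to 1, since the congruence is used a second time for the
  tail.

  The base ring consists of the fractions whose denominators do not vanish at the primitive
  \<open>n\<close>-th roots of unity, with \<open>1 - Y\<close> as modulus. All parameter values on
  the curve reduce to \<open>q\<close>, so that most denominators are units by a divisibility
  argument on exponents, and \<open>1 - Y ^ i\<close> is \<open>1 - Y\<close> times a unit.

  The recurrence in \<open>b\<close> has poles at \<open>a = p^(-2m)\<close>. That plane is
  therefore reached by two identities of rational functions, the first in \<open>a\<close> for
  \<open>b = p^(-2M)\<close>, the second in \<open>b\<close> through infinitely many
  \<open>M\<close>.\<close>

text \<open>
  Without divisions by \<open>b\<close> and \<open>d\<close>, this is \<open>(1 - ap\<^bsup>3k\<^esup>)\<close> times
  \<open>(a, b, p/b; p)\<^sub>k (d; p\<^sup>2)\<^sub>k / ((p\<^sup>2, ap\<^sup>2/b, abp; p\<^sup>2)\<^sub>k (ap/d; p)\<^sub>k) (a/d)\<^sup>k p\<^bsup>k(k+1)/2\<^esup>\<close>.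
\<close>
definition rterm :: "'a::field \<Rightarrow> 'a \<Rightarrow> 'a \<Rightarrow> 'a \<Rightarrow> nat \<Rightarrow> 'a" where
  "rterm p a b d k = (1 - a * p ^ (3 * k)) *
     (\<Prod>j<k. (1 - a * p ^ j) * (1 - b * p ^ j) * (b - p ^ Suc j) * (1 - d * p ^ (2 * j)) * a * p ^ Suc j /
       ((1 - p ^ (2 * j + 2)) * (b - a * p ^ (2 * j + 2)) * (1 - a * b * p ^ (2 * j + 1)) * (d - a * p ^ Suc j)))"

text \<open>Converts a product into another one whose factors differ from it by quotients
  \<open>z (Suc j) / z j\<close>. The relation is multiplied out because \<open>z\<close> may
  vanish, as it does when a sum terminates.\<close>

lemma prod_ratio_telescope:
  fixes f g z :: "nat \<Rightarrow> 'a::comm_ring_1"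
  assumes "\<And>j. j < N \<Longrightarrow> f j * z j = g j * z (Suc j)"
  shows "(\<Prod>j<N. f j) * z 0 = (\<Prod>j<N. g j) * z N"
  using assms
proof (induction N)
  case (Suc N)
  have IH: "(\<Prod>j<N. f j) * z 0 = (\<Prod>j<N. g j) * z N" using Suc by simp
  have "(\<Prod>j<Suc N. f j) * z 0 = ((\<Prod>j<N. f j) * z 0) * f N" by (simp add: mult_ac)
  also have "\<dots> = (\<Prod>j<N. g j) * (f N * z N)" unfolding IH by (simp add: mult_ac)
  also have "f N * z N = g N * z (Suc N)" by (rule Suc.prems) simp
  also have "(\<Prod>j<N. g j) * (g N * z (Suc N)) = (\<Prod>j<Suc N. g j) * z (Suc N)" by (simp add: mult_ac)
  finally show ?case .
qed simp

lemma pow_split: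
  fixes p :: "'a::comm_ring_1"
  shows "p ^ (2 * j) = p ^ j * p ^ j" "p ^ (2 * j + 1) = p * (p ^ j * p ^ j)"
  "p ^ (2 * j + 2) = p * p * (p ^ j * p ^ j)" "p ^ (2 * j + 3) = p * p * p * (p ^ j * p ^ j)"
  "p ^ (3 * j) = p ^ j * p ^ j * p ^ j" "p ^ Suc j = p * p ^ j"
  "p ^ (2 * Suc j) = p * p * (p ^ j * p ^ j)" "p ^ (2 * Suc j + 1) = p * p * p * (p ^ j * p ^ j)"
proof -
  have e: "3 * j = j + j + j" "2 * j = j + j" by auto
  show "p ^ (2 * j) = p ^ j * p ^ j" "p ^ (2 * j + 1) = p * (p ^ j * p ^ j)"
  "p ^ (2 * j + 2) = p * p * (p ^ j * p ^ j)" "p ^ (2 * j + 3) = p * p * p * (p ^ j * p ^ j)"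
  "p ^ (3 * j) = p ^ j * p ^ j * p ^ j" "p ^ Suc j = p * p ^ j"
  "p ^ (2 * Suc j) = p * p * (p ^ j * p ^ j)" "p ^ (2 * Suc j + 1) = p * p * p * (p ^ j * p ^ j)"
    unfolding e by (simp_all add: power_add power_mult power2_eq_square power3_eq_cube mult_ac)
qed

text \<open>
  The last summand on the right is the WZ certificate of the step \<open>b \<mapsto> b / p\<^sup>2\<close> (with \<open>b = cp\<^sup>2\<close>);
  it vanishes for large \<open>N\<close> when the sums terminate.
\<close>
lemma rterm_sum_contiguous_b:
  fixes p a c d :: "'a::field" and N :: nat
  defines "g \<equiv> \<lambda>j. (1 - a * p ^ j) * (1 - c * p ^ j) * (c * p - p ^ j) * (1 - d * p ^ (2 * j)) * a * p ^ j /
     ((1 - p ^ (2 * j + 2)) * (c - a * p ^ (2 * j)) * (1 - a * c * p ^ (2 * j + 3)) * (d - a * p ^ Suc j))"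
  assumes nz: "p \<noteq> 0" "c \<noteq> 1" "c * p \<noteq> 1"
    and p1: "\<And>j. j < N \<Longrightarrow> 1 - p ^ (2 * j + 2) \<noteq> 0"
    and ca: "\<And>j. j \<le> N \<Longrightarrow> c - a * p ^ (2 * j) \<noteq> 0"
    and ac: "\<And>j. j \<le> N \<Longrightarrow> 1 - a * c * p ^ (2 * j + 1) \<noteq> 0"
    and da: "\<And>j. j < N \<Longrightarrow> d - a * p ^ Suc j \<noteq> 0"
  shows "(\<Sum>k<N. rterm p a c d k) * ((c * d - a) * (a * c * p - 1)) =
     (\<Sum>k<N. rterm p a (c * p\<^sup>2) d k) * ((c - a) * (a * c * p - d)) +
     (c - a) * (c\<^sup>2 * p - 1) / ((1 - c) * (1 - c * p)) * (1 - p ^ (2 * N)) * (1 - a * c * p ^ (2 * N + 1)) * (d - a * p ^ N) *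
     (\<Prod>j<N. g j)"
  using p1 ca ac da
proof (induction N)
  case 0
  then show ?case by simp
next
  case (Suc N)
  define P where "P = p ^ N"
  define G where "G = (\<Prod>j<N. g j)"
  let ?f = "\<lambda>b j. (1 - a * p ^ j) * (1 - b * p ^ j) * (b - p ^ Suc j) * (1 - d * p ^ (2 * j)) * a * p ^ Suc j /
       ((1 - p ^ (2 * j + 2)) * (b - a * p ^ (2 * j + 2)) * (1 - a * b * p ^ (2 * j + 1)) * (d - a * p ^ Suc j))"
  have c0: "c - a \<noteq> 0" using Suc.prems(2)[of 0] by simp
  have ac0: "1 - a * c * p \<noteq> 0" using Suc.prems(3)[of 0] by simp
  have cP: "c - a * (P * P) \<noteq> 0" using Suc.prems(2)[of N, unfolded pow_split, folded P_def] by simp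
  \<comment> \<open>\<open>G\<close> is the part common to the summands for \<open>c\<close> and for
    \<open>c * p\<^sup>2\<close>. Together with \<open>E2\<close> this writes both as
    \<open>G\<close> times an explicit rational function of \<open>P\<close>, so the WZ equation
    becomes a polynomial identity.\<close>
  have E1: "(\<Prod>j<N. ?f c j) * ((c - 1) * (c * p - 1) * (1 - a * c * p) / (c - a)) =
      G * ((c - P) * (c * p - P) * (1 - a * c * (p * (P * P))) / (c - a * (P * P)))"
  proof -
    let ?z = "\<lambda>j. (c - p ^ j) * (c * p - p ^ j) * (1 - a * c * p ^ (2 * j + 1)) / (c - a * p ^ (2 * j))"
    have "(\<Prod>j<N. ?f c j) * ?z 0 = (\<Prod>j<N. g j) * ?z N"
    proof (rule prod_ratio_telescope)
      fix j assume j: "j < N"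
      define x where "x = p ^ j"
      have h: "1 - p * p * (x * x) \<noteq> 0" "c - a * (x * x) \<noteq> 0" "c - a * (p * p * (x * x)) \<noteq> 0"
         "1 - a * c * (p * (x * x)) \<noteq> 0" "1 - a * c * (p * p * p * (x * x)) \<noteq> 0" "d - a * (p * x) \<noteq> 0"
        using Suc.prems(1)[of j, unfolded pow_split, folded x_def] Suc.prems(2)[of j, unfolded pow_split, folded x_def] Suc.prems(2)[of "Suc j", unfolded pow_split, folded x_def] Suc.prems(3)[of j, unfolded pow_split, folded x_def]
          Suc.prems(3)[of "Suc j", unfolded pow_split, folded x_def] Suc.prems(4)[of j, unfolded pow_split, folded x_def] j by (simp_all add: mult_ac)
      have s: "p ^ (2 * Suc j + 1) = p * p * p * (x * x)" "p ^ (2 * Suc j) = p * p * (x * x)"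
        unfolding x_def by (rule pow_split)+
      show "?f c j * ?z j = g j * ?z (Suc j)"
        unfolding g_def s unfolding pow_split x_def[symmetric]
        using h by (simp add: divide_simps) (simp add: algebra_simps)
    qed
    then show ?thesis by (simp add: G_def P_def pow_split)
  qed
  have E2: "(\<Prod>j<N. ?f (c * p\<^sup>2) j) * ((1 - c) * (1 - c * p)) = G * ((1 - c * P) * (1 - c * p * P))"
  proof -
    let ?z = "\<lambda>j. (1 - c * p ^ j) * (1 - c * p * p ^ j)"
    have "(\<Prod>j<N. ?f (c * p\<^sup>2) j) * ?z 0 = (\<Prod>j<N. g j) * ?z N"
    proof (rule prod_ratio_telescope)
      fix j assume j: "j < N"
      define x where "x = p ^ j"
      have h: "1 - p * p * (x * x) \<noteq> 0" "c - a * (x * x) \<noteq> 0"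
         "1 - a * c * (p * p * p * (x * x)) \<noteq> 0" "d - a * (p * x) \<noteq> 0"
        using Suc.prems(1)[of j, unfolded pow_split, folded x_def] Suc.prems(2)[of j, unfolded pow_split, folded x_def]
          Suc.prems(3)[of "Suc j", unfolded pow_split, folded x_def] Suc.prems(4)[of j, unfolded pow_split, folded x_def] j by (simp_all add: mult_ac)
      have e1: "c * p\<^sup>2 - a * (p * p * (x * x)) = p * p * (c - a * (x * x))"
        "c * p\<^sup>2 - p * x = p * (c * p - x)"
        "1 - a * (c * p\<^sup>2) * (p * (x * x)) = 1 - a * c * (p * p * p * (x * x))"
        by (simp_all add: algebra_simps power2_eq_square)
      show "?f (c * p\<^sup>2) j * ?z j = g j * ?z (Suc j)"
        unfolding g_def unfolding pow_split x_def[symmetric] e1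
        using h nz by (simp add: divide_simps power2_eq_square) (simp add: algebra_simps)
    qed
    then show ?thesis by (simp add: G_def P_def)
  qed
  have T1: "rterm p a c d N = (1 - a * (P * P * P)) * G * ((c - P) * (c * p - P) * (1 - a * c * (p * (P * P))) * (c - a) /
      ((c - a * (P * P)) * ((c - 1) * (c * p - 1) * (1 - a * c * p))))"
    using E1 c0 ac0 nz cP unfolding rterm_def pow_split(5)[of p N] P_def[symmetric]
    by (simp add: divide_simps) (simp add: algebra_simps)
  have T2: "rterm p a (c * p\<^sup>2) d N = (1 - a * (P * P * P)) * G * ((1 - c * P) * (1 - c * p * P)) / ((1 - c) * (1 - c * p))"
    using E2 nz unfolding rterm_def pow_split(5)[of p N] P_def[symmetric]
    by (simp add: divide_simps)
  have V1: "1 - p * p * (P * P) \<noteq> 0" "1 - a * c * (p * p * p * (P * P)) \<noteq> 0" "d - a * (p * P) \<noteq> 0"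
    using Suc.prems(1)[of N, unfolded pow_split, folded P_def] Suc.prems(3)[of "Suc N", unfolded pow_split, folded P_def]
      Suc.prems(4)[of N, unfolded pow_split, folded P_def] by (simp_all add: mult_ac)
  let ?X = "(c - a) * (c\<^sup>2 * p - 1) / ((1 - c) * (1 - c * p))"
  let ?V = "c - a * (P * P)"
  let ?Q = "(1 - a * P) * (1 - c * P) * (c * p - P) * (1 - d * (P * P)) * a * P"
  have gN: "(1 - p * p * (P * P)) * (1 - a * c * (p * p * p * (P * P))) * (d - a * (p * P)) * g N = ?Q / ?V"
    unfolding g_def unfolding pow_split P_def[symmetric] using V1 by simp
  \<comment> \<open>The WZ equation at one index with common factors cleared: the summand for
    \<open>c\<close>, the summand for \<open>c * p\<^sup>2\<close>, and the certificate at
    \<open>N + 1\<close> (the \<open>?Q\<close> term) minus the certificate at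
    \<open>N\<close>.\<close>
  have poly: "- ((1 - a * (P * P * P)) * (c - P) * (c * p - P) * (1 - a * c * (p * (P * P))) * (c * d - a)) =
      (1 - a * (P * P * P)) * (1 - c * P) * (1 - c * p * P) * (a * c * p - d) * ?V +
      (c\<^sup>2 * p - 1) * (?Q - (1 - P * P) * (1 - a * c * (p * (P * P))) * (d - a * P) * ?V)"
    by algebra
  have D: "(1 - c) * (1 - c * p) \<noteq> 0" using nz by simp
  have "rterm p a c d N * ((c * d - a) * (a * c * p - 1)) =
      G * (c - a) / (?V * ((1 - c) * (1 - c * p))) *
      - ((1 - a * (P * P * P)) * (c - P) * (c * p - P) * (1 - a * c * (p * (P * P))) * (c * d - a))"
  proof -
    define w where "w = 1 - a * c * p"
    have e: "(c - 1) * (c * p - 1) = (1 - c) * (1 - c * p)" "a * c * p - 1 = - w"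
      by (simp_all add: algebra_simps w_def)
    have w: "w \<noteq> 0" using ac0 by (simp add: w_def)
    show ?thesis unfolding T1 unfolding e w_def[symmetric] using cP D w by (simp add: mult_ac)
  qed
  also have "\<dots> = rterm p a (c * p\<^sup>2) d N * ((c - a) * (a * c * p - d)) + ?X * (?Q / ?V) * G -
      ?X * (1 - P * P) * (1 - a * c * (p * (P * P))) * (d - a * P) * G"
    unfolding poly T2 using cP D by (simp add: divide_simps) algebra
  finally have step: "rterm p a c d N * ((c * d - a) * (a * c * p - 1)) =
      rterm p a (c * p\<^sup>2) d N * ((c - a) * (a * c * p - d)) + ?X * (?Q / ?V) * G -
      ?X * (1 - P * P) * (1 - a * c * (p * (P * P))) * (d - a * P) * G" .
  have IH: "(\<Sum>k<N. rterm p a c d k) * ((c * d - a) * (a * c * p - 1)) =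
     (\<Sum>k<N. rterm p a (c * p\<^sup>2) d k) * ((c - a) * (a * c * p - d)) +
     ?X * (1 - P * P) * (1 - a * c * (p * (P * P))) * (d - a * P) * G"
    using Suc.IH Suc.prems unfolding pow_split P_def[symmetric] G_def[symmetric] by auto
  have new: "?X * (1 - p ^ (2 * Suc N)) * (1 - a * c * p ^ (2 * Suc N + 1)) * (d - a * p ^ Suc N) * (\<Prod>j<Suc N. g j)
      = ?X * (?Q / ?V) * G"
  proof -
    have "?X * (1 - p ^ (2 * Suc N)) * (1 - a * c * p ^ (2 * Suc N + 1)) * (d - a * p ^ Suc N) * (\<Prod>j<Suc N. g j)
      = ?X * ((1 - p * p * (P * P)) * (1 - a * c * (p * p * p * (P * P))) * (d - a * (p * P)) * g N) * G"
      unfolding pow_split(7,8) pow_split(6)[of p N] P_def[symmetric] G_def prod.lessThan_Suc by (simp only: mult_ac)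
    then show ?thesis unfolding gN .
  qed
  show ?case unfolding sum.lessThan_Suc new ring_distribs(2) IH step by simp
qed

text \<open>The same WZ device for the step \<open>d \<mapsto> d / p\<^sup>2\<close>, with
  \<open>d = e * p\<^sup>2\<close>. The last summand is the telescoped certificate; the factor
  \<open>1 - e * p ^ (2 * j)\<close> of \<open>g\<close> kills it once \<open>e\<close> is a
  negative even power of \<open>p\<close> and \<open>N\<close> is large enough.\<close>

lemma rterm_sum_contiguous_d:
  fixes p a b e :: "'a::field" and N :: nat
  defines "g \<equiv> \<lambda>j. (1 - a * p ^ j) * (1 - b * p ^ j) * (b - p ^ Suc j) * (1 - e * p ^ (2 * j)) * a * p ^ j /
     ((1 - p ^ (2 * j + 2)) * (b - a * p ^ (2 * j + 2)) * (1 - a * b * p ^ (2 * j + 1)) * (e * p - a * p ^ j))"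
  assumes nz: "p \<noteq> 0" "e \<noteq> 1" "b \<noteq> 0"
    and p1: "\<And>j. j < N \<Longrightarrow> 1 - p ^ (2 * j + 2) \<noteq> 0"
    and ba: "\<And>j. j < N \<Longrightarrow> b - a * p ^ (2 * j + 2) \<noteq> 0"
    and ab: "\<And>j. j < N \<Longrightarrow> 1 - a * b * p ^ (2 * j + 1) \<noteq> 0"
    and ea: "\<And>j. j \<le> N \<Longrightarrow> e - a * p ^ j \<noteq> 0"
    and ea': "e * p - a \<noteq> 0"
  shows "(\<Sum>k<N. rterm p a b e k) * ((b * e - a) * (e * p - a * b)) =
     (\<Sum>k<N. rterm p a b (e * p\<^sup>2) k) * ((e * p - a) * (e - a) * b) +
     (e * p - a) * (e - a) * e * (1 - p ^ (2 * N)) * (p - a * b * p ^ (2 * N)) * (b - a * p ^ (2 * N)) /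
       ((1 - e) * (e * p - a * p ^ N)) * (\<Prod>j<N. g j)"
  using p1 ba ab ea
proof (induction N)
  case 0
  then show ?case by simp
next
  case (Suc N)
  define P where "P = p ^ N"
  define G where "G = (\<Prod>j<N. g j)"
  let ?f = "\<lambda>d j. (1 - a * p ^ j) * (1 - b * p ^ j) * (b - p ^ Suc j) * (1 - d * p ^ (2 * j)) * a * p ^ Suc j /
       ((1 - p ^ (2 * j + 2)) * (b - a * p ^ (2 * j + 2)) * (1 - a * b * p ^ (2 * j + 1)) * (d - a * p ^ Suc j))"
  have e0: "e - a \<noteq> 0" using Suc.prems(4)[of 0] by simp
  have ep: "e * p - a * p ^ j \<noteq> 0" if "j \<le> Suc N" for j
  proof (cases j)
    case 0
    then show ?thesis using ea' by simp
  next
    case (Suc i)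
    have "e * p - a * p ^ j = p * (e - a * p ^ i)" by (simp add: Suc algebra_simps)
    then show ?thesis using Suc.prems(4)[of i] Suc that nz by simp
  qed
  have eP: "e * p - a * P \<noteq> 0" using ep[of N] by (simp add: P_def)
  have eP': "e - a * P \<noteq> 0" using Suc.prems(4)[of N] by (simp add: P_def)
  have E1: "(\<Prod>j<N. ?f e j) * (1 / ((e * p - a) * (e - a))) = G * (P * P / ((e * p - a * P) * (e - a * P)))"
  proof -
    let ?z = "\<lambda>j. p ^ j * p ^ j / ((e * p - a * p ^ j) * (e - a * p ^ j))"
    have "(\<Prod>j<N. ?f e j) * ?z 0 = (\<Prod>j<N. g j) * ?z N"
    proof (rule prod_ratio_telescope)
      fix j assume j: "j < N"
      define x where "x = p ^ j"
      have h: "1 - p * p * (x * x) \<noteq> 0" "b - a * (p * p * (x * x)) \<noteq> 0" "1 - a * b * (p * (x * x)) \<noteq> 0"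
         "e - a * x \<noteq> 0" "e - a * (p * x) \<noteq> 0" "e * p - a * x \<noteq> 0"
        using Suc.prems(1)[of j, unfolded pow_split, folded x_def] Suc.prems(2)[of j, unfolded pow_split, folded x_def]
          Suc.prems(3)[of j, unfolded pow_split, folded x_def] Suc.prems(4)[of j, unfolded pow_split, folded x_def]
          Suc.prems(4)[of "Suc j", unfolded pow_split, folded x_def] ep[of j, folded x_def] j by (simp_all add: mult_ac)
      have s: "e * p - a * (p * x) = p * (e - a * x)" by (simp add: algebra_simps)
      show "?f e j * ?z j = g j * ?z (Suc j)"
        unfolding g_def unfolding pow_split x_def[symmetric] s
        using h nz by (simp add: divide_simps)
    qed
    then show ?thesis by (simp add: G_def P_def)
  qed
  have E2: "(\<Prod>j<N. ?f (e * p\<^sup>2) j) * (1 - e) = G * (1 - e * (P * P))"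
  proof -
    let ?z = "\<lambda>j. 1 - e * (p ^ j * p ^ j)"
    have "(\<Prod>j<N. ?f (e * p\<^sup>2) j) * ?z 0 = (\<Prod>j<N. g j) * ?z N"
    proof (rule prod_ratio_telescope)
      fix j assume j: "j < N"
      define x where "x = p ^ j"
      have h: "1 - p * p * (x * x) \<noteq> 0" "b - a * (p * p * (x * x)) \<noteq> 0" "1 - a * b * (p * (x * x)) \<noteq> 0"
         "e * p - a * x \<noteq> 0"
        using Suc.prems(1)[of j, unfolded pow_split, folded x_def] Suc.prems(2)[of j, unfolded pow_split, folded x_def]
          Suc.prems(3)[of j, unfolded pow_split, folded x_def] ep[of j, folded x_def] j by (simp_all add: mult_ac)
      have s: "e * p\<^sup>2 - a * (p * x) = p * (e * p - a * x)" "1 - e * p\<^sup>2 * (x * x) = 1 - e * (p * x * (p * x))"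
        by (simp_all add: algebra_simps power2_eq_square)
      show "?f (e * p\<^sup>2) j * ?z j = g j * ?z (Suc j)"
        unfolding g_def unfolding pow_split x_def[symmetric] s
        using h nz by (simp add: divide_simps)
    qed
    then show ?thesis by (simp add: G_def P_def)
  qed
  have T1: "rterm p a b e N = (1 - a * (P * P * P)) * G * (P * P) * ((e * p - a) * (e - a)) / ((e * p - a * P) * (e - a * P))"
    using E1 e0 ea' eP eP' nz unfolding rterm_def pow_split(5)[of p N] P_def[symmetric]
    by (simp add: divide_simps)
  have T2: "rterm p a b (e * p\<^sup>2) N = (1 - a * (P * P * P)) * G * (1 - e * (P * P)) / (1 - e)"
    using E2 nz unfolding rterm_def pow_split(5)[of p N] P_def[symmetric]
    by (simp add: divide_simps)
  have V1: "1 - p * p * (P * P) \<noteq> 0" "b - a * (p * p * (P * P)) \<noteq> 0" "1 - a * b * (p * (P * P)) \<noteq> 0"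
    using Suc.prems(1)[of N, unfolded pow_split, folded P_def] Suc.prems(2)[of N, unfolded pow_split, folded P_def]
      Suc.prems(3)[of N, unfolded pow_split, folded P_def] by (simp_all add: mult_ac)
  let ?X = "(e * p - a) * (e - a) * e"
  let ?Q = "(1 - a * P) * (1 - b * P) * (b - p * P) * (1 - e * (P * P)) * a * P"
  let ?W = "(1 - P * P) * (p - a * b * (P * P)) * (b - a * (P * P))"
  have gN: "(1 - p * p * (P * P)) * (p - a * b * (p * p * (P * P))) * (b - a * (p * p * (P * P))) /
      ((1 - e) * (p * (e - a * P))) * g N = ?Q / ((1 - e) * (e - a * P) * (e * p - a * P))"
  proof -
    have s: "p - a * b * (p * p * (P * P)) = p * (1 - a * b * (p * (P * P)))" by (simp add: algebra_simps)
    show ?thesis unfolding g_def s unfolding pow_split P_def[symmetric] using V1 nz eP eP' by (simp add: mult.assoc)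
  qed
  have poly: "(1 - a * (P * P * P)) * (P * P) * (1 - e) * ((b * e - a) * (e * p - a * b)) =
      (1 - a * (P * P * P)) * (1 - e * (P * P)) * b * (e * p - a * P) * (e - a * P) +
      e * (?Q - ?W * (e - a * P))"
    by algebra
  have D: "1 - e \<noteq> 0" using nz by simp
  have step: "rterm p a b e N * ((b * e - a) * (e * p - a * b)) =
      rterm p a b (e * p\<^sup>2) N * ((e * p - a) * (e - a) * b) + ?X * (?Q / ((1 - e) * (e - a * P) * (e * p - a * P))) * G -
      ?X * ?W / ((1 - e) * (e * p - a * P)) * G"
  proof -
    have "rterm p a b e N * ((b * e - a) * (e * p - a * b)) =
       G * ((e * p - a) * (e - a)) / ((1 - e) * (e - a * P) * (e * p - a * P)) *
       ((1 - a * (P * P * P)) * (P * P) * (1 - e) * ((b * e - a) * (e * p - a * b)))"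
      unfolding T1 using D by (simp add: mult_ac)
    then show ?thesis unfolding poly T2 using D eP eP' by (simp add: divide_simps) algebra
  qed
  have IH: "(\<Sum>k<N. rterm p a b e k) * ((b * e - a) * (e * p - a * b)) =
     (\<Sum>k<N. rterm p a b (e * p\<^sup>2) k) * ((e * p - a) * (e - a) * b) +
     ?X * ?W / ((1 - e) * (e * p - a * P)) * G"
    using Suc.IH Suc.prems unfolding pow_split P_def[symmetric] G_def[symmetric] by (simp add: mult_ac)
  have new: "?X * (1 - p ^ (2 * Suc N)) * (p - a * b * p ^ (2 * Suc N)) * (b - a * p ^ (2 * Suc N)) /
       ((1 - e) * (e * p - a * p ^ Suc N)) * (\<Prod>j<Suc N. g j)
      = ?X * (?Q / ((1 - e) * (e - a * P) * (e * p - a * P))) * G"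
  proof -
    have s: "e * p - a * p ^ Suc N = p * (e - a * P)" by (simp add: P_def algebra_simps)
    show ?thesis
      unfolding gN[symmetric] s unfolding pow_split(7) P_def[symmetric] G_def prod.lessThan_Suc by (simp add: mult_ac)
  qed
  show ?case unfolding sum.lessThan_Suc new ring_distribs(2) IH step by simp
qed

lemma rterm_eq_0_b:
  assumes "b * p ^ j = 1" "j < k"
  shows "rterm p a b d k = 0"
  unfolding rterm_def using assms by (auto intro!: bexI[of _ j])

lemma rterm_eq_0_b':
  assumes "b = p ^ Suc j" "j < k"
  shows "rterm p a b d k = 0"
  unfolding rterm_def using assms by (auto intro!: bexI[of _ j])

lemma rterm_eq_0_d:
  assumes "d * p ^ (2 * j) = 1" "j < k"
  shows "rterm p a b d k = 0"
  unfolding rterm_def using assms by (auto intro!: bexI[of _ j])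

lemma rterm_eq_0_a:
  assumes "a * p ^ j = 1" "j < k"
  shows "rterm p a b d k = 0"
  unfolding rterm_def using assms by (auto intro!: bexI[of _ j])

lemma rterm_0 [simp]: "rterm p a b d 0 = 1 - a"
  by (simp add: rterm_def)

lemma sum_lessThan_extend_zero:
  fixes f :: "nat \<Rightarrow> 'a::comm_monoid_add"
  assumes "N \<le> N'" "\<And>k. N \<le> k \<Longrightarrow> k < N' \<Longrightarrow> f k = 0"
  shows "(\<Sum>k<N'. f k) = (\<Sum>k<N. f k)"
  by (rule sum.mono_neutral_right) (use assms in auto)

text \<open>Induction on \<open>M\<close>: for \<open>c = p^(-2M-2)\<close> the certificate
  vanishes, and the contiguous relation links consecutive closed forms. The hypotheses on
  \<open>a\<close> and \<open>d\<close> keep every denominator of the certificate nonzero over the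
  whole range of summation. They exclude \<open>a = p^(-2i)\<close> for
  \<open>1 \<le> i \<le> 3 * M + 1\<close>, which is what calls for a density argument
  later.\<close>

lemma rterm_sum_terminating_b:
  fixes p a d :: "'a::field"
  assumes p0: "p \<noteq> 0" and p1: "\<And>i. i > 0 \<Longrightarrow> p ^ i \<noteq> 1"
    and a1: "\<And>i. 1 \<le> i \<Longrightarrow> i \<le> 3 * M + 1 \<Longrightarrow> a * p ^ (2 * i) \<noteq> 1"
    and a2: "\<And>i. i \<le> M + 1 \<Longrightarrow> a * p ^ (2 * i + 1) \<noteq> 1"
    and a3: "\<And>i. i < M \<Longrightarrow> a \<noteq> p ^ (2 * i + 1)"
    and da: "\<And>i. 1 \<le> i \<Longrightarrow> i \<le> 2 * M + 1 \<Longrightarrow> d \<noteq> a * p ^ i"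
  shows "(\<Sum>k<2 * M + 1. rterm p a (1 / p ^ (2 * M)) d k) =
    (1 - a) * (\<Prod>i<M. (1 - a * p ^ (2 * i + 2)) * (a - d * p ^ (2 * i + 1)) /
       ((d - a * p ^ (2 * i + 2)) * (a - p ^ (2 * i + 1))))"
  using a1 a2 a3 da
proof (induction M)
  case 0
  then show ?case by simp
next
  case (Suc M)
  define c where "c = 1 / p ^ (2 * Suc M)"
  let ?N = "2 * Suc M + 1"
  have c0: "c \<noteq> 0" using p0 by (simp add: c_def)
  have cpow: "c * p ^ (2 * M + 2) = 1" using p0 by (simp add: c_def)
  have cp2: "c * p\<^sup>2 = 1 / p ^ (2 * M)"
    using p0 by (simp add: c_def power_add power2_eq_square)
  have c1: "c \<noteq> 1" using p1[of "2 * M + 2"] p0 by (auto simp: c_def)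
  have "c * p * p ^ (2 * M + 1) = 1" using cpow by (simp add: mult_ac)
  then have c2: "c * p \<noteq> 1" using p1[of "2 * M + 1"] by auto
  have ca: "c - a * p ^ (2 * j) \<noteq> 0" if "j \<le> ?N" for j
  proof
    assume "c - a * p ^ (2 * j) = 0"
    then have "a * p ^ (2 * j) * p ^ (2 * M + 2) = 1" using cpow by simp
    then have "a * p ^ (2 * (j + M + 1)) = 1" by (simp add: power_add mult_ac flip: power_mult)
    then show False using Suc.prems(1)[of "j + M + 1"] that by auto
  qed
  \<comment> \<open>A zero would mean \<open>a * p ^ (2 * j + 1) = p ^ (2 * M + 2)\<close>, so
    \<open>a\<close> would be an odd power of \<open>p\<close>, positive for
    \<open>j \<le> M\<close> and negative otherwise; \<open>a3\<close> and \<open>a2\<close> exclude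
    these cases.\<close>
  have ac: "1 - a * c * p ^ (2 * j + 1) \<noteq> 0" if j: "j \<le> ?N" for j
  proof
    assume "1 - a * c * p ^ (2 * j + 1) = 0"
    then have "p ^ (2 * M + 2) = a * (c * p ^ (2 * M + 2)) * p ^ (2 * j + 1)" by (simp add: mult_ac)
    then have *: "p ^ (2 * M + 2) = a * p ^ (2 * j + 1)" unfolding cpow by simp
    show False
    proof (cases "j \<le> M")
      case True
      have "2 * M + 2 = 2 * (M - j) + 1 + (2 * j + 1)" using True by simp
      then have "p ^ (2 * M + 2) = p ^ (2 * (M - j) + 1) * p ^ (2 * j + 1)" by (metis power_add)
      then have "a = p ^ (2 * (M - j) + 1)" using * p0 by simp
      then show False using Suc.prems(3)[of "M - j"] by (meson diff_le_self le_imp_less_Suc)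
    next
      case False
      have "2 * j + 1 = (2 * (j - M - 1) + 1) + (2 * M + 2)" using False by simp
      then have "p ^ (2 * j + 1) = p ^ (2 * (j - M - 1) + 1) * p ^ (2 * M + 2)" by (metis power_add)
      then have "a * p ^ (2 * (j - M - 1) + 1) = 1" using * p0 by (simp add: mult.commute)
      moreover have "j - M - 1 \<le> Suc M + 1" using j by simp
      ultimately show False using Suc.prems(2) by blast
    qed
  qed
  have da: "d - a * p ^ Suc j \<noteq> 0" if "j < ?N" for j
    using Suc.prems(4)[of "Suc j"] that by simp
  have "(\<Sum>k<?N. rterm p a c d k) * ((c * d - a) * (a * c * p - 1)) =
     (\<Sum>k<?N. rterm p a (c * p\<^sup>2) d k) * ((c - a) * (a * c * p - d)) + 0"
  proof -
    have z: "(\<Prod>j<?N. (1 - a * p ^ j) * (1 - c * p ^ j) * (c * p - p ^ j) * (1 - d * p ^ (2 * j)) * a * p ^ j /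
     ((1 - p ^ (2 * j + 2)) * (c - a * p ^ (2 * j)) * (1 - a * c * p ^ (2 * j + 3)) * (d - a * p ^ Suc j))) = 0"
      using cpow by (intro prod_zero bexI[of _ "2 * M + 2"]) simp_all
    have p1': "1 - p ^ (2 * j + 2) \<noteq> 0" for j using p1[of "2 * j + 2"] by simp
    show ?thesis
      by (rule rterm_sum_contiguous_b[where N = ?N, OF p0 c1 c2 p1' ca ac da, unfolded z mult_zero_right])
  qed
  moreover have "(\<Sum>k<?N. rterm p a (c * p\<^sup>2) d k) = (\<Sum>k<2 * M + 1. rterm p a (1 / p ^ (2 * M)) d k)"
    unfolding cp2 using p0 by (intro sum_lessThan_extend_zero rterm_eq_0_b[of _ _ "2 * M"]) auto
  ultimately have *: "(\<Sum>k<?N. rterm p a c d k) * ((c * d - a) * (a * c * p - 1)) =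
      (\<Sum>k<2 * M + 1. rterm p a (1 / p ^ (2 * M)) d k) * ((c - a) * (a * c * p - d))" by simp
  have nz1: "d - a * p ^ (2 * M + 2) \<noteq> 0" using Suc.prems(4)[of "2 * M + 2"] by simp
  have nz2: "a - p ^ (2 * M + 1) \<noteq> 0" using Suc.prems(3)[of M] by simp
  have e: "c * d - a = c * (d - a * p ^ (2 * M + 2))" "a * c * p - 1 = c * p * (a - p ^ (2 * M + 1))"
    "c - a = c * (1 - a * p ^ (2 * M + 2))" "a * c * p - d = c * p * (a - d * p ^ (2 * M + 1))"
    using cpow by (auto simp: algebra_simps)
  have "(\<Sum>k<?N. rterm p a c d k) = (\<Sum>k<2 * M + 1. rterm p a (1 / p ^ (2 * M)) d k) *
     ((1 - a * p ^ (2 * M + 2)) * (a - d * p ^ (2 * M + 1)) / ((d - a * p ^ (2 * M + 2)) * (a - p ^ (2 * M + 1))))"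
  proof -
    have "(\<Sum>k<?N. rterm p a c d k) * ((d - a * p ^ (2 * M + 2)) * (a - p ^ (2 * M + 1))) * (c * c * p) =
       (\<Sum>k<2 * M + 1. rterm p a (1 / p ^ (2 * M)) d k) * ((1 - a * p ^ (2 * M + 2)) * (a - d * p ^ (2 * M + 1))) * (c * c * p)"
      using * unfolding e by (simp only: mult_ac)
    then have "(\<Sum>k<?N. rterm p a c d k) * ((d - a * p ^ (2 * M + 2)) * (a - p ^ (2 * M + 1))) =
       (\<Sum>k<2 * M + 1. rterm p a (1 / p ^ (2 * M)) d k) * ((1 - a * p ^ (2 * M + 2)) * (a - d * p ^ (2 * M + 1)))"
      using c0 p0 by simp
    then show ?thesis using nz1 nz2 by (simp only: times_divide_eq_right) (metis mult_eq_0_iff nonzero_eq_divide_eq)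
  qed
  moreover have "(\<Sum>k<2 * M + 1. rterm p a (1 / p ^ (2 * M)) d k) =
    (1 - a) * (\<Prod>i<M. (1 - a * p ^ (2 * i + 2)) * (a - d * p ^ (2 * i + 1)) /
       ((d - a * p ^ (2 * i + 2)) * (a - p ^ (2 * i + 1))))"
    by (rule Suc.IH) (use Suc.prems in auto)
  ultimately show ?case unfolding c_def prod.lessThan_Suc by (simp only: mult.assoc)
qed

text \<open>Induction on \<open>m\<close> by \<open>rterm_sum_contiguous_d\<close>. The summands
  vanish already for \<open>k > m\<close>; the range up to \<open>2 * m\<close> is kept so that all
  three terminating cases concern the same sum.\<close>

lemma rterm_sum_terminating_d:
  fixes p a b :: "'a::field"
  assumes p0: "p \<noteq> 0" and p1: "\<And>i. i > 0 \<Longrightarrow> p ^ i \<noteq> 1" and b0: "b \<noteq> 0"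
    and a1: "\<And>i. 1 \<le> i \<Longrightarrow> i \<le> 4 * m + 1 \<Longrightarrow> a * p ^ i \<noteq> 1"
    and ba: "\<And>i. i \<le> 2 * m \<Longrightarrow> b \<noteq> a * p ^ (2 * i + 2)"
    and ab: "\<And>i. i \<le> 2 * m \<Longrightarrow> a * b * p ^ (2 * i + 1) \<noteq> 1"
  shows "(\<Sum>k<2 * m + 1. rterm p a b (1 / p ^ (2 * m)) k) =
    (1 - a) * (\<Prod>i<m. (1 - a * p ^ (2 * i + 1)) * (1 - a * p ^ (2 * i + 2)) * b /
       ((b - a * p ^ (2 * i + 2)) * (1 - a * b * p ^ (2 * i + 1))))"
  using a1 ba ab
proof (induction m)
  case 0
  then show ?case by simp
next
  case (Suc m)
  define e where "e = 1 / p ^ (2 * Suc m)"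
  let ?N = "2 * Suc m + 1"
  have e0: "e \<noteq> 0" using p0 by (simp add: e_def)
  have epow: "e * p ^ (2 * m + 2) = 1" using p0 by (simp add: e_def)
  have ep2: "e * p\<^sup>2 = 1 / p ^ (2 * m)"
    using p0 by (simp add: e_def power_add power2_eq_square)
  have e1: "e \<noteq> 1" using p1[of "2 * m + 2"] p0 by (auto simp: e_def)
  have ea: "e - a * p ^ j \<noteq> 0" if "j \<le> ?N" for j
  proof
    assume "e - a * p ^ j = 0"
    then have "a * p ^ j * p ^ (2 * m + 2) = 1" using epow by simp
    then have "a * p ^ (j + (2 * m + 2)) = 1" by (simp add: power_add mult_ac)
    then show False using Suc.prems(1)[of "j + (2 * m + 2)"] that by auto
  qed
  have ea': "e * p - a \<noteq> 0"
  proof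
    assume "e * p - a = 0"
    then have "a = e * p" by simp
    then have "a * p ^ (2 * m + 1) = 1" using epow by (simp add: mult.assoc)
    then show False using Suc.prems(1)[of "2 * m + 1"] by simp
  qed
  have ba: "b - a * p ^ (2 * j + 2) \<noteq> 0" if "j < ?N" for j
    using Suc.prems(2)[of j] that by simp
  have ab: "1 - a * b * p ^ (2 * j + 1) \<noteq> 0" if "j < ?N" for j
    using Suc.prems(3)[of j] that by simp
  have "(\<Sum>k<?N. rterm p a b e k) * ((b * e - a) * (e * p - a * b)) =
     (\<Sum>k<?N. rterm p a b (e * p\<^sup>2) k) * ((e * p - a) * (e - a) * b) + 0"
  proof -
    have z: "(\<Prod>j<?N. (1 - a * p ^ j) * (1 - b * p ^ j) * (b - p ^ Suc j) * (1 - e * p ^ (2 * j)) * a * p ^ j /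
     ((1 - p ^ (2 * j + 2)) * (b - a * p ^ (2 * j + 2)) * (1 - a * b * p ^ (2 * j + 1)) * (e * p - a * p ^ j))) = 0"
      using epow by (intro prod_zero bexI[of _ "m + 1"]) simp_all
    have p1': "1 - p ^ (2 * j + 2) \<noteq> 0" for j using p1[of "2 * j + 2"] by simp
    show ?thesis
      by (rule rterm_sum_contiguous_d[where N = ?N, OF p0 e1 b0 p1' ba ab ea ea', unfolded z mult_zero_right])
  qed
  moreover have "(\<Sum>k<?N. rterm p a b (e * p\<^sup>2) k) = (\<Sum>k<2 * m + 1. rterm p a b (1 / p ^ (2 * m)) k)"
    unfolding ep2 using p0 by (intro sum_lessThan_extend_zero rterm_eq_0_d[of _ _ m]) auto
  ultimately have *: "(\<Sum>k<?N. rterm p a b e k) * ((b * e - a) * (e * p - a * b)) =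
     (\<Sum>k<2 * m + 1. rterm p a b (1 / p ^ (2 * m)) k) * ((e * p - a) * (e - a) * b)" by simp
  have nz1: "b - a * p ^ (2 * m + 2) \<noteq> 0" using ba[of m] by simp
  have nz2: "1 - a * b * p ^ (2 * m + 1) \<noteq> 0" using ab[of m] by simp
  have e: "b * e - a = e * (b - a * p ^ (2 * m + 2))" "e * p - a * b = e * p * (1 - a * b * p ^ (2 * m + 1))"
    "e - a = e * (1 - a * p ^ (2 * m + 2))" "e * p - a = e * p * (1 - a * p ^ (2 * m + 1))"
    using epow by (auto simp: algebra_simps)
  have "(\<Sum>k<?N. rterm p a b e k) = (\<Sum>k<2 * m + 1. rterm p a b (1 / p ^ (2 * m)) k) *
     ((1 - a * p ^ (2 * m + 1)) * (1 - a * p ^ (2 * m + 2)) * b / ((b - a * p ^ (2 * m + 2)) * (1 - a * b * p ^ (2 * m + 1))))"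
  proof -
    have "(\<Sum>k<?N. rterm p a b e k) * ((b - a * p ^ (2 * m + 2)) * (1 - a * b * p ^ (2 * m + 1))) * (e * e * p) =
       (\<Sum>k<2 * m + 1. rterm p a b (1 / p ^ (2 * m)) k) * ((1 - a * p ^ (2 * m + 1)) * (1 - a * p ^ (2 * m + 2)) * b) * (e * e * p)"
      using * unfolding e by (simp only: mult_ac)
    then have "(\<Sum>k<?N. rterm p a b e k) * ((b - a * p ^ (2 * m + 2)) * (1 - a * b * p ^ (2 * m + 1))) =
       (\<Sum>k<2 * m + 1. rterm p a b (1 / p ^ (2 * m)) k) * ((1 - a * p ^ (2 * m + 1)) * (1 - a * p ^ (2 * m + 2)) * b)"
      using e0 p0 by simp
    then show ?thesis using nz1 nz2 by (simp only: times_divide_eq_right) (metis mult_eq_0_iff nonzero_eq_divide_eq)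
  qed
  moreover have "(\<Sum>k<2 * m + 1. rterm p a b (1 / p ^ (2 * m)) k) =
    (1 - a) * (\<Prod>i<m. (1 - a * p ^ (2 * i + 1)) * (1 - a * p ^ (2 * i + 2)) * b /
       ((b - a * p ^ (2 * i + 2)) * (1 - a * b * p ^ (2 * i + 1))))"
    by (rule Suc.IH) (use Suc.prems in auto)
  ultimately show ?case unfolding e_def prod.lessThan_Suc by (simp only: mult.assoc)
qed

section \<open>Rational functions regular over a subring\<close>

text \<open>
  The instance \<open>R = UNIV\<close>, \<open>t = 0\<close> is allowed and serves for density arguments over a field.
\<close>
locale adic_subring =
  fixes R :: "'a::field set" and t :: 'a
  assumes one_in: "1 \<in> R"
    and add_in: "x \<in> R \<Longrightarrow> y \<in> R \<Longrightarrow> x + y \<in> R"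
    and mult_in: "x \<in> R \<Longrightarrow> y \<in> R \<Longrightarrow> x * y \<in> R"
    and uminus_in: "x \<in> R \<Longrightarrow> - x \<in> R"
    and t_in: "t \<in> R"
    and unit_perturb: "u \<in> R \<Longrightarrow> u \<noteq> 0 \<Longrightarrow> inverse u \<in> R \<Longrightarrow> x \<in> R \<Longrightarrow> u + t * x \<noteq> 0 \<and> inverse (u + t * x) \<in> R"
begin

definition unit :: "'a \<Rightarrow> bool" where
  "unit u \<longleftrightarrow> u \<in> R \<and> u \<noteq> 0 \<and> inverse u \<in> R"

definition cong_mod :: "nat \<Rightarrow> 'a \<Rightarrow> 'a \<Rightarrow> bool" where
  "cong_mod k x y \<longleftrightarrow> (\<exists>r\<in>R. x - y = t ^ k * r)"

text \<open>Rational functions without a pole on the ideal of \<open>t\<close>: since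
  \<open>poly D 0\<close> is a unit, so is \<open>poly D x\<close> there. Agreement is required only
  off the zeros of \<open>D\<close>, because sums and products are brought to common denominators,
  which may vanish where \<open>f\<close> differs from the \<open>0\<close> of HOL division.\<close>

definition regular :: "('a \<Rightarrow> 'a) \<Rightarrow> bool" where
  "regular f \<longleftrightarrow> (\<exists>N D. (\<forall>i. coeff N i \<in> R) \<and> (\<forall>i. coeff D i \<in> R) \<and> unit (poly D 0) \<and>
     (\<forall>x. poly D x \<noteq> 0 \<longrightarrow> f x = poly N x / poly D x))"

lemma zero_in: "0 \<in> R"
  using add_in[OF one_in uminus_in[OF one_in]] by simp

lemma diff_in: "x \<in> R \<Longrightarrow> y \<in> R \<Longrightarrow> x - y \<in> R"
  using add_in[OF _ uminus_in] by fastforce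

lemma power_in: "x \<in> R \<Longrightarrow> x ^ k \<in> R"
  by (induction k) (auto intro: one_in mult_in)

lemma sum_in: "(\<And>i. i \<in> A \<Longrightarrow> f i \<in> R) \<Longrightarrow> sum f A \<in> R"
  by (induction A rule: infinite_finite_induct) (auto intro: zero_in add_in)

lemma prod_in: "(\<And>i. i \<in> A \<Longrightarrow> f i \<in> R) \<Longrightarrow> prod f A \<in> R"
  by (induction A rule: infinite_finite_induct) (auto intro: one_in mult_in)

lemma unit_in: "unit u \<Longrightarrow> u \<in> R" by (simp add: unit_def)

lemma unit_nonzero: "unit u \<Longrightarrow> u \<noteq> 0" by (simp add: unit_def)

lemma unit_mult: "unit u \<Longrightarrow> unit v \<Longrightarrow> unit (u * v)"
  by (auto simp: unit_def intro: mult_in)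

lemma unit_inverse: "unit u \<Longrightarrow> unit (inverse u)"
  by (auto simp: unit_def)

lemma unit_uminus: "unit u \<Longrightarrow> unit (- u)"
  by (auto simp: unit_def intro: uminus_in)

lemma unit_1: "unit 1" by (simp add: unit_def one_in)

lemma unit_divide: "unit u \<Longrightarrow> unit v \<Longrightarrow> unit (u / v)"
  by (simp add: divide_inverse unit_mult unit_inverse)

lemma unit_power: "unit u \<Longrightarrow> unit (u ^ k)"
  by (induction k) (auto intro: unit_1 unit_mult)

lemma divide_in: "x \<in> R \<Longrightarrow> unit u \<Longrightarrow> x / u \<in> R"
  by (simp add: divide_inverse unit_def mult_in)

lemma cong_modI: "x - y = t ^ k * r \<Longrightarrow> r \<in> R \<Longrightarrow> cong_mod k x y"
  unfolding cong_mod_def by blast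

lemma cong_mod_refl: "cong_mod k x x"
  by (rule cong_modI[of _ _ _ 0]) (auto intro: zero_in)

lemma cong_mod_sym: "cong_mod k x y \<Longrightarrow> cong_mod k y x"
  unfolding cong_mod_def by (metis minus_diff_eq mult_minus_right uminus_in)

lemma cong_mod_trans [trans]: "cong_mod k x y \<Longrightarrow> cong_mod k y z \<Longrightarrow> cong_mod k x z"
proof -
  assume "cong_mod k x y" "cong_mod k y z"
  then obtain r s where "x - y = t ^ k * r" "y - z = t ^ k * s" "r \<in> R" "s \<in> R"
    unfolding cong_mod_def by blast
  then show ?thesis by (intro cong_modI[of _ _ _ "r + s"]) (auto simp: algebra_simps intro: add_in)
qed

lemma cong_mod_add: "cong_mod k x y \<Longrightarrow> cong_mod k x' y' \<Longrightarrow> cong_mod k (x + x') (y + y')"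
proof -
  assume "cong_mod k x y" "cong_mod k x' y'"
  then obtain r s where "x - y = t ^ k * r" "x' - y' = t ^ k * s" "r \<in> R" "s \<in> R"
    unfolding cong_mod_def by blast
  then show ?thesis by (intro cong_modI[of _ _ _ "r + s"]) (auto simp: algebra_simps intro: add_in)
qed

lemma cong_mod_mult:
  assumes "cong_mod k x y" "cong_mod k x' y'" "x' \<in> R" "y \<in> R"
  shows "cong_mod k (x * x') (y * y')"
proof -
  obtain r s where r: "x - y = t ^ k * r" "x' - y' = t ^ k * s" "r \<in> R" "s \<in> R"
    using assms unfolding cong_mod_def by blast
  have "x * x' - y * y' = (x - y) * x' + y * (x' - y')" by (simp add: algebra_simps)
  also have "\<dots> = t ^ k * (r * x' + y * s)" unfolding r by (simp add: algebra_simps)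
  finally show ?thesis by (rule cong_modI) (use r assms in \<open>auto intro: add_in mult_in\<close>)
qed

lemma cong_mod_prod:
  assumes "\<And>i. i \<in> A \<Longrightarrow> cong_mod k (f i) (g i)" "\<And>i. i \<in> A \<Longrightarrow> f i \<in> R" "\<And>i. i \<in> A \<Longrightarrow> g i \<in> R"
  shows "cong_mod k (prod f A) (prod g A)"
  using assms
  by (induction A rule: infinite_finite_induct) (auto intro!: cong_mod_refl cong_mod_mult prod_in)

lemma cong_mod_0_mult: "cong_mod i x 0 \<Longrightarrow> cong_mod j y 0 \<Longrightarrow> cong_mod (i + j) (x * y) 0"
  unfolding cong_mod_def by (auto simp: power_add) (metis mult.assoc mult.left_commute mult_in)

lemma cong_mod_0_mult_in: "cong_mod i x 0 \<Longrightarrow> y \<in> R \<Longrightarrow> cong_mod i (x * y) 0"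
  using cong_mod_0_mult[of i x 0 y] by (auto simp: cong_mod_def)

text \<open>\<open>unit_perturb\<close> places \<open>t\<close> in the Jacobson radical, so
  invertibility can be read off modulo \<open>t\<close>.\<close>

lemma unit_cong: "unit u \<Longrightarrow> cong_mod 1 v u \<Longrightarrow> unit v"
proof -
  assume u: "unit u" and "cong_mod 1 v u"
  then obtain r where r: "v = u + t * r" "r \<in> R"
    by (auto simp: cong_mod_def algebra_simps)
  show ?thesis unfolding unit_def using unit_perturb[of u r] u r
    by (auto simp: unit_def intro: add_in mult_in t_in)
qed

lemma poly_coeffs_in: "(\<And>i. coeff N i \<in> R) \<Longrightarrow> x \<in> R \<Longrightarrow> poly N x \<in> R"
  unfolding poly_altdef by (intro sum_in mult_in power_in) auto

lemma coeffs_mult_in: "(\<And>i. coeff N i \<in> R) \<Longrightarrow> (\<And>i. coeff D i \<in> R) \<Longrightarrow> coeff (N * D) i \<in> R"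
  unfolding coeff_mult by (intro sum_in mult_in) auto

lemma regularI:
  assumes "\<And>i. coeff N i \<in> R" "\<And>i. coeff D i \<in> R" "unit (poly D 0)"
    "\<And>x. poly D x \<noteq> 0 \<Longrightarrow> f x = poly N x / poly D x"
  shows "regular f"
  unfolding regular_def using assms by blast

lemma regularE:
  assumes "regular f"
  obtains N D where "\<And>i. coeff N i \<in> R" "\<And>i. coeff D i \<in> R" "unit (poly D 0)"
    "\<And>x. poly D x \<noteq> 0 \<Longrightarrow> f x = poly N x / poly D x"
  using assms unfolding regular_def by blast

lemma regular_const: "c \<in> R \<Longrightarrow> regular (\<lambda>_. c)"
  by (rule regularI[of "[:c:]" 1]) (auto simp: coeff_pCons unit_1 intro: zero_in one_in split: nat.split)

lemma regular_id: "regular (\<lambda>x. x)"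
  by (rule regularI[of "[:0, 1:]" 1]) (auto simp: coeff_pCons unit_1 intro: zero_in one_in split: nat.split)

lemma regular_add:
  assumes "regular f" "regular g"
  shows "regular (\<lambda>x. f x + g x)"
proof -
  obtain N D where 1: "\<And>i. coeff N i \<in> R" "\<And>i. coeff D i \<in> R" "unit (poly D 0)"
    "\<And>x. poly D x \<noteq> 0 \<Longrightarrow> f x = poly N x / poly D x" using assms(1) by (rule regularE) blast
  obtain N' D' where 2: "\<And>i. coeff N' i \<in> R" "\<And>i. coeff D' i \<in> R" "unit (poly D' 0)"
    "\<And>x. poly D' x \<noteq> 0 \<Longrightarrow> g x = poly N' x / poly D' x" using assms(2) by (rule regularE) blast
  show ?thesis
  proof (rule regularI[of "N * D' + N' * D" "D * D'"])
    show "coeff (N * D' + N' * D) i \<in> R" for i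
      unfolding coeff_add by (intro add_in coeffs_mult_in 1 2)
  qed (auto intro!: coeffs_mult_in unit_mult 1 2 simp: 1(4) 2(4) add_frac_eq)
qed

lemma regular_mult:
  assumes "regular f" "regular g"
  shows "regular (\<lambda>x. f x * g x)"
proof -
  obtain N D where 1: "\<And>i. coeff N i \<in> R" "\<And>i. coeff D i \<in> R" "unit (poly D 0)"
    "\<And>x. poly D x \<noteq> 0 \<Longrightarrow> f x = poly N x / poly D x" using assms(1) by (rule regularE) blast
  obtain N' D' where 2: "\<And>i. coeff N' i \<in> R" "\<And>i. coeff D' i \<in> R" "unit (poly D' 0)"
    "\<And>x. poly D' x \<noteq> 0 \<Longrightarrow> g x = poly N' x / poly D' x" using assms(2) by (rule regularE) blast
  show ?thesis
    by (rule regularI[of "N * N'" "D * D'"]) (auto intro!: coeffs_mult_in unit_mult 1 2 simp: 1(4) 2(4))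
qed

lemma regular_inverse:
  assumes "regular f" "unit (f 0)"
  shows "regular (\<lambda>x. inverse (f x))"
proof -
  obtain N D where 1: "\<And>i. coeff N i \<in> R" "\<And>i. coeff D i \<in> R" "unit (poly D 0)"
    "\<And>x. poly D x \<noteq> 0 \<Longrightarrow> f x = poly N x / poly D x" using assms(1) by (rule regularE) blast
  have "poly N 0 = f 0 * poly D 0" using 1(4)[of 0] unit_nonzero[OF 1(3)] by simp
  then have "unit (poly N 0)" using assms(2) 1(3) unit_mult by simp
  then show ?thesis
    by (intro regularI[of "D * D" "N * D"]) (auto intro!: coeffs_mult_in unit_mult 1 simp: 1(4))
qed

lemma regular_uminus: "regular f \<Longrightarrow> regular (\<lambda>x. - f x)"
  using regular_mult[OF regular_const[OF uminus_in[OF one_in]], of f] by simp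

lemma regular_diff: "regular f \<Longrightarrow> regular g \<Longrightarrow> regular (\<lambda>x. f x - g x)"
  using regular_add[OF _ regular_uminus, of f g] by simp

lemma regular_divide: "regular f \<Longrightarrow> regular g \<Longrightarrow> unit (g 0) \<Longrightarrow> regular (\<lambda>x. f x / g x)"
  unfolding divide_inverse by (intro regular_mult regular_inverse)

lemma regular_prod: "(\<And>i. i \<in> A \<Longrightarrow> regular (f i)) \<Longrightarrow> regular (\<lambda>x. \<Prod>i\<in>A. f i x)"
  by (induction A rule: infinite_finite_induct) (auto intro: regular_const one_in regular_mult)

lemma regular_sum: "(\<And>i. i \<in> A \<Longrightarrow> regular (f i)) \<Longrightarrow> regular (\<lambda>x. \<Sum>i\<in>A. f i x)"
  by (induction A rule: infinite_finite_induct) (auto intro: regular_const zero_in regular_add)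

text \<open>Division by the monic polynomial \<open>X - s\<close> needs no inverses, so the quotient
  keeps its coefficients in \<open>R\<close>. The induction is the Horner scheme.\<close>

lemma poly_factor_in:
  assumes "\<And>i. coeff N i \<in> R" "s \<in> R"
  shows "\<exists>Q. (\<forall>i. coeff Q i \<in> R) \<and> N = [:-s, 1:] * Q + [:poly N s:]"
  using assms(1)
proof (induction N)
  case 0
  then show ?case by (intro exI[of _ 0]) (auto intro: zero_in)
next
  case (pCons c N)
  have N: "coeff N i \<in> R" for i using pCons.prems[of "Suc i"] by simp
  then obtain Q where Q: "\<And>i. coeff Q i \<in> R" "N = [:-s, 1:] * Q + [:poly N s:]"
    using pCons.IH by blast
  let ?Q = "pCons (poly N s) Q"
  have "pCons c N = [:c:] + [:0, 1:] * N" by simp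
  also have "\<dots> = [:c:] + [:0, 1:] * ([:-s, 1:] * Q + [:poly N s:])" using Q(2) by simp
  also have "\<dots> = [:-s, 1:] * ?Q + [:poly (pCons c N) s:]" by simp
  finally show ?case using Q(1) poly_coeffs_in[of N s] N assms(2)
    by (intro exI[of _ ?Q]) (auto simp: coeff_pCons split: nat.split)
qed

lemma regular_denominator_unit:
  assumes "\<And>i. coeff D i \<in> R" "unit (poly D 0)" "cong_mod 1 x 0"
  shows "unit (poly D x)"
proof -
  obtain r where r: "r \<in> R" "x = t * r" using assms(3) by (auto simp: cong_mod_def)
  obtain Q where Q: "\<And>i. coeff Q i \<in> R" "D = [:-0, 1:] * Q + [:poly D 0:]"
    using poly_factor_in[of D 0] assms zero_in by blast
  have "poly D x = x * poly Q x + poly D 0" by (subst Q(2)) simp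
  then have "poly D x - poly D 0 = t ^ 1 * (r * poly Q x)" using r by simp
  moreover have "r * poly Q x \<in> R" using r Q(1) by (auto intro!: mult_in poly_coeffs_in t_in)
  ultimately show ?thesis by (intro unit_cong[OF assms(2)] cong_modI)
qed

lemma cong_0_in: "cong_mod 1 x 0 \<Longrightarrow> x \<in> R"
  by (auto simp: cong_mod_def intro: mult_in t_in)

lemma regular_in: "regular f \<Longrightarrow> cong_mod 1 x 0 \<Longrightarrow> f x \<in> R"
proof (erule regularE)
  fix N D assume x: "cong_mod 1 x 0" and 1: "\<And>i. coeff N i \<in> R" "\<And>i. coeff D i \<in> R" "unit (poly D 0)"
    "\<And>x. poly D x \<noteq> 0 \<Longrightarrow> f x = poly N x / poly D x"
  have D: "unit (poly D x)" by (rule regular_denominator_unit[OF 1(2,3) x])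
  show "f x \<in> R" unfolding 1(4)[OF unit_nonzero[OF D]]
    by (intro divide_in poly_coeffs_in 1 D cong_0_in x)
qed

text \<open>Only the numerator is divided. The factorisation is claimed on the ideal of
  \<open>t\<close>, where the denominator is a unit and \<open>f\<close> really is the
  quotient.\<close>

lemma regular_factor_root:
  assumes "regular f" "cong_mod 1 s 0" "f s = 0"
  obtains g where "regular g" "\<And>x. cong_mod 1 x 0 \<Longrightarrow> f x = (x - s) * g x"
proof -
  obtain N D where 1: "\<And>i. coeff N i \<in> R" "\<And>i. coeff D i \<in> R" "unit (poly D 0)"
    "\<And>x. poly D x \<noteq> 0 \<Longrightarrow> f x = poly N x / poly D x" using assms(1) by (rule regularE) blast
  note Du = regular_denominator_unit[OF 1(2,3), THEN unit_nonzero]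
  have "poly N s = 0" using 1(4)[OF Du[OF assms(2)]] Du[OF assms(2)] assms(3) by simp
  then obtain Q where Q: "\<And>i. coeff Q i \<in> R" "N = [:-s, 1:] * Q"
    using poly_factor_in[of N s] 1(1) cong_0_in[OF assms(2)] by auto
  have "regular (\<lambda>x. poly Q x / poly D x)"
    by (rule regularI[of Q D]) (use Q 1 in auto)
  moreover have "f x = (x - s) * (poly Q x / poly D x)" if "cong_mod 1 x 0" for x
    using 1(4)[OF Du[OF that]] by (simp add: Q(2) algebra_simps)
  ultimately show ?thesis using that by blast
qed

text \<open>The function \<open>f z - f x\<close> has the root \<open>z = x\<close>; splitting it
  off and setting \<open>z = 0\<close> exhibits \<open>f x - f 0\<close> as a multiple of
  \<open>x\<close>.\<close>

lemma regular_cong: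
  assumes "regular f" "cong_mod 1 x 0"
  shows "cong_mod 1 (f x) (f 0)"
proof -
  have fx: "f x \<in> R" using assms by (rule regular_in)
  obtain g where g: "regular g" "\<And>z. cong_mod 1 z 0 \<Longrightarrow> f z - f x = (z - x) * g z"
    using regular_factor_root[of "\<lambda>z. f z - f x" x] assms fx regular_diff regular_const by auto
  have "f x - f 0 = x * g 0" using g(2)[OF cong_mod_refl] by (simp add: algebra_simps)
  then show ?thesis using cong_mod_0_mult_in[OF assms(2), of "g 0"] regular_in[OF g(1) cong_mod_refl]
    by (simp add: cong_mod_def)
qed

text \<open>Splitting off one root after the other gives \<open>f 0 = - s1 * s2 * s3 * k 0\<close>,
  and each root contributes one factor \<open>t\<close>. Distinctness passes the remaining roots on
  to the quotient.\<close>

lemma regular_three_roots: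
  assumes f: "regular f" and s: "cong_mod 1 s1 0" "cong_mod 1 s2 0" "cong_mod 1 s3 0"
    and dist: "s1 \<noteq> s2" "s1 \<noteq> s3" "s2 \<noteq> s3" and z: "f s1 = 0" "f s2 = 0" "f s3 = 0"
  shows "cong_mod 3 (f 0) 0"
proof -
  obtain g where g: "regular g" "\<And>x. cong_mod 1 x 0 \<Longrightarrow> f x = (x - s1) * g x"
    using regular_factor_root[OF f s(1) z(1)] by blast
  have "g s2 = 0" "g s3 = 0" using g(2)[OF s(2)] g(2)[OF s(3)] z dist by auto
  then obtain h where h: "regular h" "\<And>x. cong_mod 1 x 0 \<Longrightarrow> g x = (x - s2) * h x"
    using regular_factor_root[OF g(1) s(2)] by blast
  have "h s3 = 0" using h(2)[OF s(3)] \<open>g s3 = 0\<close> dist by auto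
  then obtain k where k: "regular k" "\<And>x. cong_mod 1 x 0 \<Longrightarrow> h x = (x - s3) * k x"
    using regular_factor_root[OF h(1) s(3)] by blast
  have "f 0 = s1 * s2 * s3 * (- k 0)"
    using g(2)[OF cong_mod_refl] h(2)[OF cong_mod_refl] k(2)[OF cong_mod_refl] by simp
  moreover have "cong_mod (1 + 1 + 1) (s1 * s2 * s3) 0" by (intro cong_mod_0_mult s)
  ultimately show ?thesis
    using cong_mod_0_mult_in[of "1 + 1 + 1" "s1 * s2 * s3" "- k 0"] regular_in[OF k(1) cong_mod_refl] uminus_in
    by (simp add: numeral_3_eq_3)
qed

text \<open>The identity principle behind the density arguments: a nonzero numerator has only
  finitely many roots.\<close>

lemma regular_infinite_zeros:
  assumes "regular f" "infinite {x. f x = 0}"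
  shows "f 0 = 0"
proof -
  obtain N D where 1: "unit (poly D 0)" "\<And>x. poly D x \<noteq> 0 \<Longrightarrow> f x = poly N x / poly D x"
    using assms(1) by (rule regularE) blast
  have "D \<noteq> 0" using unit_nonzero[OF 1(1)] by auto
  have "N = 0"
  proof (rule ccontr)
    assume "N \<noteq> 0"
    then have "finite ({x. poly N x = 0} \<union> {x. poly D x = 0})"
      using \<open>D \<noteq> 0\<close> by (simp add: poly_roots_finite)
    moreover have "{x. f x = 0} \<subseteq> {x. poly N x = 0} \<union> {x. poly D x = 0}" using 1(2) by auto
    ultimately show False using assms(2) finite_subset by blast
  qed
  then show ?thesis using 1(2)[of 0] unit_nonzero[OF 1(1)] by simp
qed

end

section \<open>Termination in \<open>a\<close> by density\<close>

context adic_subring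
begin

lemma regular_rterm:
  assumes p: "p \<in> R" and reg: "regular a" "regular b" "regular d"
    and u: "\<And>j. j < k \<Longrightarrow> unit (1 - p ^ (2 * j + 2))" "\<And>j. j < k \<Longrightarrow> unit (b 0 - a 0 * p ^ (2 * j + 2))"
      "\<And>j. j < k \<Longrightarrow> unit (1 - a 0 * b 0 * p ^ (2 * j + 1))" "\<And>j. j < k \<Longrightarrow> unit (d 0 - a 0 * p ^ Suc j)"
  shows "regular (\<lambda>x. rterm p (a x) (b x) (d x) k)"
  unfolding rterm_def
  by (intro regular_mult regular_prod regular_divide regular_diff regular_const reg one_in power_in p unit_mult u) auto

end

lemma power_inj_of_not_root_of_unity:
  fixes p :: "'a::field"
  assumes p0: "p \<noteq> 0" and p1: "\<And>i. i > 0 \<Longrightarrow> p ^ i \<noteq> 1"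
  shows "p ^ i = p ^ j \<longleftrightarrow> i = j"
proof -
  have *: "p ^ i \<noteq> p ^ j" if "i < j" for i j
  proof
    assume "p ^ i = p ^ j"
    also have "p ^ j = p ^ i * p ^ (j - i)" using that by (simp flip: power_add)
    finally show False using p0 p1[of "j - i"] that by simp
  qed
  show ?thesis using *[of i j] *[of j i] by (cases i j rule: linorder_cases) auto
qed

lemma infinite_cofinite_field:
  fixes p a :: "'a::field"
  assumes p0: "p \<noteq> 0" and p1: "\<And>i. i > 0 \<Longrightarrow> p ^ i \<noteq> 1"
    and fin: "finite B" and B: "\<And>x. x \<notin> S \<Longrightarrow> a + x \<in> B"
  shows "infinite S"
proof
  assume "finite S"
  have "- S \<subseteq> (\<lambda>y. y - a) ` B"
  proof
    fix x assume "x \<in> - S"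
    then have "a + x \<in> B" using B by simp
    then show "x \<in> (\<lambda>y. y - a) ` B" by (rule rev_image_eqI) simp
  qed
  then have "finite (- S)" using fin finite_surj by blast
  then have "finite (UNIV :: 'a set)" using \<open>finite S\<close> by (metis Compl_partition finite_UnI)
  moreover have "inj (\<lambda>i. p ^ i)"
    using power_inj_of_not_root_of_unity[OF p0 p1] by (auto simp: inj_def)
  then have "infinite (range (\<lambda>i. p ^ i))" by (rule range_inj_infinite)
  ultimately show False using finite_subset[OF subset_UNIV] by blast
qed

text \<open>The value \<open>a = p^(-2m)\<close> is in general outside the scope of
  \<open>rterm_sum_terminating_b\<close>, but both sides are regular in \<open>a\<close> there and
  agree for all but finitely many \<open>a\<close>, so the identity extends. The closed product is
  then 0 through its factor \<open>1 - a * p ^ (2 * i + 2)\<close> with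
  \<open>i = m - 1 < M\<close>, or through \<open>1 - a\<close> if \<open>m = 0\<close>.\<close>

lemma rterm_sum_terminating_ab:
  fixes p d :: "'a::field"
  assumes p0: "p \<noteq> 0" and p1: "\<And>i. i > 0 \<Longrightarrow> p ^ i \<noteq> 1"
    and mM: "m \<le> M"
    and d: "\<And>i. d * p ^ (2 * m) \<noteq> p ^ Suc i"
  shows "(\<Sum>k<2 * M + 1. rterm p (1 / p ^ (2 * m)) (1 / p ^ (2 * M)) d k) = 0"
proof -
  interpret F: adic_subring "UNIV :: 'a set" 0 by unfold_locales auto
  have Funit: "F.unit u \<longleftrightarrow> u \<noteq> 0" for u by (simp add: F.unit_def)
  note pinj = power_inj_of_not_root_of_unity[OF p0 p1]
  define a where "a = 1 / p ^ (2 * m)"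
  define b where "b = 1 / p ^ (2 * M)"
  have am: "a * p ^ (2 * m) = 1" using p0 by (simp add: a_def)
  have bM: "b * p ^ (2 * M) = 1" using p0 by (simp add: b_def)
  have da: "d - a * p ^ Suc i \<noteq> 0" for i
  proof
    assume "d - a * p ^ Suc i = 0"
    then have "d * p ^ (2 * m) = (a * p ^ (2 * m)) * p ^ Suc i" by (simp add: mult_ac)
    then show False using d[of i] am by simp
  qed
  have ba: "b - a * p ^ (2 * j + 2) \<noteq> 0" for j
  proof
    assume "b - a * p ^ (2 * j + 2) = 0"
    then have "(b * p ^ (2 * M)) * p ^ (2 * m) = (a * p ^ (2 * m)) * p ^ (2 * j + 2) * p ^ (2 * M)"
      by (simp add: mult_ac)
    then have "p ^ (2 * m) = p ^ (2 * j + 2 + 2 * M)" unfolding am bM by (simp add: power_add)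
    then have "2 * m = 2 * j + 2 + 2 * M" by (simp only: pinj)
    then show False using mM by simp
  qed
  have ab: "1 - a * b * p ^ (2 * j + 1) \<noteq> 0" for j
  proof
    assume "1 - a * b * p ^ (2 * j + 1) = 0"
    then have "p ^ (2 * M) * p ^ (2 * m) = (a * p ^ (2 * m)) * (b * p ^ (2 * M)) * p ^ (2 * j + 1)"
      by (simp add: mult_ac)
    then have "p ^ (2 * M + 2 * m) = p ^ (2 * j + 1)" unfolding am bM by (simp add: power_add)
    then have "2 * M + 2 * m = 2 * j + 1" by (simp only: pinj)
    then show False by presburger
  qed
  have ap: "a - p ^ (2 * i + 1) \<noteq> 0" for i
  proof
    assume "a - p ^ (2 * i + 1) = 0"
    then have "p ^ (2 * i + 1) * p ^ (2 * m) = 1" using am by simp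
    then have "p ^ (2 * i + 1 + 2 * m) = 1" by (simp only: power_add)
    then show False using p1[of "2 * i + 1 + 2 * m"] by simp
  qed
  let ?f = "\<lambda>x. (\<Sum>k<2 * M + 1. rterm p (a + x) b d k) -
    (1 - (a + x)) * (\<Prod>i<M. (1 - (a + x) * p ^ (2 * i + 2)) * ((a + x) - d * p ^ (2 * i + 1)) /
       ((d - (a + x) * p ^ (2 * i + 2)) * ((a + x) - p ^ (2 * i + 1))))"
  have "F.regular ?f"
  proof (intro F.regular_diff F.regular_sum F.regular_rterm F.regular_mult F.regular_prod F.regular_divide
      F.regular_add F.regular_const F.regular_id F.unit_mult UNIV_I)
    fix j
    show "F.unit (1 - p ^ (2 * j + 2))" using p1[of "2 * j + 2"] by (simp add: Funit)
    show "F.unit (b - (a + 0) * p ^ (2 * j + 2))" using ba[of j] by (simp add: Funit)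
    show "F.unit (1 - (a + 0) * b * p ^ (2 * j + 1))" using ab[of j] by (simp add: Funit)
    show "F.unit (d - (a + 0) * p ^ Suc j)" using da[of j] by (simp add: Funit)
    show "F.unit (d - (a + 0) * p ^ (2 * j + 2))" using da[of "2 * j + 1"] by (simp add: Funit)
    show "F.unit (a + 0 - p ^ (2 * j + 1))" using ap[of j] by (simp add: Funit)
  qed
  moreover have "infinite {x. ?f x = 0}"
  proof -
    \<comment> \<open>These values of \<open>a\<close> cover all exceptions of
      \<open>rterm_sum_terminating_b\<close>; the bound \<open>6 * M + 3\<close> serves its even
      exponents, up to \<open>6 * M + 2\<close>, and its odd ones, up to \<open>2 * M + 3\<close>,
      at once.\<close>
    define B where "B = (\<lambda>i. 1 / p ^ i) ` {..6 * M + 3} \<union> (\<lambda>i. p ^ i) ` {..2 * M + 1} \<union> (\<lambda>i. d / p ^ i) ` {..2 * M + 1}"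
    have "?f x = 0" if "a + x \<notin> B" for x
    proof -
      have 1: "(a + x) * p ^ i \<noteq> 1" if "i \<le> 6 * M + 3" for i
      proof
        assume "(a + x) * p ^ i = 1"
        then have "a + x = 1 / p ^ i" using p0 by (simp add: field_simps)
        then show False using \<open>a + x \<notin> B\<close> that by (auto simp: B_def)
      qed
      have 2: "a + x \<noteq> p ^ i" if "i \<le> 2 * M + 1" for i
        using \<open>a + x \<notin> B\<close> that by (auto simp: B_def)
      have 3: "d \<noteq> (a + x) * p ^ i" if "i \<le> 2 * M + 1" for i
      proof
        assume "d = (a + x) * p ^ i"
        then have "a + x = d / p ^ i" using p0 by (simp add: field_simps)
        then show False using \<open>a + x \<notin> B\<close> that by (auto simp: B_def)
      qed
      have h1: "(a + x) * p ^ (2 * i) \<noteq> 1" if "1 \<le> i" "i \<le> 3 * M + 1" for i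
        by (rule 1) (use that in simp)
      have h2: "(a + x) * p ^ (2 * i + 1) \<noteq> 1" if "i \<le> M + 1" for i
        by (rule 1) (use that in simp)
      have h3: "a + x \<noteq> p ^ (2 * i + 1)" if "i < M" for i
        by (rule 2) (use that in simp)
      have h4: "d \<noteq> (a + x) * p ^ i" if "1 \<le> i" "i \<le> 2 * M + 1" for i
        by (rule 3) (use that in simp)
      have "(\<Sum>k<2 * M + 1. rterm p (a + x) b d k) =
        (1 - (a + x)) * (\<Prod>i<M. (1 - (a + x) * p ^ (2 * i + 2)) * ((a + x) - d * p ^ (2 * i + 1)) /
         ((d - (a + x) * p ^ (2 * i + 2)) * ((a + x) - p ^ (2 * i + 1))))"
        unfolding b_def by (rule rterm_sum_terminating_b[where M = M, OF p0 p1 h1 h2 h3 h4])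
      then show ?thesis by simp
    qed
    then have B: "a + x \<in> B" if "x \<notin> {x. ?f x = 0}" for x using that by blast
    show ?thesis
    proof (rule infinite_cofinite_field[OF p0 p1 _ B])
      show "finite B" by (simp add: B_def)
    qed
  qed
  ultimately have "?f 0 = 0" by (rule F.regular_infinite_zeros)
  moreover have "(1 - (a + 0)) * (\<Prod>i<M. (1 - (a + 0) * p ^ (2 * i + 2)) * ((a + 0) - d * p ^ (2 * i + 1)) /
       ((d - (a + 0) * p ^ (2 * i + 2)) * ((a + 0) - p ^ (2 * i + 1)))) = 0"
  proof (cases m)
    case 0
    then show ?thesis by (simp add: a_def)
  next
    case (Suc m')
    then have "1 - (a + 0) * p ^ (2 * m' + 2) = 0" using am by simp
    moreover have "m' < M" using mM Suc by simp
    ultimately show ?thesis by (intro mult_eq_0_iff[THEN iffD2] disjI2 prod_zero bexI[of _ m']) auto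
  qed
  ultimately show ?thesis unfolding a_def[symmetric] b_def[symmetric] by simp
qed

text \<open>For fixed \<open>a = p^(-2m)\<close> the number of terms does not depend on
  \<open>b\<close>, and the sum is regular in \<open>b\<close>. By
  \<open>rterm_sum_terminating_ab\<close> it vanishes at \<open>b = p^(-2M)\<close> for all
  \<open>M \<ge> m\<close>, hence at the given \<open>b\<close>.\<close>

lemma rterm_sum_terminating_a:
  fixes p b d :: "'a::field"
  assumes p0: "p \<noteq> 0" and p1: "\<And>i. i > 0 \<Longrightarrow> p ^ i \<noteq> 1"
    and a: "a * p ^ (2 * m) = 1"
    and d: "\<And>i. d * p ^ (2 * m) \<noteq> p ^ Suc i"
    and ba: "\<And>j. j < 2 * m \<Longrightarrow> b \<noteq> a * p ^ (2 * j + 2)"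
    and ab: "\<And>j. j < 2 * m \<Longrightarrow> a * b * p ^ (2 * j + 1) \<noteq> 1"
  shows "(\<Sum>k<2 * m + 1. rterm p a b d k) = 0"
proof -
  interpret F: adic_subring "UNIV :: 'a set" 0 by unfold_locales auto
  have Funit: "F.unit u \<longleftrightarrow> u \<noteq> 0" for u by (simp add: F.unit_def)
  note pinj = power_inj_of_not_root_of_unity[OF p0 p1]
  have a_eq: "a = 1 / p ^ (2 * m)" using a p0 by (simp add: field_simps)
  have da: "d - a * p ^ Suc i \<noteq> 0" for i
  proof
    assume "d - a * p ^ Suc i = 0"
    then have "d * p ^ (2 * m) = (a * p ^ (2 * m)) * p ^ Suc i" by (simp add: mult_ac)
    then show False using d[of i] a by simp
  qed
  let ?f = "\<lambda>x. \<Sum>k<2 * m + 1. rterm p a (b + x) d k"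
  have "F.regular ?f"
  proof (intro F.regular_sum F.regular_rterm F.regular_add F.regular_const F.regular_id UNIV_I)
    fix k j assume "k \<in> {..<2 * m + 1}" "j < k"
    then have j: "j < 2 * m" by simp
    show "F.unit (1 - p ^ (2 * j + 2))" using p1[of "2 * j + 2"] by (simp add: Funit)
    show "F.unit (b + 0 - a * p ^ (2 * j + 2))" using ba[OF j] by (simp add: Funit)
    show "F.unit (1 - a * (b + 0) * p ^ (2 * j + 1))" using ab[OF j] by (simp add: Funit)
    show "F.unit (d - a * p ^ Suc j)" using da[of j] by (simp add: Funit)
  qed
  moreover have "infinite {x. ?f x = 0}"
  proof -
    let ?g = "\<lambda>M. 1 / p ^ (2 * M) - b"
    have "?f (?g M) = 0" if "m \<le> M" for M
    proof -
      have "?f (?g M) = (\<Sum>k<2 * M + 1. rterm p a (b + ?g M) d k)"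
        using a that by (intro sum_lessThan_extend_zero[symmetric] rterm_eq_0_a[of _ _ "2 * m"]) auto
      also have "\<dots> = 0" using rterm_sum_terminating_ab[OF p0 p1 that d] unfolding a_eq by simp
      finally show ?thesis .
    qed
    then have "?g ` {m..} \<subseteq> {x. ?f x = 0}" by auto
    moreover have "inj ?g" using p0 pinj by (auto simp: inj_def)
    then have "infinite (?g ` {m..})"
      using finite_imageD[of ?g "{m..}"] infinite_Ici[of m] inj_on_subset[of ?g UNIV "{m..}"] by auto
    ultimately show ?thesis using finite_subset by blast
  qed
  ultimately have "?f 0 = 0" by (rule F.regular_infinite_zeros)
  then show ?thesis by simp
qed

text \<open>
  Interpolates the three closed forms on the planes \<open>a = p\<^bsup>-2m\<^esup>\<close>, \<open>b = p\<^bsup>-2m\<^esup>\<close> and \<open>d = p\<^bsup>-2m\<^esup>\<close>.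
\<close>
definition rprod :: "'a::field \<Rightarrow> nat \<Rightarrow> 'a \<Rightarrow> 'a \<Rightarrow> 'a \<Rightarrow> 'a" where
  "rprod p m a b d = (1 - a) * (\<Prod>i<m.
     ((1 - a * p ^ (2 * i + 2)) * (a - d * p ^ (2 * i + 1)) * (1 - a * p ^ (2 * m + 2 * i + 2)) * b) /
     ((d - a * p ^ (2 * i + 2)) * (b - a * p ^ (2 * i + 2)) * (- (p ^ (2 * i + 1))) * (1 - a * b * p ^ (2 * i + 1))))"

lemma rprod_a:
  assumes "a * p ^ (2 * m) = 1" "m > 0"
  shows "rprod p m a b d = 0"
proof -
  obtain m' where "m = Suc m'" using assms(2) by (cases m) auto
  then have "1 - a * p ^ (2 * m' + 2) = 0" "m' < m" using assms by auto
  then show ?thesis unfolding rprod_def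
    by (intro mult_eq_0_iff[THEN iffD2] disjI2 prod_zero bexI[of _ m']) auto
qed

text \<open>On this plane \<open>(1 - a * p ^ (2 * m + 2 * i + 2)) * b\<close> is
  \<open>b - a * p ^ (2 * i + 2)\<close> and cancels. Two other denominators combine into
  \<open>a - p ^ (2 * i + 1)\<close> after one product is reversed, because
  \<open>b * p ^ (2 * i + 1) * p ^ (2 * (m - 1 - i) + 1) = 1\<close>.\<close>

lemma rprod_b:
  fixes p a b d :: "'a::field"
  assumes b: "b * p ^ (2 * m) = 1" and nz: "\<And>i. i < m \<Longrightarrow> a * p ^ (2 * m + 2 * i + 2) \<noteq> 1"
  shows "rprod p m a b d = (1 - a) * (\<Prod>i<m. (1 - a * p ^ (2 * i + 2)) * (a - d * p ^ (2 * i + 1)) /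
       ((d - a * p ^ (2 * i + 2)) * (a - p ^ (2 * i + 1))))"
proof -
  have b0: "b \<noteq> 0" using b by auto
  have r: "(\<Prod>i<m. 1 - a * b * p ^ (2 * i + 1)) = (\<Prod>i<m. 1 - a * b * p ^ (2 * (m - Suc i) + 1))"
    by (rule prod.nat_diff_reindex[symmetric])
  have q: "(\<Prod>i<m. - (p ^ (2 * i + 1))) * (\<Prod>i<m. 1 - a * b * p ^ (2 * i + 1)) = (\<Prod>i<m. a - p ^ (2 * i + 1))"
    unfolding r prod.distrib[symmetric]
  proof (rule prod.cong[OF refl])
    fix i assume "i \<in> {..<m}"
    then have "2 * m = 2 * i + 1 + (2 * (m - Suc i) + 1)" by auto
    then have "b * (p ^ (2 * i + 1) * p ^ (2 * (m - Suc i) + 1)) = 1" using b by (metis power_add)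
    then show "- (p ^ (2 * i + 1)) * (1 - a * b * p ^ (2 * (m - Suc i) + 1)) = a - p ^ (2 * i + 1)"
      by (simp add: algebra_simps)
  qed
  have s: "(1 - a * p ^ (2 * m + 2 * i + 2)) * b = b - a * p ^ (2 * i + 2)" for i
  proof -
    have "a * p ^ (2 * m + 2 * i + 2) * b = a * p ^ (2 * i + 2) * (b * p ^ (2 * m))"
      by (simp add: power_add mult_ac)
    then show ?thesis unfolding b by (simp only: left_diff_distrib mult_1_left mult_1_right)
  qed
  have nz': "b - a * p ^ (2 * i + 2) \<noteq> 0" if "i < m" for i
    unfolding s[symmetric] using nz[OF that] b0 by simp
  have "rprod p m a b d = (1 - a) * (\<Prod>i<m. ((1 - a * p ^ (2 * i + 2)) * (a - d * p ^ (2 * i + 1))) /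
     (d - a * p ^ (2 * i + 2)) * (1 / (- (p ^ (2 * i + 1)))) * (1 / (1 - a * b * p ^ (2 * i + 1))))"
    unfolding rprod_def
  proof (intro arg_cong[where f = "\<lambda>z. (1 - a) * z"] prod.cong refl)
    fix i assume "i \<in> {..<m}"
    then have "b - a * p ^ (2 * i + 2) \<noteq> 0" using nz' by simp
    then show "((1 - a * p ^ (2 * i + 2)) * (a - d * p ^ (2 * i + 1)) * (1 - a * p ^ (2 * m + 2 * i + 2)) * b) /
     ((d - a * p ^ (2 * i + 2)) * (b - a * p ^ (2 * i + 2)) * (- (p ^ (2 * i + 1))) * (1 - a * b * p ^ (2 * i + 1))) =
      ((1 - a * p ^ (2 * i + 2)) * (a - d * p ^ (2 * i + 1))) /
     (d - a * p ^ (2 * i + 2)) * (1 / (- (p ^ (2 * i + 1)))) * (1 / (1 - a * b * p ^ (2 * i + 1)))"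
      unfolding mult.assoc[of _ "1 - a * p ^ (2 * m + 2 * i + 2)" b] s by simp
  qed
  also have "\<dots> = (1 - a) * ((\<Prod>i<m. ((1 - a * p ^ (2 * i + 2)) * (a - d * p ^ (2 * i + 1))) /
     (d - a * p ^ (2 * i + 2))) * (1 / ((\<Prod>i<m. - (p ^ (2 * i + 1))) * (\<Prod>i<m. 1 - a * b * p ^ (2 * i + 1)))))"
    by (simp only: prod.distrib prod_dividef prod.neutral_const mult.assoc) simp
  also have "\<dots> = (1 - a) * (\<Prod>i<m. (1 - a * p ^ (2 * i + 2)) * (a - d * p ^ (2 * i + 1)) /
       ((d - a * p ^ (2 * i + 2)) * (a - p ^ (2 * i + 1))))"
    unfolding q by (simp add: prod_dividef prod.distrib)
  finally show ?thesis .
qed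

text \<open>\<open>d - a * p ^ (2 * i + 2)\<close> is \<open>d\<close> times a numerator factor,
  which cancels. Reversing the product of \<open>a - d * p ^ (2 * i + 1)\<close> produces
  \<open>1 - a * p ^ (2 * i + 1)\<close>; the leftover monomials cancel as a whole product, not
  factor by factor.\<close>

lemma rprod_d:
  fixes p a b d :: "'a::field"
  assumes d: "d * p ^ (2 * m) = 1" and p0: "p \<noteq> 0" and nz: "\<And>i. i < m \<Longrightarrow> a * p ^ (2 * m + 2 * i + 2) \<noteq> 1"
  shows "rprod p m a b d = (1 - a) * (\<Prod>i<m. (1 - a * p ^ (2 * i + 1)) * (1 - a * p ^ (2 * i + 2)) * b /
       ((b - a * p ^ (2 * i + 2)) * (1 - a * b * p ^ (2 * i + 1))))"
proof -
  have d0: "d \<noteq> 0" using d by auto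
  have split: "d * (p ^ (2 * (m - Suc i) + 1) * p ^ (2 * i + 1)) = 1" if "i < m" for i
  proof -
    have "2 * m = (2 * (m - Suc i) + 1) + (2 * i + 1)" using that by auto
    then show ?thesis using d by (metis power_add)
  qed
  have r: "(\<Prod>i<m. a - d * p ^ (2 * i + 1)) = (\<Prod>i<m. - (1 - a * p ^ (2 * i + 1)) / p ^ (2 * i + 1))"
  proof -
    have "(\<Prod>i<m. a - d * p ^ (2 * i + 1)) = (\<Prod>i<m. a - d * p ^ (2 * (m - Suc i) + 1))"
      by (rule prod.nat_diff_reindex[symmetric])
    also have "\<dots> = (\<Prod>i<m. - (1 - a * p ^ (2 * i + 1)) / p ^ (2 * i + 1))"
    proof (rule prod.cong[OF refl])
      fix i assume "i \<in> {..<m}"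
      then have "d * p ^ (2 * (m - Suc i) + 1) = 1 / p ^ (2 * i + 1)"
        using split[of i] p0 by (simp add: nonzero_eq_divide_eq mult_ac)
      then show "a - d * p ^ (2 * (m - Suc i) + 1) = - (1 - a * p ^ (2 * i + 1)) / p ^ (2 * i + 1)"
        using p0 by (simp add: field_simps)
    qed
    finally show ?thesis .
  qed
  have dp: "(\<Prod>i<m. d * p ^ (2 * i + 1)) = (\<Prod>i<m. 1 / p ^ (2 * i + 1))"
  proof -
    have "(\<Prod>i<m. d * p ^ (2 * i + 1)) = (\<Prod>i<m. d * p ^ (2 * (m - Suc i) + 1))"
      by (rule prod.nat_diff_reindex[symmetric])
    also have "\<dots> = (\<Prod>i<m. 1 / p ^ (2 * i + 1))"
      using split p0 by (intro prod.cong refl) (simp add: nonzero_eq_divide_eq mult_ac)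
    finally show ?thesis .
  qed
  have s: "d - a * p ^ (2 * i + 2) = d * (1 - a * p ^ (2 * m + 2 * i + 2))" for i
  proof -
    have "d * (a * p ^ (2 * m + 2 * i + 2)) = a * p ^ (2 * i + 2) * (d * p ^ (2 * m))"
      by (simp add: power_add mult_ac)
    then show ?thesis unfolding d by (simp only: right_diff_distrib mult_1_right)
  qed
  let ?A = "\<lambda>i. (1 - a * p ^ (2 * i + 2)) * b / ((b - a * p ^ (2 * i + 2)) * (1 - a * b * p ^ (2 * i + 1)))"
  have "rprod p m a b d = (1 - a) * (\<Prod>i<m. ?A i * (a - d * p ^ (2 * i + 1)) * (- (1 / (d * p ^ (2 * i + 1)))))"
    unfolding rprod_def
  proof (intro arg_cong[where f = "\<lambda>z. (1 - a) * z"] prod.cong refl)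
    fix i assume "i \<in> {..<m}"
    then have "1 - a * p ^ (2 * m + 2 * i + 2) \<noteq> 0" using nz[of i] by simp
    then show "((1 - a * p ^ (2 * i + 2)) * (a - d * p ^ (2 * i + 1)) * (1 - a * p ^ (2 * m + 2 * i + 2)) * b) /
     ((d - a * p ^ (2 * i + 2)) * (b - a * p ^ (2 * i + 2)) * (- (p ^ (2 * i + 1))) * (1 - a * b * p ^ (2 * i + 1))) =
      ?A i * (a - d * p ^ (2 * i + 1)) * (- (1 / (d * p ^ (2 * i + 1))))"
      unfolding s by (simp add: mult_ac)
  qed
  also have "\<dots> = (1 - a) * ((\<Prod>i<m. ?A i) * (\<Prod>i<m. - (1 - a * p ^ (2 * i + 1)) / p ^ (2 * i + 1)) *
      (\<Prod>i<m. - (1 / (d * p ^ (2 * i + 1)))))"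
    unfolding prod.distrib r ..
  also have "(\<Prod>i<m. - (1 / (d * p ^ (2 * i + 1)))) = (\<Prod>i<m. - (p ^ (2 * i + 1)))"
  proof -
    have "(\<Prod>i<m. - (1 / (d * p ^ (2 * i + 1)))) = (\<Prod>i<m. (-1) * inverse (d * p ^ (2 * i + 1)))"
      by (simp add: divide_inverse)
    also have "\<dots> = (\<Prod>i<m. -1) * inverse (\<Prod>i<m. d * p ^ (2 * i + 1))"
      by (subst prod.distrib, subst prod_inversef[symmetric]) (simp add: o_def)
    also have "\<dots> = (\<Prod>i<m. -1) * (\<Prod>i<m. p ^ (2 * i + 1))"
      unfolding dp prod_inversef[symmetric] o_def by simp
    also have "\<dots> = (\<Prod>i<m. - (p ^ (2 * i + 1)))"
      unfolding prod.distrib[symmetric] by simp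
    finally show ?thesis .
  qed
  also have "(\<Prod>i<m. ?A i) * (\<Prod>i<m. - (1 - a * p ^ (2 * i + 1)) / p ^ (2 * i + 1)) * (\<Prod>i<m. - (p ^ (2 * i + 1))) =
     (\<Prod>i<m. (1 - a * p ^ (2 * i + 1)) * (1 - a * p ^ (2 * i + 2)) * b /
       ((b - a * p ^ (2 * i + 2)) * (1 - a * b * p ^ (2 * i + 1))))"
    unfolding prod.distrib[symmetric]
  proof (intro prod.cong refl)
    fix i
    have e: "- (1 - a * p ^ (2 * i + 1)) / p ^ (2 * i + 1) * - (p ^ (2 * i + 1)) = 1 - a * p ^ (2 * i + 1)"
      using p0 by simp
    show "?A i * (- (1 - a * p ^ (2 * i + 1)) / p ^ (2 * i + 1)) * - (p ^ (2 * i + 1)) =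
      (1 - a * p ^ (2 * i + 1)) * (1 - a * p ^ (2 * i + 2)) * b /
       ((b - a * p ^ (2 * i + 2)) * (1 - a * b * p ^ (2 * i + 1)))"
      unfolding mult.assoc[of "?A i"] e by (simp add: mult_ac)
  qed
  finally show ?thesis .
qed

section \<open>The congruence for the short sum\<close>

text \<open>What the argument uses about the localisation at the primitive \<open>n\<close>-th roots
  of unity. Modulo \<open>1 - q ^ n\<close> a geometric sum in \<open>q ^ n\<close> is the integer
  \<open>i\<close>, so \<open>unit_geometric\<close> expresses characteristic 0; by it
  \<open>1 - q ^ (n * i)\<close> and \<open>1 - q ^ n\<close> differ by a unit factor.\<close>

locale cyclo_ring = adic_subring R "1 - q ^ n" for R :: "'a::field set" and q :: 'a and n :: nat +
  fixes d m :: nat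
  assumes n_eq: "n = 2 * d * m + 1" and d_ge: "2 \<le> d" and m_ge: "1 \<le> m"
    and unit_q: "unit q"
    and unit_one_minus: "\<not> n dvd e \<Longrightarrow> unit (1 - q ^ e)"
    and unit_geometric: "i > 0 \<Longrightarrow> unit (\<Sum>j<i. (q ^ n) ^ j)"
    and not_root: "e > 0 \<Longrightarrow> q ^ e \<noteq> 1"
begin

definition p where "p = q ^ d"
definition Y where "Y = q ^ n"

lemma q_nonzero: "q \<noteq> 0" using unit_q by (simp add: unit_def)
lemma p_nonzero: "p \<noteq> 0" using q_nonzero by (simp add: p_def)
lemma Y_nonzero: "Y \<noteq> 0" using q_nonzero by (simp add: Y_def)

lemma unit_p: "unit p" unfolding p_def by (intro unit_power unit_q)
lemma unit_Y: "unit Y" unfolding Y_def by (intro unit_power unit_q)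

lemma n_gt: "4 * m < n"
proof -
  have "2 * m \<le> d * m" by (rule mult_le_mono1[OF d_ge])
  moreover have "n = 2 * (d * m) + 1" using n_eq by simp
  ultimately show ?thesis by linarith
qed

lemma p_not_root: "i > 0 \<Longrightarrow> p ^ i \<noteq> 1"
  unfolding p_def power_mult[symmetric] using d_ge by (intro not_root) simp

lemma Y_not_root: "i > 0 \<Longrightarrow> Y ^ i \<noteq> 1"
  unfolding Y_def power_mult[symmetric] using n_eq by (intro not_root) simp

lemma q_times_p_power: "q * p ^ (2 * m) = Y"
proof -
  have "q * (q ^ d) ^ (2 * m) = q ^ (2 * d * m + 1)" by (simp add: mult_ac flip: power_mult)
  then show ?thesis unfolding p_def Y_def by (metis n_eq)
qed

lemma p_power_n: "p ^ n = Y ^ d"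
  by (simp add: p_def Y_def mult_ac flip: power_mult)

lemma t_eq: "1 - q ^ n = 1 - Y" by (simp add: Y_def)

lemma coprime_n: "coprime n (2 * d)"
proof -
  have "coprime (2 * d * m + 1) (2 * d)"
    by (metis coprime_Suc_left_nat coprime_commute coprime_mult_left_iff Suc_eq_plus1)
  then show ?thesis by (simp add: n_eq)
qed

lemma coprime_d: "coprime n d" using coprime_n by simp

lemma odd_n: "odd n" by (simp add: n_eq)

lemma one_minus_Y_power: "1 - Y ^ i = (1 - Y) * (\<Sum>j<i. Y ^ j)"
  by (rule one_diff_power_eq)

lemma unit_geom: "i > 0 \<Longrightarrow> unit (\<Sum>j<i. Y ^ j)"
  unfolding Y_def by (rule unit_geometric)

lemma unit_1_Y: "unit (1 + Y)"
  using unit_geom[of 2] by (simp add: numeral_2_eq_2)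

lemma cong_Y_power: "cong_mod 1 (Y ^ i) 1"
proof (rule cong_modI)
  show "Y ^ i - 1 = (1 - q ^ n) ^ 1 * (- (\<Sum>j<i. Y ^ j))"
    using one_minus_Y_power[of i] by (simp add: t_eq algebra_simps)
  show "- (\<Sum>j<i. Y ^ j) \<in> R" by (intro uminus_in sum_in power_in unit_in unit_Y)
qed

lemma cong_Y: "cong_mod 1 Y 1"
  using cong_Y_power[of 1] by simp

lemma cong_inverse_Y: "cong_mod 1 (1 / Y) 1"
proof (rule cong_modI)
  show "1 / Y - 1 = (1 - q ^ n) ^ 1 * (1 / Y)"
    using Y_nonzero by (simp add: t_eq field_simps)
  show "1 / Y \<in> R" using unit_Y by (simp add: unit_def divide_inverse)
qed

lemma cong_mult_left: "cong_mod k x y \<Longrightarrow> c \<in> R \<Longrightarrow> cong_mod k (c * x) (c * y)"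
  unfolding cong_mod_def by (metis mult.left_commute mult_in right_diff_distrib)

lemma cong_uminus: "cong_mod k x y \<Longrightarrow> cong_mod k (- x) (- y)"
  using cong_mult_left[of k x y "-1"] by (simp add: uminus_in one_in)

lemma cong_diff: "cong_mod k x y \<Longrightarrow> cong_mod k x' y' \<Longrightarrow> cong_mod k (x - x') (y - y')"
  using cong_mod_add[OF _ cong_uminus, of k x y x' y'] by simp

lemma cong_in: "cong_mod 1 x y \<Longrightarrow> y \<in> R \<Longrightarrow> x \<in> R"
  unfolding cong_mod_def by (metis add_in add.commute diff_add_cancel mult_in power_one_right t_in)

lemmas q_in = unit_in[OF unit_q] and p_in = unit_in[OF unit_p] and Y_in = unit_in[OF unit_Y]

lemma unit_one_minus_p: "\<not> n dvd i \<Longrightarrow> unit (1 - p ^ i)"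
  unfolding p_def power_mult[symmetric]
  by (rule unit_one_minus) (use coprime_d coprime_dvd_mult_right_iff in blast)

text \<open>Parameters on the curve are congruent to \<open>q\<close>, so this denominator reduces
  to \<open>q * (1 - q ^ (d * i))\<close>, and \<open>d\<close> is prime to
  \<open>n\<close>.\<close>

lemma unit_diff_p:
  assumes "cong_mod 1 a q" "cong_mod 1 b q" "\<not> n dvd i"
  shows "unit (b - a * p ^ i)"
proof (rule unit_cong)
  show "unit (q * (1 - p ^ i))" by (intro unit_mult unit_q unit_one_minus_p assms)
  have "cong_mod 1 (b - p ^ i * a) (q - p ^ i * q)"
    by (intro cong_diff assms cong_mult_left power_in p_in)
  then show "cong_mod 1 (b - a * p ^ i) (q * (1 - p ^ i))" by (simp add: algebra_simps)
qed

text \<open>The reduction is \<open>1 - q ^ (d + 2 + 2 * d * j)\<close>. Since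
  \<open>n * (d + 2) = d + 2 + 2 * d * ((d + 2) * m)\<close>, this exponent is divisible by
  \<open>n\<close> for exactly one \<open>j < n\<close>, the excluded one.\<close>

lemma unit_one_minus_ab:
  assumes "cong_mod 1 a q" "cong_mod 1 b q" "j < n" "j \<noteq> (d + 2) * m"
  shows "unit (1 - a * b * p ^ (2 * j + 1))"
proof (rule unit_cong)
  have "\<not> n dvd (d + 2 + 2 * d * j)"
  proof
    assume dv: "n dvd (d + 2 + 2 * d * j)"
    have "int (d + 2 + 2 * d * j) - int n * (d + 2) = int (2 * d) * (int j - int ((d + 2) * m))"
      by (simp add: n_eq algebra_simps)
    then have "int n dvd int (2 * d) * (int j - int ((d + 2) * m))"
      using dv by (metis dvd_diff dvd_triv_left of_nat_dvd_iff)
    then have *: "int n dvd int j - int ((d + 2) * m)"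
      using coprime_n coprime_dvd_mult_right_iff coprime_int_iff by blast
    have "(d + 2) * m \<le> 2 * d * m" using d_ge by (intro mult_right_mono) auto
    then have "(d + 2) * m < n" by (simp add: n_eq)
    then have "\<bar>int j - int ((d + 2) * m)\<bar> < int n" using assms(3) by linarith
    moreover have "int j - int ((d + 2) * m) \<noteq> 0"
      using assms(4) by (metis eq_iff_diff_eq_0 of_nat_eq_iff)
    ultimately show False using dvd_imp_le_int[OF _ *] by simp
  qed
  then have "unit (1 - q ^ (d + 2 + 2 * d * j))" by (rule unit_one_minus)
  then show "unit (1 - q * q * p ^ (2 * j + 1))"
    by (simp add: p_def power_add power2_eq_square mult_ac flip: power_mult)
  have "cong_mod 1 (a * b) (q * q)"
    by (intro cong_mod_mult assms q_in cong_in[OF assms(2)])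
  then have "cong_mod 1 (1 - p ^ (2 * j + 1) * (a * b)) (1 - p ^ (2 * j + 1) * (q * q))"
    by (intro cong_diff cong_mod_refl cong_mult_left power_in p_in)
  then show "cong_mod 1 (1 - a * b * p ^ (2 * j + 1)) (1 - q * q * p ^ (2 * j + 1))"
    by (simp add: mult_ac)
qed

lemma dvd_one_plus:
  assumes "n dvd 1 + d * i"
  shows "i mod n = 2 * m"
proof -
  have "int (1 + d * i) - int n = int d * (int i - int (2 * m))"
    by (simp add: n_eq algebra_simps)
  then have "int n dvd int d * (int i - int (2 * m))"
    using assms by (metis dvd_diff dvd_refl of_nat_dvd_iff)
  then have "int n dvd int i - int (2 * m)"
    using coprime_d coprime_dvd_mult_right_iff coprime_int_iff by blast
  then have "int i mod int n = int (2 * m) mod int n" by (simp add: mod_eq_dvd_iff)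
  then have "i mod n = 2 * m mod n" by (metis of_nat_eq_iff of_nat_mod)
  then show ?thesis using n_gt by simp
qed

lemma unit_one_minus_a:
  assumes "cong_mod 1 a q" "i mod n \<noteq> 2 * m"
  shows "unit (1 - a * p ^ i)"
proof (rule unit_cong)
  show "unit (1 - q ^ (1 + d * i))" using dvd_one_plus assms(2) by (intro unit_one_minus) blast
  have "cong_mod 1 (1 - p ^ i * a) (1 - p ^ i * q)"
    by (intro cong_diff cong_mod_refl cong_mult_left power_in p_in assms)
  then show "cong_mod 1 (1 - a * p ^ i) (1 - q ^ (1 + d * i))"
    by (simp add: p_def mult_ac flip: power_mult)
qed

text \<open>Adding \<open>n\<close> to the exponent \<open>d * (2 * i + 1) - 1\<close> turns it into
  \<open>d * (2 * i + 1 + 2 * m)\<close>, and the second factor stays below \<open>n\<close> in the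
  stated range.\<close>

lemma unit_a_minus:
  assumes "cong_mod 1 a q" "i < m * (d - 1)"
  shows "unit (a - p ^ (2 * i + 1))"
proof (rule unit_cong)
  have e: "d * (2 * i + 1) = 1 + (d * (2 * i + 1) - 1)" using d_ge by simp
  have nd: "\<not> n dvd d * (2 * i + 1) - 1"
  proof
    assume "n dvd d * (2 * i + 1) - 1"
    then have "n dvd (d * (2 * i + 1) - 1) + n" by simp
    also have "(d * (2 * i + 1) - 1) + n = d * (2 * i + 1 + 2 * m)" using e by (simp add: n_eq algebra_simps)
    finally have "n dvd 2 * i + 1 + 2 * m" using coprime_d coprime_dvd_mult_right_iff by blast
    then have "n \<le> 2 * i + 1 + 2 * m" by (rule dvd_imp_le) simp
    moreover have "m * (d - 1) + m = d * m" using d_ge by (cases d) auto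
    ultimately show False using assms(2) n_eq by simp
  qed
  show "unit (q * (1 - q ^ (d * (2 * i + 1) - 1)))" by (intro unit_mult unit_q unit_one_minus nd)
  have "p ^ (2 * i + 1) = q ^ (1 + (d * (2 * i + 1) - 1))" unfolding p_def power_mult[symmetric] using e by simp
  then have e2: "q * (1 - q ^ (d * (2 * i + 1) - 1)) = q - p ^ (2 * i + 1)" by (simp add: algebra_simps)
  show "cong_mod 1 (a - p ^ (2 * i + 1)) (q * (1 - q ^ (d * (2 * i + 1) - 1)))"
    unfolding e2 by (intro cong_diff assms cong_mod_refl)
qed

lemma not_dvd_even: "0 < i \<Longrightarrow> i < n \<Longrightarrow> \<not> n dvd 2 * i"
  using odd_n by (metis coprime_dvd_mult_right_iff coprime_right_2_iff_odd dvd_imp_le not_le)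

lemma not_dvd_less: "0 < i \<Longrightarrow> i < n \<Longrightarrow> \<not> n dvd i"
  by (auto dest: dvd_imp_le)

lemma m_le_J: "2 * m < (d + 2) * m"
  using m_ge d_ge by simp

text \<open>The case \<open>\<beta> = 1\<close> gives the short sum; the case
  \<open>\<beta> = Y ^ (d - 1)\<close>, where \<open>b\<close> becomes
  \<open>p ^ (2 * M + 1)\<close>, serves the tail.\<close>

theorem rterm_sum_cong_rprod:
  assumes \<beta>: "cong_mod 1 \<beta> 1"
  shows "cong_mod 3 (\<Sum>k<2 * m + 1. rterm p q (q * \<beta>) q k) (rprod p m q (q * \<beta>) q)"
proof -
  \<comment> \<open>The slope \<open>c\<close> is made for \<open>a s1 = q / Y\<close> at
    \<open>s1 = 1 / Y ^ 2 - 1\<close>; with slope 1, as in \<open>e\<close>, the roots for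
    \<open>a\<close> and \<open>e\<close> would coincide. The denominator \<open>1 + Y\<close> is a
    geometric sum, hence a unit.\<close>
  define c where "c = Y / (1 + Y)"
  have c_in: "c \<in> R" unfolding c_def by (intro divide_in Y_in unit_1_Y)
  have Y1: "1 + Y \<noteq> 0" using unit_1_Y by (rule unit_nonzero)
  have "cong_mod 1 (1 / Y) \<beta>" using cong_mod_trans[OF cong_inverse_Y cong_mod_sym[OF \<beta>]] .
  \<comment> \<open>\<open>r\<close> is made for \<open>b s2 = q / Y\<close> at
    \<open>s2 = Y - 1\<close>; it exists in \<open>R\<close> because \<open>1 / Y\<close> and
    \<open>\<beta>\<close> are both congruent to 1.\<close>
  then obtain r where r: "r \<in> R" "1 / Y - \<beta> = (1 - Y) * r"
    unfolding cong_mod_def unfolding t_eq power_one_right by blast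
  define a where "a x = q * (1 + x * c)" for x
  define b where "b x = q * (\<beta> - x * r)" for x
  define e where "e x = q * (1 + x)" for x
  have \<beta>_in: "\<beta> \<in> R" by (rule cong_in[OF \<beta> one_in])
  have reg: "regular a" "regular b" "regular e"
    unfolding a_def b_def e_def
    by (intro regular_mult regular_const regular_add regular_diff regular_id q_in one_in c_in \<beta>_in r)+
  have a0: "a 0 = q" and b0: "b 0 = q * \<beta>" and e0: "e 0 = q" by (simp_all add: a_def b_def e_def)
  have cb0: "cong_mod 1 (q * \<beta>) q" using cong_mult_left[OF \<beta> q_in] by simp
  have ca: "cong_mod 1 (a x) q" if "cong_mod 1 x 0" for x
    using regular_cong[OF reg(1) that] by (simp add: a0)
  have cb: "cong_mod 1 (b x) q" if "cong_mod 1 x 0" for x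
    using regular_cong[OF reg(2) that] cb0 by (metis b0 cong_mod_trans)
  have ce: "cong_mod 1 (e x) q" if "cong_mod 1 x 0" for x
    using regular_cong[OF reg(3) that] by (simp add: e0)
  have n1: "\<not> n dvd 2 * j + 2" if "j \<le> 2 * m" for j
    using not_dvd_even[of "j + 1"] that n_gt m_ge by simp
  let ?f = "\<lambda>x. (\<Sum>k<2 * m + 1. rterm p (a x) (b x) (e x) k) - rprod p m (a x) (b x) (e x)"
  have rf: "regular ?f"
    unfolding rprod_def
  proof (intro regular_diff regular_sum regular_rterm regular_mult regular_prod regular_divide regular_const
      uminus_in reg one_in power_in p_in unit_mult unit_uminus unit_power unit_p)
    fix k j assume "k \<in> {..<2 * m + 1}" "j < k"
    then have j: "j < 2 * m" by simp
    show "unit (1 - p ^ (2 * j + 2))" using n1[of j] j by (intro unit_one_minus_p) auto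
    show "unit (b 0 - a 0 * p ^ (2 * j + 2))" unfolding a0 b0
      using n1[of j] j by (intro unit_diff_p cong_mod_refl cb0) auto
    show "unit (1 - a 0 * b 0 * p ^ (2 * j + 1))" unfolding a0 b0
      using m_le_J n_gt j by (intro unit_one_minus_ab cong_mod_refl cb0) auto
    show "unit (e 0 - a 0 * p ^ Suc j)" unfolding a0 e0
      using n_gt j by (intro unit_diff_p cong_mod_refl not_dvd_less) auto
  next
    fix i assume "i \<in> {..<m}"
    then have i: "i < m" by simp
    show "unit (e 0 - a 0 * p ^ (2 * i + 2))" unfolding a0 e0
      using n1[of i] i by (intro unit_diff_p cong_mod_refl) auto
    show "unit (b 0 - a 0 * p ^ (2 * i + 2))" unfolding a0 b0
      using n1[of i] i by (intro unit_diff_p cong_mod_refl cb0) auto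
    show "unit (1 - a 0 * b 0 * p ^ (2 * i + 1))" unfolding a0 b0
      using m_le_J n_gt i by (intro unit_one_minus_ab cong_mod_refl cb0) auto
  qed
  define s1 s2 s3 where "s1 = 1 / Y ^ 2 - 1" and "s2 = Y - 1" and "s3 = 1 / Y - 1"
  have iY: "1 / Y \<in> R" using unit_Y by (simp add: unit_def divide_inverse)
  have s3: "cong_mod 1 s3 0" unfolding s3_def using cong_diff[OF cong_inverse_Y cong_mod_refl[of 1 1]] by simp
  have s2: "cong_mod 1 s2 0" unfolding s2_def using cong_diff[OF cong_Y cong_mod_refl[of 1 1]] by simp
  have s1: "cong_mod 1 s1 0"
  proof -
    have "s1 = s3 * (1 / Y + 1)" by (simp add: s1_def s3_def power2_eq_square algebra_simps)
    then show ?thesis using cong_mod_0_mult_in[OF s3 add_in[OF iY one_in]] by simp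
  qed
  have Y12: "Y \<noteq> 1" "Y ^ 2 \<noteq> 1" "Y ^ 3 \<noteq> 1"
    using Y_not_root[of 1] Y_not_root[of 2] Y_not_root[of 3] by auto
  have dist: "s1 \<noteq> s2" "s1 \<noteq> s3" "s2 \<noteq> s3"
    using Y12 Y_nonzero by (auto simp: s1_def s2_def s3_def field_simps power2_eq_square power3_eq_cube)
  have qpY: "q / Y * p ^ (2 * m) = 1" using q_times_p_power Y_nonzero by simp
  have z1: "?f s1 = 0"
  proof -
    have "1 + s1 * c = 1 / Y" using Y_nonzero Y1
      by (simp add: s1_def c_def divide_simps) (simp add: algebra_simps power2_eq_square)
    then have as: "a s1 = q / Y" by (simp add: a_def)
    have "(\<Sum>k<2 * m + 1. rterm p (a s1) (b s1) (e s1) k) = 0"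
    proof (rule rterm_sum_terminating_a[OF p_nonzero p_not_root])
      show "a s1 * p ^ (2 * m) = 1" unfolding as by (rule qpY)
      fix i
      show "e s1 * p ^ (2 * m) \<noteq> p ^ Suc i"
      proof
        assume "e s1 * p ^ (2 * m) = p ^ Suc i"
        then have "q * p ^ (2 * m) = p ^ Suc i * Y ^ 2" using Y_nonzero by (simp add: e_def s1_def divide_eq_eq)
        then have "Y * 1 = Y * (p ^ Suc i * Y)" unfolding q_times_p_power by (simp add: power2_eq_square mult_ac)
        then have "p ^ Suc i * Y = 1" using Y_nonzero by (metis mult_cancel_left)
        then have "q ^ (d * Suc i + n) = 1" by (simp add: p_def Y_def power_add power_mult)
        then show False using not_root[of "d * Suc i + n"] n_eq by simp
      qed
    next
      fix j assume j: "j < 2 * m"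
      have "unit (b s1 - a s1 * p ^ (2 * j + 2))"
        using n1[of j] j by (intro unit_diff_p ca cb s1) auto
      then show "b s1 \<noteq> a s1 * p ^ (2 * j + 2)" by (auto simp: unit_def)
      have "unit (1 - a s1 * b s1 * p ^ (2 * j + 1))"
        using m_le_J n_gt j by (intro unit_one_minus_ab ca cb s1) auto
      then show "a s1 * b s1 * p ^ (2 * j + 1) \<noteq> 1" by (auto simp: unit_def)
    qed
    moreover have "rprod p m (a s1) (b s1) (e s1) = 0"
      by (rule rprod_a) (use as qpY m_ge in auto)
    ultimately show ?thesis by simp
  qed
  have neq_a: "a x * p ^ i \<noteq> 1" if "cong_mod 1 x 0" "i mod n \<noteq> 2 * m" for x i
    using unit_one_minus_a[OF ca[OF that(1)] that(2)] by (auto simp: unit_def)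
  \<comment> \<open>\<open>2 * i\<close> may exceed \<open>n\<close> but stays below
    \<open>2 * n\<close>; the value \<open>2 * m + n\<close> is then excluded by parity.\<close>
  have even_mod: "(2 * i) mod n \<noteq> 2 * m" if "i \<le> 3 * m + 1" "i \<noteq> m" for i
  proof (cases "2 * i < n")
    case False
    have "2 * i \<noteq> 2 * m + n" using odd_n by (metis dvd_triv_left even_add)
    moreover have "2 * i - n < n" using that n_gt m_ge by simp
    ultimately show ?thesis using False by (simp add: le_mod_geq)
  qed (use that in simp)
  have z2: "?f s2 = 0"
  proof -
    have "\<beta> - s2 * r = 1 / Y" using r by (simp add: s2_def algebra_simps)
    then have bs: "b s2 = q / Y" by (simp add: b_def)
    then have bs': "b s2 = 1 / p ^ (2 * m)"
      using qpY by (simp only: nonzero_eq_divide_eq[OF power_not_zero[OF p_nonzero]])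
    \<comment> \<open>At exponent \<open>2 * m\<close> the factor \<open>1 - a * p ^ (2 * m)\<close>
      is divisible by \<open>1 - Y\<close>, so reduction says nothing. The exact value of the power
      term is \<open>(1 + Y ^ 2) * Y / (1 + Y)\<close>, which is not 1 since
      \<open>Y ^ 3 \<noteq> 1\<close>.\<close>
    have am: "a s2 * p ^ (2 * m) \<noteq> 1"
    proof
      assume "a s2 * p ^ (2 * m) = 1"
      then have "(1 + s2 * c) * (q * p ^ (2 * m)) = 1" by (simp add: a_def mult_ac)
      then have "(1 + s2 * c) * Y = 1" unfolding q_times_p_power .
      then have "Y ^ 3 = 1" using Y1 by (simp add: s2_def c_def field_simps power3_eq_cube)
      then show False using Y12 by simp
    qed
    have h1: "a s2 * p ^ (2 * i) \<noteq> 1" if "1 \<le> i" "i \<le> 3 * m + 1" for i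
      using am neq_a[OF s2 even_mod[of i]] that by (cases "i = m") auto
    have h2: "a s2 * p ^ (2 * i + 1) \<noteq> 1" if "i \<le> m + 1" for i
    proof (rule neq_a[OF s2])
      have "2 * i + 1 < n \<or> 2 * i + 1 = n" using that n_gt m_ge by auto
      moreover have "2 * i + 1 \<noteq> 2 * m" by presburger
      ultimately show "(2 * i + 1) mod n \<noteq> 2 * m" using m_ge by (metis mod_less mod_self mult_eq_0_iff not_one_le_zero zero_neq_numeral)
    qed
    have h3: "a s2 \<noteq> p ^ (2 * i + 1)" if "i < m" for i
    proof -
      have "m * 1 \<le> m * (d - 1)" using d_ge by (intro mult_le_mono2) simp
      then have "i < m * (d - 1)" using that by linarith
      then have "unit (a s2 - p ^ (2 * i + 1))" by (intro unit_a_minus ca s2)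
      then show ?thesis by (auto simp: unit_def)
    qed
    have h4: "e s2 \<noteq> a s2 * p ^ i" if "1 \<le> i" "i \<le> 2 * m + 1" for i
    proof -
      have "unit (e s2 - a s2 * p ^ i)"
        using that n_gt m_ge by (intro unit_diff_p ca ce s2 not_dvd_less) auto
      then show ?thesis by (auto simp: unit_def)
    qed
    have h5: "a s2 * p ^ (2 * m + 2 * i + 2) \<noteq> 1" if "i < m" for i
      using h1[of "m + i + 1"] that by (simp add: algebra_simps)
    have "(\<Sum>k<2 * m + 1. rterm p (a s2) (b s2) (e s2) k) = rprod p m (a s2) (b s2) (e s2)"
      using rterm_sum_terminating_b[where M = m, OF p_nonzero p_not_root h1 h2 h3 h4] rprod_b[of "b s2" p m "a s2" "e s2"] h5 bs' p_nonzero
      by simp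
    then show ?thesis by simp
  qed
  have z3: "?f s3 = 0"
  proof -
    have es: "e s3 = 1 / p ^ (2 * m)" using qpY p_nonzero by (simp add: e_def s3_def field_simps)
    have am: "a s3 * p ^ (2 * m) \<noteq> 1"
    proof
      assume "a s3 * p ^ (2 * m) = 1"
      then have "(1 + s3 * c) * (q * p ^ (2 * m)) = 1" by (simp add: a_def mult_ac)
      then have "(1 + s3 * c) * Y = 1" unfolding q_times_p_power .
      moreover have "(1 / Y - 1) * Y = 1 - Y" using Y_nonzero by (simp add: left_diff_distrib)
      then have "s3 * c = (1 - Y) / (1 + Y)" by (simp add: s3_def c_def)
      moreover have "1 + (1 - Y) / (1 + Y) = (1 + 1) / (1 + Y)" using Y1 by (simp add: divide_simps)
      ultimately have "(1 + 1) / (1 + Y) * Y = 1" by (simp only:)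
      then have "(1 + 1) * Y = 1 + Y" using Y1 by (simp add: divide_simps)
      then have "Y = 1" by (simp only: distrib_right mult_1_left add_right_cancel)
      then show False using Y12 by simp
    qed
    have h1: "a s3 * p ^ i \<noteq> 1" if "1 \<le> i" "i \<le> 4 * m + 1" for i
    proof (cases "i = 2 * m")
      case False
      have "i < n \<or> i = n" using that n_gt by auto
      then show ?thesis using False m_ge by (intro neq_a[OF s3]) auto
    qed (use am in simp)
    have h2: "b s3 \<noteq> a s3 * p ^ (2 * i + 2)" if "i \<le> 2 * m" for i
    proof -
      have "unit (b s3 - a s3 * p ^ (2 * i + 2))"
        using n1[of i] that by (intro unit_diff_p ca cb s3) auto
      then show ?thesis by (auto simp: unit_def)
    qed
    have h3: "a s3 * b s3 * p ^ (2 * i + 1) \<noteq> 1" if "i \<le> 2 * m" for i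
    proof -
      have "unit (1 - a s3 * b s3 * p ^ (2 * i + 1))"
        using m_le_J n_gt that by (intro unit_one_minus_ab ca cb s3) auto
      then show ?thesis by (auto simp: unit_def)
    qed
    have b0: "b s3 \<noteq> 0" using unit_cong[OF unit_q cb[OF s3]] by (simp add: unit_def)
    have h5: "a s3 * p ^ (2 * m + 2 * i + 2) \<noteq> 1" if "i < m" for i
      using h1[of "2 * m + 2 * i + 2"] that by simp
    have "(\<Sum>k<2 * m + 1. rterm p (a s3) (b s3) (e s3) k) = rprod p m (a s3) (b s3) (e s3)"
      using rterm_sum_terminating_d[where m = m, OF p_nonzero p_not_root b0 h1 h2 h3] rprod_d[of "e s3" p m "a s3" "b s3"] h5 es p_nonzero
      by simp
    then show ?thesis by simp
  qed
  have "cong_mod 3 (?f 0) 0" by (rule regular_three_roots[OF rf s1 s2 s3 dist z1 z2 z3])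
  then show ?thesis by (simp add: a0 b0 e0 cong_mod_def)
qed

end

text \<open>\<open>b \<mapsto> p / b\<close> exchanges the factors \<open>(b; p)_k\<close> and
  \<open>(p/b; p)_k\<close> and also the two denominators containing \<open>b\<close>. It carries
  the termination at \<open>p^(-2M)\<close> over to \<open>p ^ (2 * M + 1)\<close>.\<close>

lemma rterm_symmetric_b:
  assumes "p \<noteq> 0" "b \<noteq> 0"
  shows "rterm p a (p / b) d k = rterm p a b d k"
proof -
  have "(1 - a * p ^ j) * (1 - p / b * p ^ j) * (p / b - p ^ Suc j) * (1 - d * p ^ (2 * j)) * a * p ^ Suc j /
       ((1 - p ^ (2 * j + 2)) * (p / b - a * p ^ (2 * j + 2)) * (1 - a * (p / b) * p ^ (2 * j + 1)) * (d - a * p ^ Suc j)) =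
     (1 - a * p ^ j) * (1 - b * p ^ j) * (b - p ^ Suc j) * (1 - d * p ^ (2 * j)) * a * p ^ Suc j /
       ((1 - p ^ (2 * j + 2)) * (b - a * p ^ (2 * j + 2)) * (1 - a * b * p ^ (2 * j + 1)) * (d - a * p ^ Suc j))" for j
  proof -
    have e: "1 - p / b * p ^ j = (b - p ^ Suc j) / b" "p / b - p ^ Suc j = p * (1 - b * p ^ j) / b"
      "p / b - a * p ^ (2 * j + 2) = p * (1 - a * b * p ^ (2 * j + 1)) / b"
      "1 - a * (p / b) * p ^ (2 * j + 1) = (b - a * p ^ (2 * j + 2)) / b"
      using assms by (simp_all add: field_simps)
    show ?thesis unfolding e using assms by (simp add: mult_ac)
  qed
  then show ?thesis unfolding rterm_def by simp
qed

section \<open>The interpolating product at \<open>a = b = d = q\<close>\<close>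

context cyclo_ring
begin

text \<open>The two sides differ by the factor formed by all \<open>?V i\<close>. Each of these is
  invariant under \<open>Y \<mapsto> 1 / Y\<close> and is congruent to 1 even modulo
  \<open>(1 - Y)\<^sup>2\<close>; the factor \<open>1 - Y\<close> in front completes the
  cube.\<close>

lemma rprod_cong_target:
  "cong_mod 3 (rprod p m q q q) ((1 - Y) * (\<Prod>i<m. (1 - p ^ (2 * i + 1)) / (1 - q * q * p ^ (2 * i + 1))) * (q ^ m / p ^ m))"
proof -
  let ?A = "\<lambda>i. (1 - p ^ (2 * i + 1)) / (1 - q * q * p ^ (2 * i + 1))"
  let ?W = "\<lambda>i. (1 - Y * p ^ (2 * i + 2)) / ((1 - p ^ (2 * i + 2)) * (1 - p ^ (2 * i + 2)) * - (p ^ (2 * i + 1)))"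
  let ?V = "\<lambda>i. (1 - p ^ (2 * i + 2) / Y) * (1 - Y * p ^ (2 * i + 2)) / ((1 - p ^ (2 * i + 2)) * (1 - p ^ (2 * i + 2)))"
  have factor: "((1 - q * p ^ (2 * i + 2)) * (q - q * p ^ (2 * i + 1)) * (1 - q * p ^ (2 * m + 2 * i + 2)) * q) /
     ((q - q * p ^ (2 * i + 2)) * (q - q * p ^ (2 * i + 2)) * (- (p ^ (2 * i + 1))) * (1 - q * q * p ^ (2 * i + 1))) =
     (1 - q * p ^ (2 * i + 2)) * (?A i * ?W i)" for i
  proof -
    have e: "q - q * x = q * (1 - x)" for x by (simp add: algebra_simps)
    have e2: "q * p ^ (2 * m + 2 * i + 2) = Y * p ^ (2 * i + 2)"
      unfolding q_times_p_power[symmetric] by (simp add: power_add mult_ac)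
    show ?thesis unfolding e e2 using q_nonzero by (simp add: mult_ac)
  qed
  \<comment> \<open>Shifting the index trades \<open>1 - q\<close> for
    \<open>1 - q * p ^ (2 * m) = 1 - Y\<close>, the numerator of \<open>qint q n\<close>.\<close>
  have B: "(1 - q) * (\<Prod>i<m. 1 - q * p ^ (2 * i + 2)) = (\<Prod>i<m. 1 - q * p ^ (2 * i)) * (1 - Y)"
  proof -
    have "(\<Prod>i<Suc m. 1 - q * p ^ (2 * i)) = (1 - q * p ^ (2 * 0)) * (\<Prod>i<m. 1 - q * p ^ (2 * Suc i))"
      by (rule prod.lessThan_Suc_shift)
    then show ?thesis unfolding prod.lessThan_Suc q_times_p_power by simp
  qed
  \<comment> \<open>Read backwards, \<open>q * p ^ (2 * i)\<close> becomes
    \<open>Y / p ^ (2 * i + 2)\<close>, so the numerators match the denominators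
    \<open>1 - p ^ (2 * i + 2)\<close>.\<close>
  have C: "(\<Prod>i<m. 1 - q * p ^ (2 * i)) = (\<Prod>i<m. - (Y / p ^ (2 * i + 2)) * (1 - p ^ (2 * i + 2) / Y))"
  proof -
    have "(\<Prod>i<m. 1 - q * p ^ (2 * i)) = (\<Prod>i<m. 1 - q * p ^ (2 * (m - Suc i)))"
      by (rule prod.nat_diff_reindex[symmetric])
    also have "\<dots> = (\<Prod>i<m. - (Y / p ^ (2 * i + 2)) * (1 - p ^ (2 * i + 2) / Y))"
    proof (rule prod.cong[OF refl])
      fix i assume "i \<in> {..<m}"
      then have "2 * m = 2 * (m - Suc i) + (2 * i + 2)" by auto
      then have "Y = q * p ^ (2 * (m - Suc i)) * p ^ (2 * i + 2)" unfolding q_times_p_power[symmetric] by (metis power_add mult.assoc)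
      then have "q * p ^ (2 * (m - Suc i)) = Y / p ^ (2 * i + 2)" using p_nonzero by (simp add: nonzero_eq_divide_eq)
      then show "1 - q * p ^ (2 * (m - Suc i)) = - (Y / p ^ (2 * i + 2)) * (1 - p ^ (2 * i + 2) / Y)"
        using Y_nonzero p_nonzero by (simp add: algebra_simps)
    qed
    finally show ?thesis .
  qed
  \<comment> \<open>The collected monomials; as \<open>q / p = q^(1-d)\<close>, they form the power
    \<open>q^(-m(d-1))\<close> of the right-hand side.\<close>
  have D: "(\<Prod>i<m. Y / p ^ (2 * i + 2)) * (\<Prod>i<m. 1 / p ^ (2 * i + 1)) = q ^ m / p ^ m"
  proof -
    have "(\<Prod>i<m. 1 / p ^ (2 * i + 1)) = (\<Prod>i<m. 1 / p ^ (2 * (m - Suc i) + 1))"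
      by (rule prod.nat_diff_reindex[symmetric])
    then have "(\<Prod>i<m. Y / p ^ (2 * i + 2)) * (\<Prod>i<m. 1 / p ^ (2 * i + 1)) =
      (\<Prod>i<m. Y / p ^ (2 * i + 2) * (1 / p ^ (2 * (m - Suc i) + 1)))" by (simp only: prod.distrib)
    also have "\<dots> = (\<Prod>i<m. q / p)"
    proof (rule prod.cong[OF refl])
      fix i assume "i \<in> {..<m}"
      then have "2 * m + 1 = (2 * i + 2) + (2 * (m - Suc i) + 1)" by auto
      then have e: "p ^ (2 * i + 2) * p ^ (2 * (m - Suc i) + 1) = p ^ (2 * m) * p"
        by (metis power_add power_one_right)
      have "Y / p ^ (2 * i + 2) * (1 / p ^ (2 * (m - Suc i) + 1)) = q * p ^ (2 * m) / (p ^ (2 * m) * p)"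
        unfolding q_times_p_power e[symmetric] by simp
      then show "Y / p ^ (2 * i + 2) * (1 / p ^ (2 * (m - Suc i) + 1)) = q / p" using p_nonzero by simp
    qed
    finally show ?thesis by (simp add: power_divide)
  qed
  have "rprod p m q q q = (1 - q) * ((\<Prod>i<m. 1 - q * p ^ (2 * i + 2)) * (\<Prod>i<m. ?A i * ?W i))"
    unfolding rprod_def factor prod.distrib[symmetric] ..
  also have "\<dots> = (1 - Y) * ((\<Prod>i<m. - (Y / p ^ (2 * i + 2)) * (1 - p ^ (2 * i + 2) / Y)) * (\<Prod>i<m. ?A i * ?W i))"
    unfolding C[symmetric] using B by (simp only: mult.assoc[symmetric]) (simp only: mult_ac)
  also have "(\<Prod>i<m. - (Y / p ^ (2 * i + 2)) * (1 - p ^ (2 * i + 2) / Y)) * (\<Prod>i<m. ?A i * ?W i) =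
     (\<Prod>i<m. ?A i * (Y / p ^ (2 * i + 2) * (1 / p ^ (2 * i + 1))) * ?V i)"
    unfolding prod.distrib[symmetric]
  proof (rule prod.cong[OF refl])
    fix i
    have gen: "- y * w * (A * (u / (v * v * - x))) = A * (y * (1 / x)) * (w * u / (v * v))" for y w A u v x :: 'a
      by (simp add: mult_ac)
    show "- (Y / p ^ (2 * i + 2)) * (1 - p ^ (2 * i + 2) / Y) * (?A i * ?W i) =
      ?A i * (Y / p ^ (2 * i + 2) * (1 / p ^ (2 * i + 1))) * ?V i" by (rule gen)
  qed
  also have "\<dots> = (\<Prod>i<m. ?A i) * (q ^ m / p ^ m) * (\<Prod>i<m. ?V i)"
    unfolding D[symmetric] by (simp only: prod.distrib)
  finally have eq: "rprod p m q q q = (1 - Y) * ((\<Prod>i<m. ?A i) * (q ^ m / p ^ m) * (\<Prod>i<m. ?V i))" .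
  have u2: "unit (1 - p ^ (2 * i + 2))" if "i < m" for i
    using not_dvd_even[of "i + 1"] that n_gt by (intro unit_one_minus_p) simp
  have V_in: "?V i \<in> R" if "i < m" for i
    using u2[OF that] by (intro divide_in mult_in diff_in one_in power_in p_in Y_in unit_Y unit_mult)
  have V1: "cong_mod 2 (?V i) 1" if "i < m" for i
  proof (rule cong_modI)
    let ?c = "p ^ (2 * i + 2)"
    have "1 - ?c \<noteq> 0" using u2[OF that] by (rule unit_nonzero)
    then show "?V i - 1 = (1 - q ^ n) ^ 2 * (- ?c / (Y * ((1 - ?c) * (1 - ?c))))"
      unfolding t_eq using Y_nonzero by (simp add: divide_simps) (simp add: algebra_simps power2_eq_square)
    show "- ?c / (Y * ((1 - ?c) * (1 - ?c))) \<in> R"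
      using u2[OF that] by (intro divide_in uminus_in power_in p_in unit_mult unit_Y)
  qed
  have "cong_mod 2 (\<Prod>i<m. ?V i) (\<Prod>i<m. 1)"
    by (rule cong_mod_prod) (use V1 V_in one_in in auto)
  then have "cong_mod 2 ((\<Prod>i<m. ?V i) - 1) 0" using cong_diff[OF _ cong_mod_refl[of 2 1]] by fastforce
  moreover have "cong_mod 1 ((1 - Y) * ((\<Prod>i<m. ?A i) * (q ^ m / p ^ m))) 0"
  proof (rule cong_modI)
    show "(1 - Y) * ((\<Prod>i<m. ?A i) * (q ^ m / p ^ m)) - 0 = (1 - q ^ n) ^ 1 * ((\<Prod>i<m. ?A i) * (q ^ m / p ^ m))"
      by (simp add: t_eq)
    show "(\<Prod>i<m. ?A i) * (q ^ m / p ^ m) \<in> R"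
      using m_le_J n_gt by (intro mult_in prod_in divide_in diff_in one_in power_in p_in q_in unit_power unit_p
          unit_one_minus_ab cong_mod_refl) auto
  qed
  ultimately have "cong_mod (1 + 2) ((1 - Y) * ((\<Prod>i<m. ?A i) * (q ^ m / p ^ m)) * ((\<Prod>i<m. ?V i) - 1)) 0"
    by (intro cong_mod_0_mult)
  moreover have "y * (a * c) * (v - 1) = y * (a * c * v) - y * a * c" for y a c v :: 'a
    by (simp add: algebra_simps)
  moreover have "1 + 2 = (3 :: nat)" by simp
  ultimately have "cong_mod 3 (rprod p m q q q - (1 - Y) * (\<Prod>i<m. ?A i) * (q ^ m / p ^ m)) 0"
    unfolding eq by (simp only:)
  then show ?thesis by (simp add: cong_mod_def)
qed

section \<open>The tail of the full sum\<close>

text \<open>Fixed by \<open>2 * M + 2 * m + 1 = n\<close>, so that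
  \<open>p ^ (2 * M + 1) = p ^ n / p ^ (2 * m)\<close> is congruent to \<open>q\<close>, in view of
  \<open>p ^ n = Y ^ d\<close> and \<open>p ^ (2 * m) = Y / q\<close>.\<close>

definition M where "M = m * (d - 1)"

lemma m_le_M: "m \<le> M"
proof -
  have "1 \<le> d - 1" using d_ge by simp
  from mult_le_mono2[OF this, of m] show ?thesis unfolding M_def by (simp only: mult_1_right)
qed

lemma n_eq_M: "n = 2 * M + 2 * m + 1"
proof -
  have "m * (d - 1) + m = d * m" using d_ge by (cases d) auto
  then show ?thesis using n_eq by (simp add: M_def)
qed

lemma p_power_M: "p ^ (2 * M + 1) = q * Y ^ (d - 1)"
proof -
  have "d * (2 * M + 1) = 1 + n * (d - 1)"
  proof -
    obtain d' where "d = Suc d'" using d_ge by (cases d) auto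
    then show ?thesis unfolding M_def by (simp add: n_eq algebra_simps)
  qed
  then have "(q ^ d) ^ (2 * M + 1) = q ^ (1 + n * (d - 1))" unfolding power_mult[symmetric] by simp
  then show ?thesis by (simp add: p_def Y_def power_mult)
qed

text \<open>The exponents \<open>1 + d * i\<close> and \<open>d * j\<close> differ modulo
  \<open>d\<close>. Hence at \<open>a = q\<close> the conditions of the terminating formulas on
  \<open>a\<close> hold and no density argument intervenes.\<close>

lemma qp_ne_p: "q * p ^ i \<noteq> p ^ j"
proof
  assume "q * p ^ i = p ^ j"
  then have "q ^ (1 + d * i) = q ^ (d * j)" by (simp add: p_def flip: power_mult)
  then have "1 + d * i = d * j" using power_inj_of_not_root_of_unity[OF q_nonzero not_root] by blast
  then have "d dvd 1" by (metis dvd_add_left_iff dvd_triv_left)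
  then show False using d_ge by simp
qed

lemma qp_ne_1: "q * p ^ i \<noteq> 1" using qp_ne_p[of i 0] by simp

definition cprod where
  "cprod e = (1 - q) * (\<Prod>i<M. (1 - q * p ^ (2 * i + 2)) * (q - e * p ^ (2 * i + 1)) /
       ((e - q * p ^ (2 * i + 2)) * (q - p ^ (2 * i + 1))))"

lemma rterm_sum_cprod:
  assumes "\<And>i. 1 \<le> i \<Longrightarrow> e \<noteq> q * p ^ i"
  shows "(\<Sum>k<2 * M + 1. rterm p q (p ^ (2 * M + 1)) e k) = cprod e"
proof -
  have s: "rterm p q (p ^ (2 * M + 1)) e k = rterm p q (1 / p ^ (2 * M)) e k" for k
    using rterm_symmetric_b[of p "p ^ (2 * M + 1)" q e k] p_nonzero by simp
  have h3: "q \<noteq> p ^ (2 * i + 1)" for i using qp_ne_p[of 0 "2 * i + 1"] by simp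
  show ?thesis unfolding s cprod_def
    by (rule rterm_sum_terminating_b[OF p_nonzero p_not_root qp_ne_1 qp_ne_1 h3 assms])
qed

text \<open>Both products evaluate one doubly terminating sum: \<open>b = p ^ (2 * M + 1)\<close>
  ends it at \<open>2 * M\<close>, and \<open>q / Y = p^(-2m)\<close> in the place of
  \<open>d\<close> ends it at \<open>m\<close>. This fixes the ratio of constants that would be
  laborious to compare directly.\<close>

lemma rprod_eq_cprod: "rprod p m q (p ^ (2 * M + 1)) (q / Y) = cprod (q / Y)"
proof -
  have e: "q / Y = 1 / p ^ (2 * m)" using q_times_p_power p_nonzero Y_nonzero by (simp add: field_simps)
  have e': "q / Y * p ^ (2 * m) = 1" using p_nonzero by (simp add: e)
  have "q / Y \<noteq> q * p ^ i" if "1 \<le> i" for i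
  proof
    assume "q / Y = q * p ^ i"
    then have "p ^ i * Y = 1" using q_nonzero Y_nonzero by (simp add: field_simps)
    then have "q ^ (d * i + n) = 1" by (simp add: p_def Y_def power_add power_mult)
    then show False using not_root[of "d * i + n"] n_eq by simp
  qed
  then have "cprod (q / Y) = (\<Sum>k<2 * M + 1. rterm p q (p ^ (2 * M + 1)) (q / Y) k)"
    by (intro rterm_sum_cprod[symmetric])
  also have "\<dots> = (\<Sum>k<2 * m + 1. rterm p q (p ^ (2 * M + 1)) (q / Y) k)"
    using m_le_M e' by (intro sum_lessThan_extend_zero rterm_eq_0_d[of _ _ m]) auto
  also have "\<dots> = rprod p m q (p ^ (2 * M + 1)) (q / Y)"
  proof -
    have ba: "p ^ (2 * M + 1) \<noteq> q * p ^ (2 * i + 2)" for i using qp_ne_p[of "2 * i + 2" "2 * M + 1"] by metis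
    have ab: "q * p ^ (2 * M + 1) * p ^ (2 * i + 1) \<noteq> 1" for i
      using qp_ne_1[of "2 * M + 1 + (2 * i + 1)"] by (simp only: power_add mult.assoc) simp
    have b0: "p ^ (2 * M + 1) \<noteq> 0" using p_nonzero by simp
    show ?thesis
      unfolding rprod_d[OF e' p_nonzero qp_ne_1]
      unfolding e by (rule rterm_sum_terminating_d[OF p_nonzero p_not_root b0 qp_ne_1 ba ab])
  qed
  finally show ?thesis by simp
qed

text \<open>As functions of \<open>e\<close> both products contain the factors \<open>f e i\<close>
  with \<open>i < m\<close>; what remains is a constant \<open>h\<close> in \<open>rprod\<close> and
  \<open>c * \<psi> e\<close> in \<open>cprod\<close>. Equality at \<open>e = q / Y\<close> gives
  \<open>h = c * \<psi> (q / Y)\<close>. At \<open>e = q\<close> the difference thus contains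
  \<open>c * (\<psi> q - \<psi> (q / Y))\<close>, where \<open>c\<close> supplies one factor
  \<open>1 - Y\<close> and the bracket two.\<close>

lemma cprod_cong_rprod: "cong_mod 3 (cprod q) (rprod p m q (p ^ (2 * M + 1)) q)"
proof -
  let ?b = "p ^ (2 * M + 1)"
  define f where "f e i = (q - e * p ^ (2 * i + 1)) / (e - q * p ^ (2 * i + 2))" for e i
  define c where "c = (1 - q) * (\<Prod>i<M. (1 - q * p ^ (2 * i + 2)) / (q - p ^ (2 * i + 1)))"
  define h where "h = (1 - q) * (\<Prod>i<m. ((1 - q * p ^ (2 * i + 2)) * (1 - q * p ^ (2 * m + 2 * i + 2)) * ?b) /
     ((?b - q * p ^ (2 * i + 2)) * (- (p ^ (2 * i + 1))) * (1 - q * ?b * p ^ (2 * i + 1))))"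
  define \<psi> where "\<psi> e = (\<Prod>i\<in>{m..<M}. f e i)" for e
  have C: "cprod e = c * ((\<Prod>i<m. f e i) * \<psi> e)" for e
  proof -
    have "(\<Prod>i<m. f e i) * \<psi> e = (\<Prod>i<M. f e i)"
      unfolding \<psi>_def lessThan_atLeast0 using m_le_M by (intro prod.atLeastLessThan_concat) auto
    then show ?thesis unfolding cprod_def c_def by (simp add: f_def prod.distrib prod_dividef mult_ac)
  qed
  have H: "rprod p m q ?b e = h * (\<Prod>i<m. f e i)" for e
  proof -
    have "((1 - q * p ^ (2 * i + 2)) * (q - e * p ^ (2 * i + 1)) * (1 - q * p ^ (2 * m + 2 * i + 2)) * ?b) /
     ((e - q * p ^ (2 * i + 2)) * (?b - q * p ^ (2 * i + 2)) * (- (p ^ (2 * i + 1))) * (1 - q * ?b * p ^ (2 * i + 1)))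
     = ((1 - q * p ^ (2 * i + 2)) * (1 - q * p ^ (2 * m + 2 * i + 2)) * ?b) /
     ((?b - q * p ^ (2 * i + 2)) * (- (p ^ (2 * i + 1))) * (1 - q * ?b * p ^ (2 * i + 1))) * f e i" for i
      unfolding f_def times_divide_times_eq by (simp only: mult_ac)
    then show ?thesis unfolding rprod_def h_def mult.assoc prod.distrib[symmetric] by simp
  qed
  have cqY: "cong_mod 1 (q / Y) q" using cong_mult_left[OF cong_inverse_Y q_in] by simp
  have ndv: "\<not> n dvd 2 * i + 2" if "i < M" for i
    using not_dvd_even[of "i + 1"] that n_eq_M by simp
  have den: "unit (e - q * p ^ (2 * i + 2))" if "cong_mod 1 e q" "i < M" for e i
    using that by (intro unit_diff_p cong_mod_refl ndv)
  have f_in: "f e i \<in> R" if "cong_mod 1 e q" "i < M" for e i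
    unfolding f_def
    by (intro divide_in den that diff_in mult_in power_in p_in q_in cong_in[OF that(1) q_in])
  have "f (q / Y) i \<noteq> 0" if "i < m" for i
  proof -
    have "unit (q - q / Y * p ^ (2 * i + 1))"
      using that n_gt by (intro unit_diff_p cqY cong_mod_refl not_dvd_less) auto
    moreover have "unit (q / Y - q * p ^ (2 * i + 2))" using that m_le_M by (intro den cqY) auto
    ultimately show ?thesis unfolding f_def by (simp add: unit_def)
  qed
  then have "(\<Prod>i<m. f (q / Y) i) \<noteq> 0" by simp
  moreover have "h * (\<Prod>i<m. f (q / Y) i) = c * ((\<Prod>i<m. f (q / Y) i) * \<psi> (q / Y))"
    unfolding H[symmetric] C[symmetric] by (rule rprod_eq_cprod)
  ultimately have h: "h = c * \<psi> (q / Y)" by simp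
  have c1: "cong_mod 1 c 0"
  proof -
    let ?g = "\<lambda>i. (1 - q * p ^ (2 * i + 2)) / (q - p ^ (2 * i + 1))"
    have uq: "unit (q - p ^ (2 * i + 1))" if "i < M" for i
      using that unfolding M_def by (intro unit_a_minus cong_mod_refl)
    have g_in: "?g i \<in> R" if "i < M" for i
      using uq[OF that] by (intro divide_in diff_in one_in mult_in power_in p_in q_in)
    have mM: "m - 1 < M" using m_le_M m_ge by simp
    have "2 * (m - 1) + 2 = 2 * m" using m_ge by simp
    then have g1: "?g (m - 1) = (1 - Y) / (q - p ^ (2 * (m - 1) + 1))" by (simp only: q_times_p_power)
    have "(\<Prod>i<M. ?g i) = ?g (m - 1) * (\<Prod>i\<in>{..<M} - {m - 1}. ?g i)"
      using mM by (intro prod.remove) auto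
    then have "c - 0 = (1 - q ^ n) ^ 1 * ((1 - q) * (1 / (q - p ^ (2 * (m - 1) + 1))) * (\<Prod>i\<in>{..<M} - {m - 1}. ?g i))"
      unfolding c_def g1 t_eq by simp
    moreover have "(1 - q) * (1 / (q - p ^ (2 * (m - 1) + 1))) * (\<Prod>i\<in>{..<M} - {m - 1}. ?g i) \<in> R"
      using uq[OF mM] by (intro mult_in prod_in divide_in one_in diff_in q_in g_in) auto
    ultimately show ?thesis by (rule cong_modI)
  qed
  have \<psi>2: "cong_mod 2 (\<psi> q) (\<psi> (q / Y))"
  proof -
    \<comment> \<open>With the denominators in reverse order the exponents in factor
      \<open>i\<close> add up to \<open>n\<close>, so \<open>?x * ?z = Y ^ d\<close>. This yields a
      second factor \<open>1 - Y\<close> beside the one caused by replacing \<open>q\<close> with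
      \<open>q / Y\<close>.\<close>
    let ?f = "\<lambda>e i. (q - e * p ^ (2 * i + 1)) / (e - q * p ^ (2 * (M + m - Suc i) + 2))"
    have re: "\<psi> e = (\<Prod>i\<in>{m..<M}. ?f e i)" for e
    proof -
      have "(\<Prod>i\<in>{m..<M}. e - q * p ^ (2 * i + 2)) = (\<Prod>i\<in>{m..<M}. e - q * p ^ (2 * (M + m - Suc i) + 2))"
        by (rule prod.atLeastLessThan_rev)
      then show ?thesis unfolding \<psi>_def f_def prod_dividef by (simp only:)
    qed
    have lt: "M + m - Suc i < M" if "i \<in> {m..<M}" for i using that by auto
    show ?thesis unfolding re
    proof (rule cong_mod_prod)
      fix i assume i: "i \<in> {m..<M}"
      let ?x = "p ^ (2 * i + 1)" and ?z = "p ^ (2 * (M + m - Suc i) + 2)"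
      have u1: "unit (q - q * ?z)" by (intro den cong_mod_refl lt i)
      have u2: "unit (q / Y - q * ?z)" by (intro den cqY lt i)
      show "?f q i \<in> R" using u1 by (intro divide_in diff_in mult_in q_in power_in p_in)
      show "?f (q / Y) i \<in> R" using u2 by (intro divide_in diff_in mult_in q_in power_in p_in unit_Y)
      have xz: "?x * ?z = Y ^ d"
      proof -
        have "2 * i + 1 + (2 * (M + m - Suc i) + 2) = n" using i n_eq_M by auto
        then show ?thesis unfolding p_power_n[symmetric] by (metis power_add)
      qed
      have u1': "unit (1 - ?z)" using ndv[OF lt[OF i]] by (rule unit_one_minus_p)
      have "unit (Y / q * (q / Y - q * ?z))" by (intro unit_mult u2 unit_divide unit_Y unit_q)
      moreover have "Y / q * (q / Y - q * ?z) = 1 - Y * ?z" using q_nonzero Y_nonzero by (simp add: algebra_simps)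
      ultimately have u2': "unit (1 - Y * ?z)" by simp
      have f1: "?f q i = (1 - ?x) / (1 - ?z)"
      proof -
        have "q - q * w = q * (1 - w)" for w by (simp add: algebra_simps)
        then show ?thesis using q_nonzero by simp
      qed
      have f2: "?f (q / Y) i = (Y - ?x) / (1 - Y * ?z)"
      proof -
        have "q - q / Y * ?x = q / Y * (Y - ?x)" "q / Y - q * ?z = q / Y * (1 - Y * ?z)"
          using Y_nonzero by (simp_all add: algebra_simps)
        then show ?thesis using q_nonzero Y_nonzero by simp
      qed
      have sub: "?f q i - ?f (q / Y) i = ((1 - ?x) * (1 - Y * ?z) - (Y - ?x) * (1 - ?z)) / ((1 - ?z) * (1 - Y * ?z))"
        unfolding f1 f2 by (rule diff_frac_eq[OF unit_nonzero[OF u1'] unit_nonzero[OF u2']])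
      have num: "(1 - x) * (1 - Y * z) - (Y - x) * (1 - z) = (1 - Y) * (1 - x * z)" for x z
        by (simp add: algebra_simps)
      show "cong_mod 2 (?f q i) (?f (q / Y) i)"
      proof (rule cong_modI)
        show "?f q i - ?f (q / Y) i = (1 - q ^ n)\<^sup>2 * ((\<Sum>j<d. Y ^ j) / ((1 - ?z) * (1 - Y * ?z)))"
          unfolding sub num xz one_minus_Y_power t_eq by (simp add: power2_eq_square)
        show "(\<Sum>j<d. Y ^ j) / ((1 - ?z) * (1 - Y * ?z)) \<in> R"
          by (intro divide_in sum_in power_in Y_in unit_mult u1' u2')
      qed
    qed
  qed
  have "cong_mod 2 (\<psi> q - \<psi> (q / Y)) 0" using \<psi>2 by (simp add: cong_mod_def)
  from cong_mod_0_mult[OF c1 this]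
  have "cong_mod (1 + 2) (c * (\<psi> q - \<psi> (q / Y))) 0" .
  moreover have "1 + 2 = (3 :: nat)" by simp
  ultimately have "cong_mod 3 (c * (\<psi> q - \<psi> (q / Y))) 0" by (simp only:)
  moreover have "(\<Prod>i<m. f q i) \<in> R" using m_le_M by (intro prod_in f_in cong_mod_refl) auto
  ultimately have "cong_mod 3 (c * (\<psi> q - \<psi> (q / Y)) * (\<Prod>i<m. f q i)) 0"
    by (rule cong_mod_0_mult_in)
  moreover have "cprod q - rprod p m q ?b q = c * (\<psi> q - \<psi> (q / Y)) * (\<Prod>i<m. f q i)"
    unfolding C H h by (simp add: algebra_simps)
  ultimately show ?thesis by (simp add: cong_mod_def)
qed

end

section \<open>The non-unit denominator and the divisibility of the tail\<close>

context cyclo_ring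
begin

text \<open>
  The factor of index \<open>J\<close> is the only one in the denominators of the tail that is not a unit.
\<close>
definition J where "J = (d + 2) * m"
definition L where "L x = 1 - q * (q * (1 + x)) * p ^ (2 * J + 1)" for x

text \<open>By the choice of \<open>J\<close> the exponent of \<open>q\<close> in \<open>L\<close>
  is \<open>n * (d + 2)\<close>. Consequently \<open>L\<close> is \<open>1 - Y\<close> times a unit
  both at \<open>x = 0\<close> and at \<open>x = Y ^ (d - 1) - 1\<close>.\<close>

lemma L_eq: "L x = 1 - (1 + x) * Y ^ (d + 2)"
proof -
  have e: "2 + d * (2 * ((d + 2) * m) + 1) = (2 * d * m + 1) * (d + 2)" by (simp add: algebra_simps)
  have "q * q * p ^ (2 * J + 1) = q ^ (2 + d * (2 * ((d + 2) * m) + 1))"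
    unfolding p_def J_def power_mult[symmetric] power_add[of q 2] power2_eq_square ..
  also have "\<dots> = Y ^ (d + 2)" unfolding e Y_def power_mult[symmetric] by (metis n_eq)
  finally have "q * q * p ^ (2 * J + 1) = Y ^ (d + 2)" .
  moreover have "L x = 1 - (1 + x) * (q * q * p ^ (2 * J + 1))" by (simp add: L_def mult_ac)
  ultimately show ?thesis by (simp only:)
qed

lemma prod_zero_mod:
  assumes "finite A" "j \<in> A" "\<And>i. i \<in> A \<Longrightarrow> f i \<in> R" "cong_mod 1 (f j) 0"
  shows "cong_mod 1 (prod f A) 0"
  unfolding prod.remove[OF assms(1,2)]
  by (intro cong_mod_0_mult_in assms prod_in) (use assms in auto)

lemma cong_t: "cong_mod 1 (1 - Y) 0"
  by (rule cong_modI[OF _ one_in]) (simp add: t_eq)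

text \<open>\<open>1 - q * p ^ (2 * m) = 1 - Y\<close> occurs twice independently of
  \<open>x\<close>: at \<open>j = 2 * m\<close> among the \<open>a\<close> factors and at
  \<open>j = m\<close> among the \<open>d\<close> factors. The third such factor, from
  \<open>b\<close>, varies with \<open>x\<close> and stays inside \<open>g\<close>, to be exploited
  through its zero. \<open>L\<close> clears the denominator that may fail to be a unit.\<close>

lemma rterm_tail_regular:
  assumes k: "2 * m < k" "k < n"
  shows "\<exists>g. regular g \<and> (\<forall>x. L x \<noteq> 0 \<longrightarrow> L x * rterm p q (q * (1 + x)) q k = (1 - Y)\<^sup>2 * g x)"
proof -
  let ?b = "\<lambda>x. q * (1 + x)"
  let ?c3 = "\<Prod>j<k. q * p ^ Suc j / ((1 - p ^ (2 * j + 2)) * (q - q * p ^ Suc j))"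
  let ?v = "\<lambda>x. \<Prod>j<k. (1 - ?b x * p ^ j) * (?b x - p ^ Suc j) / (?b x - q * p ^ (2 * j + 2))"
  define D where "D j x = inverse (1 - q * ?b x * p ^ (2 * j + 1))" for j x
  \<comment> \<open>For \<open>J < k\<close> the bad denominator cancels against \<open>L x\<close>;
    otherwise \<open>L x\<close> is simply carried along. In this way all \<open>k\<close> share one
    multiplier and the tail can be summed.\<close>
  define E where "E x = (if J < k then (\<Prod>j\<in>{..<k} - {J}. D j x) else L x * (\<Prod>j<k. D j x))" for x
  have regb: "regular ?b"
    by (rule regular_mult[OF regular_const[OF q_in] regular_add[OF regular_const[OF one_in] regular_id]])
  have reg1: "regular (\<lambda>x. 1 + x)"
    by (rule regular_add[OF regular_const[OF one_in] regular_id])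
  have ndv: "\<not> n dvd 2 * j + 2" if "j < k" for j
    using not_dvd_even[of "j + 1"] that k by simp
  have regD: "regular (D j)" if "j < k" "j \<noteq> J" for j
    unfolding D_def
  proof (intro regular_inverse regular_diff regular_mult regular_const regb reg1 one_in q_in power_in p_in)
    have "unit (1 - q * q * p ^ (2 * j + 1))"
      using that k by (intro unit_one_minus_ab cong_mod_refl) (auto simp: J_def)
    then show "unit (1 - q * (q * (1 + 0)) * p ^ (2 * j + 1))" by simp
  qed
  have regE: "regular E"
  proof (cases "J < k")
    case True
    have "regular (\<lambda>x. \<Prod>j\<in>{..<k} - {J}. D j x)" by (intro regular_prod regD) auto
    then show ?thesis using True by (simp add: E_def[abs_def])
  next
    case False
    have "regular (\<lambda>x. L x * (\<Prod>j<k. D j x))"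
      unfolding L_def using False
      by (intro regular_mult regular_prod regD regular_diff regular_const regb reg1 one_in q_in power_in p_in) auto
    then show ?thesis using False by (simp add: E_def[abs_def])
  qed
  have regv: "regular ?v"
  proof (intro regular_prod regular_divide regular_mult regular_diff regular_const regb reg1 one_in q_in power_in p_in)
    fix j assume "j \<in> {..<k}"
    then have "unit (q - q * p ^ (2 * j + 2))" using ndv by (intro unit_diff_p cong_mod_refl) auto
    then show "unit (q * (1 + 0) - q * p ^ (2 * j + 2))" by simp
  qed
  have "cong_mod 1 (\<Prod>j<k. 1 - q * p ^ j) 0"
    using k by (intro prod_zero_mod[of _ "2 * m"] diff_in mult_in one_in q_in power_in p_in)
      (auto simp: q_times_p_power cong_t[simplified])
  then obtain r1 where r1: "r1 \<in> R" "(\<Prod>j<k. 1 - q * p ^ j) = (1 - Y) * r1"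
    unfolding cong_mod_def unfolding t_eq by auto
  have "cong_mod 1 (\<Prod>j<k. 1 - q * p ^ (2 * j)) 0"
    using k by (intro prod_zero_mod[of _ m] diff_in mult_in one_in q_in power_in p_in)
      (auto simp: q_times_p_power cong_t[simplified])
  then obtain r2 where r2: "r2 \<in> R" "(\<Prod>j<k. 1 - q * p ^ (2 * j)) = (1 - Y) * r2"
    unfolding cong_mod_def unfolding t_eq by auto
  have c3: "?c3 \<in> R"
  proof (intro prod_in divide_in mult_in q_in power_in p_in unit_mult)
    fix j assume "j \<in> {..<k}"
    then have j: "j < k" by simp
    show "unit (1 - p ^ (2 * j + 2))" by (intro unit_one_minus_p ndv j)
    show "unit (q - q * p ^ Suc j)" using j k by (intro unit_diff_p cong_mod_refl not_dvd_less) auto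
  qed
  let ?g = "\<lambda>x. ((1 - q * p ^ (3 * k)) * (r1 * r2 * ?c3)) * (?v x * E x)"
  have "regular ?g"
    by (intro regular_mult regular_const regv regE mult_in r1 r2 c3 diff_in one_in q_in power_in p_in)
  moreover have "L x * rterm p q (?b x) q k = (1 - Y)\<^sup>2 * ?g x" if "L x \<noteq> 0" for x
  proof -
    have LE: "L x * (\<Prod>j<k. D j x) = E x"
    proof (cases "J < k")
      case True
      have "D J x = inverse (L x)" by (simp add: D_def L_def)
      moreover have "(\<Prod>j<k. D j x) = D J x * (\<Prod>j\<in>{..<k} - {J}. D j x)"
        using True by (intro prod.remove) auto
      ultimately show ?thesis using True that by (simp add: E_def)
    qed (simp add: E_def)
    have "rterm p q (?b x) q k = (1 - q * p ^ (3 * k)) * (\<Prod>j<k. (1 - q * p ^ j) * ((1 - q * p ^ (2 * j)) *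
       (q * p ^ Suc j / ((1 - p ^ (2 * j + 2)) * (q - q * p ^ Suc j)) *
       ((1 - ?b x * p ^ j) * (?b x - p ^ Suc j) / (?b x - q * p ^ (2 * j + 2)) * D j x))))"
      unfolding rterm_def
    proof (intro arg_cong[where f = "\<lambda>z. (1 - q * p ^ (3 * k)) * z"] prod.cong refl)
      fix j
      have gen: "A * B * C * D' * q * P / (u * v * w * y) = A * (D' * (q * P / (u * y) * (B * C / v * inverse w)))"
        for A B C D' P u v w y :: 'a by (simp add: field_simps)
      show "(1 - q * p ^ j) * (1 - ?b x * p ^ j) * (?b x - p ^ Suc j) * (1 - q * p ^ (2 * j)) * q * p ^ Suc j /
       ((1 - p ^ (2 * j + 2)) * (?b x - q * p ^ (2 * j + 2)) * (1 - q * ?b x * p ^ (2 * j + 1)) * (q - q * p ^ Suc j)) =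
       (1 - q * p ^ j) * ((1 - q * p ^ (2 * j)) *
       (q * p ^ Suc j / ((1 - p ^ (2 * j + 2)) * (q - q * p ^ Suc j)) *
       ((1 - ?b x * p ^ j) * (?b x - p ^ Suc j) / (?b x - q * p ^ (2 * j + 2)) * D j x)))"
        unfolding D_def by (rule gen)
    qed
    also have "\<dots> = (1 - q * p ^ (3 * k)) * ((1 - Y) * r1 * ((1 - Y) * r2 * (?c3 * (?v x * (\<Prod>j<k. D j x)))))"
      by (simp only: prod.distrib[of _ _ "{..<k}"] r1(2)[symmetric] r2(2)[symmetric])
    finally have "L x * rterm p q (?b x) q k =
        (1 - q * p ^ (3 * k)) * ((1 - Y) * r1 * ((1 - Y) * r2 * (?c3 * (?v x * (L x * (\<Prod>j<k. D j x))))))"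
      by (simp only: mult_ac)
    then show ?thesis unfolding LE power2_eq_square by (simp only: mult_ac)
  qed
  ultimately show ?thesis by blast
qed

text \<open>With \<open>L * T = (1 - Y)\<^sup>2 * w\<close>, the function \<open>w\<close> vanishes
  at \<open>s1\<close>, and at \<open>s2\<close> modulo \<open>(1 - Y)\<^sup>2\<close>. As
  \<open>s2 - s1\<close> is \<open>1 - Y\<close> times a unit, the quotient \<open>h\<close> of
  \<open>w\<close> by \<open>x - s1\<close> vanishes modulo \<open>1 - Y\<close> at
  \<open>s2\<close>, hence also at 0. So \<open>(1 - Y)\<^sup>2\<close> divides \<open>w 0\<close>,
  and removing \<open>L 0\<close> from a fourth power leaves a cube.\<close>

theorem rterm_tail_cong: "cong_mod 3 (\<Sum>k\<in>{2 * m + 1..<n}. rterm p q q q k) 0"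
proof -
  let ?K = "{2 * m + 1..<n}"
  define T where "T x = (\<Sum>k\<in>?K. rterm p q (q * (1 + x)) q k)" for x
  have "\<forall>k\<in>?K. \<exists>g. regular g \<and> (\<forall>x. L x \<noteq> 0 \<longrightarrow> L x * rterm p q (q * (1 + x)) q k = (1 - Y)\<^sup>2 * g x)"
    using rterm_tail_regular by auto
  then obtain g where g: "\<And>k. k \<in> ?K \<Longrightarrow> regular (g k)"
    "\<And>k x. k \<in> ?K \<Longrightarrow> L x \<noteq> 0 \<Longrightarrow> L x * rterm p q (q * (1 + x)) q k = (1 - Y)\<^sup>2 * g k x"
    by metis
  define w where "w x = (\<Sum>k\<in>?K. g k x)" for x
  have regw: "regular w" unfolding w_def by (intro regular_sum g)
  have w: "L x * T x = (1 - Y)\<^sup>2 * w x" if "L x \<noteq> 0" for x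
    unfolding T_def w_def sum_distrib_left using g(2) that by (intro sum.cong refl) auto
  have t0: "1 - Y \<noteq> 0" using Y_not_root[of 1] by simp
  define s1 s2 where "s1 = 1 / Y - 1" and "s2 = Y ^ (d - 1) - 1"
  have s1: "cong_mod 1 s1 0" unfolding s1_def using cong_diff[OF cong_inverse_Y cong_mod_refl[of 1 1]] by simp
  have s2: "cong_mod 1 s2 0" unfolding s2_def using cong_diff[OF cong_Y_power cong_mod_refl[of 1 1]] by simp
  \<comment> \<open>Here \<open>q * (1 + s1) = p^(-2m)\<close>, which kills every term with
    \<open>k > 2 * m\<close>.\<close>
  have ws1: "w s1 = 0"
  proof -
    have "L s1 = 1 - Y ^ (d + 1)" unfolding L_eq s1_def using Y_nonzero by simp
    then have "L s1 \<noteq> 0" using Y_not_root[of "d + 1"] by simp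
    moreover have "T s1 = 0"
      unfolding T_def
    proof (intro sum.neutral ballI)
      fix k assume "k \<in> ?K"
      then show "rterm p q (q * (1 + s1)) q k = 0"
        using q_times_p_power Y_nonzero by (intro rterm_eq_0_b[of _ _ "2 * m"]) (auto simp: s1_def)
    qed
    ultimately show ?thesis using w[of s1] t0 by simp
  qed
  \<comment> \<open>At \<open>b = p ^ (2 * M + 1)\<close> the tail is the full sum
    \<open>cprod q\<close> minus the short sum, and both are congruent to the same
    \<open>rprod\<close> modulo the cube. The factor \<open>1 - Y\<close> of \<open>L s2\<close>
    makes this a fourth power, of which \<open>w\<close> keeps a square.\<close>
  have ws2: "cong_mod 2 (w s2) 0"
  proof -
    have "L s2 = 1 - Y ^ (d - 1 + (d + 2))" unfolding L_eq s2_def power_add[of _ "d - 1"] by simp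
    then have L2: "L s2 = (1 - Y) * (\<Sum>j<d - 1 + (d + 2). Y ^ j)" by (simp only: one_minus_Y_power)
    define S where "S = (\<Sum>j<d - 1 + (d + 2). Y ^ j)"
    have Lu: "unit S" unfolding S_def by (rule unit_geom) simp
    have Ln: "L s2 \<noteq> 0" using L2[folded S_def] t0 unit_nonzero[OF Lu] by simp
    have b: "q * (1 + s2) = p ^ (2 * M + 1)" unfolding p_power_M s2_def by simp
    have "cong_mod 3 (T s2) 0"
    proof -
      have c\<beta>: "cong_mod 1 (Y ^ (d - 1)) 1" by (rule cong_Y_power)
      have "cong_mod 3 (\<Sum>k<2 * m + 1. rterm p q (p ^ (2 * M + 1)) q k) (rprod p m q (p ^ (2 * M + 1)) q)"
        using rterm_sum_cong_rprod[OF c\<beta>] unfolding p_power_M .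
      from cong_diff[OF cprod_cong_rprod this]
      have *: "cong_mod 3 (cprod q - (\<Sum>k<2 * m + 1. rterm p q (p ^ (2 * M + 1)) q k)) 0" by simp
      have "q \<noteq> q * p ^ i" if "1 \<le> i" for i using p_not_root[of i] q_nonzero that by simp
      then have "cprod q = (\<Sum>k<2 * M + 1. rterm p q (p ^ (2 * M + 1)) q k)"
        by (rule rterm_sum_cprod[symmetric])
      also have "\<dots> = (\<Sum>k<n. rterm p q (p ^ (2 * M + 1)) q k)"
        using n_eq_M by (intro sum_lessThan_extend_zero[symmetric] rterm_eq_0_b'[of _ _ "2 * M"]) auto
      also have "\<dots> = (\<Sum>k<2 * m + 1. rterm p q (p ^ (2 * M + 1)) q k) + T s2"
        unfolding T_def b lessThan_atLeast0 using n_eq_M by (intro sum.atLeastLessThan_concat[symmetric]) auto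
      finally show ?thesis using * by simp
    qed
    then obtain r where r: "r \<in> R" "T s2 = (1 - Y) ^ 3 * r" unfolding cong_mod_def unfolding t_eq by auto
    have "(1 - Y)\<^sup>2 * w s2 = (1 - Y)\<^sup>2 * ((1 - Y)\<^sup>2 * (S * r))"
      unfolding w[OF Ln, symmetric] unfolding L2[folded S_def] r(2) by (simp add: power2_eq_square power3_eq_cube)
    moreover have "(1 - Y)\<^sup>2 \<noteq> 0" using t0 by simp
    ultimately have "w s2 = (1 - Y)\<^sup>2 * (S * r)" using mult_left_cancel by blast
    then have "w s2 - 0 = (1 - q ^ n)\<^sup>2 * (S * r)" unfolding t_eq by simp
    then show ?thesis by (rule cong_modI) (intro mult_in r unit_in Lu)
  qed
  obtain h where h: "regular h" "\<And>x. cong_mod 1 x 0 \<Longrightarrow> w x = (x - s1) * h x"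
    using regular_factor_root[OF regw s1 ws1] by blast
  have "cong_mod 1 (h s2) 0"
  proof -
    obtain r where r: "r \<in> R" "w s2 = (1 - Y)\<^sup>2 * r" using ws2 unfolding cong_mod_def unfolding t_eq by auto
    have U: "unit (\<Sum>j<d. Y ^ j)" using d_ge by (intro unit_geom) simp
    have "Y ^ d = Y * Y ^ (d - 1)" using d_ge by (simp flip: power_Suc)
    then have "s2 - s1 = - (1 - Y ^ d) / Y" using Y_nonzero by (simp add: s1_def s2_def field_simps)
    then have "Y * (s2 - s1) = - ((1 - Y) * (\<Sum>j<d. Y ^ j))" using Y_nonzero by (simp add: one_minus_Y_power)
    then have "(1 - Y) * ((\<Sum>j<d. Y ^ j) * h s2) = - (Y * (s2 - s1)) * h s2" by simp
    also have "\<dots> = - (Y * w s2)" unfolding h(2)[OF s2] by simp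
    also have "\<dots> = (1 - Y) * ((1 - Y) * (- (Y * r)))" unfolding r(2) by (simp add: power2_eq_square)
    finally have "(1 - Y) * ((\<Sum>j<d. Y ^ j) * h s2) = (1 - Y) * ((1 - Y) * (- (Y * r)))" .
    then have "(\<Sum>j<d. Y ^ j) * h s2 = (1 - Y) * (- (Y * r))" using t0 by (simp only: mult_cancel_left) simp
    then have "h s2 = (1 - Y) * (- (Y * r)) / (\<Sum>j<d. Y ^ j)"
      using unit_nonzero[OF U] by (metis nonzero_mult_div_cancel_left)
    then have "h s2 - 0 = (1 - q ^ n) ^ 1 * (- (Y * r) / (\<Sum>j<d. Y ^ j))"
      unfolding t_eq by simp
    then show ?thesis by (rule cong_modI) (intro divide_in uminus_in mult_in Y_in r U)
  qed
  then have h0: "cong_mod 1 (h 0) 0"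
    using cong_mod_trans[OF cong_mod_sym[OF regular_cong[OF h(1) s2]]] by blast
  have "w 0 = - s1 * h 0" using h(2)[OF cong_mod_refl] by simp
  moreover have "cong_mod (1 + 1) (- s1 * h 0) 0"
    by (rule cong_mod_0_mult[OF _ h0]) (use cong_uminus[OF s1] in simp)
  ultimately obtain r where r: "r \<in> R" "w 0 = (1 - Y)\<^sup>2 * r"
    unfolding cong_mod_def unfolding t_eq by (auto simp: power2_eq_square)
  have L0: "L 0 = (1 - Y) * (\<Sum>j<d + 2. Y ^ j)" unfolding L_eq by (simp only: add_0_right mult_1_left one_minus_Y_power)
  have U: "unit (\<Sum>j<d + 2. Y ^ j)" by (rule unit_geom) simp
  have "L 0 \<noteq> 0" using L0 t0 unit_nonzero[OF U] by simp
  then have "(1 - Y) * ((\<Sum>j<d + 2. Y ^ j) * T 0) = (1 - Y) * ((1 - Y) ^ 3 * r)"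
    using w[of 0] unfolding L0 r(2) by (simp add: power2_eq_square power3_eq_cube mult_ac)
  then have "(\<Sum>j<d + 2. Y ^ j) * T 0 = (1 - Y) ^ 3 * r" using t0 by (simp only: mult_cancel_left) simp
  then have "T 0 - 0 = (1 - q ^ n) ^ 3 * (r / (\<Sum>j<d + 2. Y ^ j))"
    unfolding t_eq using unit_nonzero[OF U] by (simp add: nonzero_eq_divide_eq mult.commute)
  then have "cong_mod 3 (T 0) 0" by (rule cong_modI) (intro divide_in r U)
  then show ?thesis by (simp add: T_def)
qed

definition target where
  "target = (1 - Y) * (\<Prod>i<m. (1 - p ^ (2 * i + 1)) / (1 - q * q * p ^ (2 * i + 1))) * (q ^ m / p ^ m)"

theorem rterm_sum_cong_target: "cong_mod 3 (\<Sum>k<2 * m + 1. rterm p q q q k) target"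
  using cong_mod_trans[OF rterm_sum_cong_rprod[OF cong_mod_refl] ] rprod_cong_target
  unfolding target_def by simp

theorem rterm_full_sum_cong_target: "cong_mod 3 (\<Sum>k<n. rterm p q q q k) target"
proof -
  have "(\<Sum>k<n. rterm p q q q k) = (\<Sum>k<2 * m + 1. rterm p q q q k) + (\<Sum>k\<in>{2 * m + 1..<n}. rterm p q q q k)"
    unfolding lessThan_atLeast0 using n_eq_M by (intro sum.atLeastLessThan_concat[symmetric]) auto
  then show ?thesis using cong_mod_add[OF rterm_sum_cong_target rterm_tail_cong] by simp
qed

end

section \<open>Rational functions modulo a cyclotomic polynomial\<close>

definition root_eval :: "rat poly \<Rightarrow> complex \<Rightarrow> complex" where
  "root_eval v z = poly (map_poly of_rat v) z"

lemma root_eval_add: "root_eval (u + v) z = root_eval u z + root_eval v z"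
  by (simp add: root_eval_def map_poly_of_rat_add)

lemma root_eval_mult: "root_eval (u * v) z = root_eval u z * root_eval v z"
  by (simp add: root_eval_def map_poly_of_rat_mult)

lemma root_eval_0: "root_eval 0 z = 0" by (simp add: root_eval_def)

lemma root_eval_1: "root_eval 1 z = 1" by (simp add: root_eval_def)

lemma root_eval_diff: "root_eval (u - v) z = root_eval u z - root_eval v z"
  using root_eval_add[of "u - v" v z] by simp

lemma root_eval_power: "root_eval (u ^ e) z = root_eval u z ^ e"
  by (induction e) (simp_all add: root_eval_1 root_eval_mult)

lemma root_eval_X_power: "root_eval ([:0, 1:] ^ e) z = z ^ e"
  unfolding root_eval_power by (simp add: root_eval_def map_poly_pCons)

lemma root_eval_sum: "root_eval (\<Sum>j\<in>A. f j) z = (\<Sum>j\<in>A. root_eval (f j) z)"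
  by (induction A rule: infinite_finite_induct) (simp_all add: root_eval_0 root_eval_add)

lemma primitive_roots_nonempty:
  assumes "n > 0"
  shows "primitive_roots n \<noteq> {}"
proof -
  let ?f = "\<lambda>k. cis (2 * pi * real k / real n)"
  let ?w = "?f 1"
  have inj: "inj_on ?f {..<n}" and im: "?f ` {..<n} = {z. z ^ n = 1}"
    using bij_betw_roots_unity[OF assms] by (auto simp: bij_betw_def)
  have pw: "?w ^ k = ?f k" for k by (simp add: DeMoivre mult_ac)
  have "?w \<in> primitive_roots n"
    unfolding primitive_roots_def
  proof (intro CollectI conjI allI impI)
    show "?w ^ n = 1" unfolding pw using assms by simp
    fix k assume k: "0 < k \<and> k < n"
    show "?w ^ k \<noteq> 1"
    proof
      assume "?w ^ k = 1"
      then have "?f k = ?f 0" unfolding pw by simp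
      then show False using inj_onD[OF inj, of k 0] k by simp
    qed
  qed
  then show ?thesis by blast
qed

text \<open>Values at the roots instead of coprimality: the condition is visibly multiplicative, and
  for \<open>1 - X ^ e\<close> it becomes a question about exponents.
  \<open>coprime_cyclotomic\<close> leads back to the notion in \<open>ratfun_cong\<close>.\<close>

definition cyclotomic_unit :: "nat \<Rightarrow> rat poly \<Rightarrow> bool" where
  "cyclotomic_unit n v \<longleftrightarrow> v \<noteq> 0 \<and> (\<forall>z\<in>primitive_roots n. root_eval v z \<noteq> 0)"

definition cyclotomic_local_ring :: "nat \<Rightarrow> rat poly fract set" where
  "cyclotomic_local_ring n = {to_fract u / to_fract v | u v. cyclotomic_unit n v}"

lemma cyclotomic_unit_mult: "cyclotomic_unit n u \<Longrightarrow> cyclotomic_unit n v \<Longrightarrow> cyclotomic_unit n (u * v)"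
  by (simp add: cyclotomic_unit_def root_eval_mult)

lemma cyclotomic_unit_1: "cyclotomic_unit n 1"
  by (simp add: cyclotomic_unit_def root_eval_1)

lemma cyclotomic_unitI:
  assumes "n > 0" "\<And>z. z \<in> primitive_roots n \<Longrightarrow> root_eval v z \<noteq> 0"
  shows "cyclotomic_unit n v"
proof -
  obtain z where "z \<in> primitive_roots n" using primitive_roots_nonempty[OF assms(1)] by blast
  then have "v \<noteq> 0" using assms(2)[of z] by (auto simp: root_eval_0)
  then show ?thesis using assms by (simp add: cyclotomic_unit_def)
qed

lemma cyclotomic_local_ringI:
  "cyclotomic_unit n v \<Longrightarrow> to_fract u / to_fract v \<in> cyclotomic_local_ring n"
  unfolding cyclotomic_local_ring_def by blast

lemma to_fract_in_local_ring: "to_fract u \<in> cyclotomic_local_ring n"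
  using cyclotomic_local_ringI[OF cyclotomic_unit_1, of u] by simp

lemma cyclotomic_unit_of_inverse:
  assumes "cyclotomic_unit n v" "to_fract u / to_fract v \<noteq> 0"
    and "inverse (to_fract u / to_fract v) \<in> cyclotomic_local_ring n"
  shows "cyclotomic_unit n u"
proof -
  obtain u' v' where uv: "inverse (to_fract u / to_fract v) = to_fract u' / to_fract v'" "cyclotomic_unit n v'"
    using assms(3) unfolding cyclotomic_local_ring_def by blast
  have nz: "v \<noteq> 0" "v' \<noteq> 0" "u \<noteq> 0" using assms uv(2) by (auto simp: cyclotomic_unit_def)
  then have "to_fract (v * v') = to_fract (u * u')"
    using uv(1) by (simp add: field_simps)
  then have "v * v' = u * u'" by (simp only: to_fract_eq_iff)
  then have "root_eval u z \<noteq> 0" if "z \<in> primitive_roots n" for z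
    using that cyclotomic_unit_mult[OF assms(1) uv(2)] by (auto simp: cyclotomic_unit_def root_eval_mult)
  then show ?thesis using nz by (simp add: cyclotomic_unit_def)
qed

lemma to_fract_power: "to_fract (x ^ k) = to_fract x ^ k"
  by (induction k) simp_all

lemma qvar_power: "qvar ^ e = to_fract ([:0, 1:] ^ e)"
  by (simp only: qvar_def to_fract_power)

lemma adic_subring_cyclotomic:
  assumes n: "n > 0"
  shows "adic_subring (cyclotomic_local_ring n) (1 - qvar ^ n)"
proof
  let ?R = "cyclotomic_local_ring n"
  have t: "1 - qvar ^ n = to_fract (1 - [:0, 1:] ^ n)" by (simp add: qvar_power)
  show "1 \<in> ?R" using to_fract_in_local_ring[of 1] by simp
  show "1 - qvar ^ n \<in> ?R" unfolding t by (rule to_fract_in_local_ring)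
  show "- x \<in> ?R" if x: "x \<in> ?R" for x
  proof -
    obtain u v where "x = to_fract u / to_fract v" "cyclotomic_unit n v"
      using x unfolding cyclotomic_local_ring_def by blast
    then show ?thesis using cyclotomic_local_ringI[of n v "- u"] by simp
  qed
  show "x + y \<in> ?R" if xy: "x \<in> ?R" "y \<in> ?R" for x y
  proof -
    obtain u v u' v' where 1: "x = to_fract u / to_fract v" "cyclotomic_unit n v"
      "y = to_fract u' / to_fract v'" "cyclotomic_unit n v'"
      using xy unfolding cyclotomic_local_ring_def by blast
    then have "x + y = to_fract (u * v' + u' * v) / to_fract (v * v')"
      by (simp add: cyclotomic_unit_def add_frac_eq)
    then show ?thesis using cyclotomic_local_ringI cyclotomic_unit_mult 1 by metis
  qed
  show "x * y \<in> ?R" if xy: "x \<in> ?R" "y \<in> ?R" for x y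
  proof -
    obtain u v u' v' where 1: "x = to_fract u / to_fract v" "cyclotomic_unit n v"
      "y = to_fract u' / to_fract v'" "cyclotomic_unit n v'"
      using xy unfolding cyclotomic_local_ring_def by blast
    then have "x * y = to_fract (u * u') / to_fract (v * v')" by simp
    then show ?thesis using cyclotomic_local_ringI cyclotomic_unit_mult 1 by metis
  qed
  show "u + (1 - qvar ^ n) * x \<noteq> 0 \<and> inverse (u + (1 - qvar ^ n) * x) \<in> ?R"
    if u: "u \<in> ?R" "u \<noteq> 0" "inverse u \<in> ?R" and x: "x \<in> ?R" for u x
  proof -
    obtain a b where ab: "u = to_fract a / to_fract b" "cyclotomic_unit n b"
      using u(1) unfolding cyclotomic_local_ring_def by blast
    obtain c e where ce: "x = to_fract c / to_fract e" "cyclotomic_unit n e"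
      using x unfolding cyclotomic_local_ring_def by blast
    have a: "cyclotomic_unit n a" using cyclotomic_unit_of_inverse[OF ab(2)] u(2,3) ab(1) by simp
    \<comment> \<open>The numerator of \<open>u + (1 - qvar ^ n) * x\<close>. At a primitive root
      \<open>z ^ n = 1\<close>, so only the nonzero value of \<open>a * e\<close> remains.\<close>
    define w where "w = a * e + (1 - [:0, 1:] ^ n) * c * b"
    have w: "cyclotomic_unit n w"
    proof (rule cyclotomic_unitI[OF n])
      fix z assume z: "z \<in> primitive_roots n"
      then have "z ^ n = 1" by (simp add: primitive_roots_def)
      then show "root_eval w z \<noteq> 0" using z a ce(2)
        by (simp add: w_def root_eval_add root_eval_mult root_eval_diff root_eval_1 root_eval_X_power cyclotomic_unit_def)
    qed
    have "u + (1 - qvar ^ n) * x = to_fract w / to_fract (b * e)"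
      unfolding ab ce t using ab(2) ce(2) by (simp add: w_def cyclotomic_unit_def field_simps)
    moreover have "to_fract (b * e) / to_fract w \<in> ?R" by (rule cyclotomic_local_ringI[OF w])
    moreover have "b * e \<noteq> 0" "w \<noteq> 0" using ab(2) ce(2) w by (auto simp: cyclotomic_unit_def)
    ultimately show ?thesis by simp
  qed
qed

text \<open>The remainder has degree below the number of primitive roots, which is the degree of the
  divisor, yet it vanishes at each of them.\<close>

lemma cyclotomic_dvd:
  assumes "n > 0"
  shows "cyclotomic n dvd 1 - [:0, 1:] ^ n"
proof -
  let ?X = "1 - [:0, 1:] ^ n :: rat poly"
  let ?r = "?X mod cyclotomic n"
  note c = of_rat_cyclotomic[OF assms]
  have deg: "degree (map_poly of_rat p :: complex poly) = degree p" for p :: "rat poly"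
    by (intro degree_map_poly) auto
  have "degree (cyclotomic n) = degree (\<Prod>z\<in>primitive_roots n. [:-z, 1:])"
    by (simp flip: c add: deg)
  also have "\<dots> = card (primitive_roots n)" by (subst degree_prod_sum_eq) auto
  finally have degc: "degree (cyclotomic n) = card (primitive_roots n)" .
  have fin: "finite (primitive_roots n)" by (rule finite_primitive_roots[OF assms])
  have "card (primitive_roots n) > 0" using fin primitive_roots_nonempty[OF assms] by (simp add: card_gt_0_iff)
  have c0: "cyclotomic n \<noteq> 0" using degc \<open>card (primitive_roots n) > 0\<close> by auto
  have "?r = 0"
  proof (rule ccontr)
    assume r: "?r \<noteq> 0"
    then have "degree ?r < card (primitive_roots n)" using degree_mod_less'[OF c0 r] degc by simp
    moreover have "primitive_roots n \<subseteq> {z. poly (map_poly of_rat ?r) z = 0}"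
    proof
      fix z assume z: "z \<in> primitive_roots n"
      then have "root_eval (cyclotomic n) z = 0"
        unfolding root_eval_def c poly_prod using fin by (auto simp: prod_zero_iff)
      moreover have "root_eval ?X z = 0" using z
        by (simp add: root_eval_diff root_eval_1 root_eval_X_power primitive_roots_def)
      ultimately have "root_eval ?r z = 0"
        by (simp add: root_eval_diff root_eval_mult flip: minus_div_mult_eq_mod)
      then show "z \<in> {z. poly (map_poly of_rat ?r) z = 0}" by (simp add: root_eval_def)
    qed
    moreover have nz: "map_poly of_rat ?r \<noteq> (0 :: complex poly)"
      using r map_poly_of_rat_inj[of ?r 0] by auto
    ultimately have "card (primitive_roots n) \<le> degree (map_poly of_rat ?r :: complex poly)"
      using card_mono[OF poly_roots_finite[OF nz]] card_poly_roots_bound[OF nz] by (meson le_trans)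
    then show False using \<open>degree ?r < card (primitive_roots n)\<close> by (simp add: deg)
  qed
  then show ?thesis by (simp add: mod_eq_0_iff_dvd)
qed

text \<open>A nonconstant common factor would have a complex root. As a root of a power of the
  cyclotomic polynomial it is a primitive root of unity, where \<open>v\<close> does not
  vanish.\<close>

lemma coprime_cyclotomic:
  assumes "n > 0" "cyclotomic_unit n v"
  shows "coprime v (cyclotomic n ^ k)"
proof (rule ccontr)
  assume "\<not> coprime v (cyclotomic n ^ k)"
  then obtain g where g: "g dvd v" "g dvd cyclotomic n ^ k" "\<not> is_unit g" by (auto simp: coprime_def)
  have "v \<noteq> 0" using assms(2) by (simp add: cyclotomic_unit_def)
  then have "g \<noteq> 0" using g(1) by auto
  then have "degree g > 0" using g(3) is_unit_iff_degree by blast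
  moreover have "degree (map_poly of_rat g :: complex poly) = degree g" by (intro degree_map_poly) auto
  ultimately obtain z :: complex where z: "poly (map_poly of_rat g) z = 0"
    using alg_closed_imp_poly_has_root[of "map_poly of_rat g :: complex poly"] by auto
  have *: "root_eval w z = 0" if "g dvd w" for w
    using that z by (auto simp: root_eval_mult root_eval_def[of g] elim!: dvdE)
  have "root_eval (cyclotomic n) z = 0" using *[OF g(2)] by (simp add: root_eval_power)
  then have "z \<in> primitive_roots n"
    using finite_primitive_roots[OF assms(1)]
    unfolding root_eval_def of_rat_cyclotomic[OF assms(1)] poly_prod by (auto simp: prod_zero_iff)
  then show False using *[OF g(1)] assms(2) by (simp add: cyclotomic_unit_def)
qed

text \<open>Passing from \<open>1 - q ^ n\<close> to its divisor moves the cofactor \<open>c\<close>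
  into the numerator, so the denominator stays coprime to the modulus.\<close>

lemma ratfun_cong_of_local_ring:
  assumes n: "n > 0" and r: "r \<in> cyclotomic_local_ring n" and eq: "f - g = (1 - qvar ^ n) ^ k * r"
  shows "ratfun_cong f g (cyclotomic n ^ k)"
proof -
  obtain u v where uv: "r = to_fract u / to_fract v" "cyclotomic_unit n v"
    using r unfolding cyclotomic_local_ring_def by blast
  obtain c where c: "1 - [:0, 1:] ^ n = cyclotomic n * c" using cyclotomic_dvd[OF n] by (elim dvdE)
  have "1 - qvar ^ n = to_fract (1 - [:0, 1:] ^ n)" by (simp add: qvar_power)
  then have "1 - qvar ^ n = to_fract (cyclotomic n) * to_fract c" unfolding c by simp
  then have "f - g = to_fract (cyclotomic n ^ k) * (to_fract (c ^ k * u) / to_fract v)"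
    unfolding eq uv(1) by (simp add: power_mult_distrib to_fract_power)
  moreover have "v \<noteq> 0" "coprime v (cyclotomic n ^ k)"
    using uv(2) coprime_cyclotomic[OF n uv(2)] by (auto simp: cyclotomic_unit_def)
  ultimately show ?thesis unfolding ratfun_cong_def by blast
qed

lemma cyclo_ring_cyclotomic:
  assumes "2 \<le> d" "1 \<le> m"
  shows "cyclo_ring (cyclotomic_local_ring (2 * d * m + 1)) qvar (2 * d * m + 1) d m"
proof -
  define n where "n = 2 * d * m + 1"
  have n: "n > 0" by (simp add: n_def)
  interpret adic_subring "cyclotomic_local_ring n" "1 - qvar ^ n" by (rule adic_subring_cyclotomic[OF n])
  have u: "unit (to_fract v)" if v: "cyclotomic_unit n v" for v
    using v cyclotomic_local_ringI[OF v, of 1] to_fract_in_local_ring[of v n]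
    by (simp add: unit_def cyclotomic_unit_def inverse_eq_divide)
  have "cyclo_ring (cyclotomic_local_ring n) qvar n d m"
  proof
    show "n = 2 * d * m + 1" "2 \<le> d" "1 \<le> m" by (rule n_def assms)+
    show "unit qvar"
    proof -
      have "cyclotomic_unit n ([:0, 1:] ^ 1)"
      proof (rule cyclotomic_unitI[OF n])
        fix z assume "z \<in> primitive_roots n"
        then show "root_eval ([:0, 1:] ^ 1) z \<noteq> 0"
          unfolding root_eval_X_power using n by (auto simp: primitive_roots_def power_0_left)
      qed
      from u[OF this] show ?thesis by (simp add: qvar_def)
    qed
    show "unit (1 - qvar ^ e)" if "\<not> n dvd e" for e
    proof -
      have "cyclotomic_unit n (1 - [:0, 1:] ^ e)"
      proof (rule cyclotomic_unitI[OF n])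
        fix z assume "z \<in> primitive_roots n"
        then show "root_eval (1 - [:0, 1:] ^ e) z \<noteq> 0"
          using primitive_root_pow_eq_1_iff[OF _ n, of z e] that
          by (simp add: root_eval_diff root_eval_1 root_eval_X_power)
      qed
      from u[OF this] show ?thesis by (simp add: qvar_power)
    qed
    show "unit (\<Sum>j<i. (qvar ^ n) ^ j)" if "i > 0" for i
    proof -
      have "cyclotomic_unit n (\<Sum>j<i. [:0, 1:] ^ (n * j))"
      proof (rule cyclotomic_unitI[OF n])
        fix z assume "z \<in> primitive_roots n"
        then have "z ^ n = 1" by (simp add: primitive_roots_def)
        \<comment> \<open>Each summand is 1 at a primitive root, so the value is the integer
          \<open>i\<close>, nonzero in characteristic 0.\<close>
        then show "root_eval (\<Sum>j<i. [:0, 1:] ^ (n * j)) z \<noteq> 0"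
          using that by (simp add: root_eval_sum root_eval_X_power) (simp add: power_mult)
      qed
      from u[OF this] show ?thesis by (simp only: to_fract_sum qvar_power[symmetric]) (simp only: power_mult)
    qed
    show "qvar ^ e \<noteq> 1" if "e > 0" for e
    proof
      assume "qvar ^ e = 1"
      then have "[:0, 1:] ^ e = (1 :: rat poly)" by (simp add: qvar_power flip: to_fract_1)
      then have "degree ([:0, 1:] ^ e :: rat poly) = 0" by simp
      then show False using that by (simp add: degree_power_eq)
    qed
  qed
  then show ?thesis unfolding n_def .
qed

text \<open>For \<open>a = b = d = q\<close> the factor \<open>b - p ^ Suc j\<close> is
  \<open>q * (1 - q ^ (d - 1) * p ^ j)\<close>, which accounts for the unusual symbol
  \<open>(q ^ (d - 1); q ^ d)_k\<close>. Its \<open>q\<close> and the factor \<open>a\<close> cancel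
  against one \<open>q\<close> from each of the two denominators beginning with \<open>b\<close> and
  \<open>d\<close>.\<close>

lemma rterm_eq_qpoch:
  fixes q :: "'a::field"
  assumes q_nonzero: "q \<noteq> 0" and d: "d \<ge> 1"
  shows "qint q (3 * d * k + 1) *
      ((qpoch q (q ^ (2 * d)) k * qpoch (q ^ (d - 1)) (q ^ d) k * (qpoch q (q ^ d) k)\<^sup>2)
       / (qpoch (q ^ d) (q ^ d) k * qpoch (q ^ (d + 2)) (q ^ (2 * d)) k * (qpoch (q ^ (2 * d)) (q ^ (2 * d)) k)\<^sup>2))
      * q ^ (d * (k\<^sup>2 + k) div 2) = rterm (q ^ d) q q q k / (1 - q)"
proof -
  define p where "p = q ^ d"
  have p2: "(q ^ (2 * d)) ^ j = p ^ (2 * j)" for j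
    by (simp add: p_def mult_ac flip: power_mult)
  have e1: "q ^ (3 * d * k + 1) = q * p ^ (3 * k)"
    by (simp add: p_def mult_ac flip: power_mult)
  have e2: "q * q ^ (d - 1) = p" using d by (simp add: p_def flip: power_Suc)
  have e3: "q ^ (d + 2) * (q ^ (2 * d)) ^ j = q * q * p ^ (2 * j + 1)" for j
    unfolding p2 by (simp add: p_def power_add power2_eq_square mult_ac)
  have e4: "q ^ (2 * d) * (q ^ (2 * d)) ^ j = p ^ (2 * j + 2)" for j
    unfolding p2 by (simp add: p_def power_add power_mult power2_eq_square mult_ac)
  have e5: "q ^ d * (q ^ d) ^ j = p ^ Suc j" for j by (simp add: p_def)
  \<comment> \<open>The exponent parses as \<open>(d * (k\<^sup>2 + k)) div 2\<close>, an exact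
    division; it is \<open>d\<close> times the sum of the numbers up to \<open>k\<close> and is
    spread over the factors.\<close>
  have tri: "q ^ (d * (k\<^sup>2 + k) div 2) = (\<Prod>j<k. p ^ Suc j)"
  proof -
    have "(\<Sum>j<k. Suc j) * 2 = k\<^sup>2 + k" by (induction k) (simp_all add: power2_eq_square algebra_simps)
    then have e: "d * (k\<^sup>2 + k) = d * (\<Sum>j<k. Suc j) * 2" by (metis mult.assoc)
    have "d * (k\<^sup>2 + k) div 2 = d * (\<Sum>j<k. Suc j)" unfolding e by simp
    then show ?thesis by (simp only: power_sum p_def power_mult)
  qed
  have ratio: "(1 - q * p ^ j) * (1 - q * p ^ j) * (q - p ^ Suc j) * (1 - q * p ^ (2 * j)) * q * p ^ Suc j /
       ((1 - p ^ (2 * j + 2)) * (q - q * p ^ (2 * j + 2)) * (1 - q * q * p ^ (2 * j + 1)) * (q - q * p ^ Suc j)) =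
      (1 - q * p ^ (2 * j)) * (1 - q ^ (d - 1) * p ^ j) * ((1 - q * p ^ j) * (1 - q * p ^ j)) /
      ((1 - p ^ Suc j) * (1 - q * q * p ^ (2 * j + 1)) * ((1 - p ^ (2 * j + 2)) * (1 - p ^ (2 * j + 2)))) * p ^ Suc j" for j
  proof -
    have f: "q - q * x = q * (1 - x)" for x by (simp add: algebra_simps)
    have f2: "q - p ^ Suc j = q * (1 - q ^ (d - 1) * p ^ j)"
      by (simp add: e2[symmetric] algebra_simps)
    show ?thesis unfolding f f2 using q_nonzero by (simp add: mult_ac)
  qed
  have "rterm p q q q k = (1 - q * p ^ (3 * k)) *
     ((\<Prod>j<k. 1 - q * p ^ (2 * j)) * (\<Prod>j<k. 1 - q ^ (d - 1) * p ^ j) * ((\<Prod>j<k. 1 - q * p ^ j) * (\<Prod>j<k. 1 - q * p ^ j)) /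
      ((\<Prod>j<k. 1 - p ^ Suc j) * (\<Prod>j<k. 1 - q * q * p ^ (2 * j + 1)) * ((\<Prod>j<k. 1 - p ^ (2 * j + 2)) * (\<Prod>j<k. 1 - p ^ (2 * j + 2)))) *
      (\<Prod>j<k. p ^ Suc j))"
    unfolding rterm_def ratio by (simp only: prod.distrib prod_dividef)
  then show ?thesis
    unfolding qint_def qpoch_def e1 tri e3 e4 e5 unfolding p2 p_def[symmetric] power2_eq_square
    by (simp add: mult_ac)
qed

theorem theorem3:
  fixes d n :: nat
  assumes "d > 1" and "n > 1" and "[n = 1] (mod (2 * d))"
  shows
    "ratfun_cong
       (\<Sum>k = 0..(n - 1) div d.
          qint qvar (3 * d * k + 1)
          * ((qpoch qvar (qvar ^ (2 * d)) k * qpoch (qvar ^ (d - 1)) (qvar ^ d) k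
              * (qpoch qvar (qvar ^ d) k)\<^sup>2)
             / (qpoch (qvar ^ d) (qvar ^ d) k * qpoch (qvar ^ (d + 2)) (qvar ^ (2 * d)) k
              * (qpoch (qvar ^ (2 * d)) (qvar ^ (2 * d)) k)\<^sup>2))
          * qvar ^ (d * (k\<^sup>2 + k) div 2))
       (qpoch (qvar ^ d) (qvar ^ (2 * d)) ((n - 1) div (2 * d))
          / qpoch (qvar ^ (d + 2)) (qvar ^ (2 * d)) ((n - 1) div (2 * d))
          * qint qvar n
          * qvar powi (- int ((n - 1) * (d - 1) div (2 * d))))
       (cyclotomic n ^ 3)
     \<and>
     ratfun_cong
       (\<Sum>k = 0..n - 1.
          qint qvar (3 * d * k + 1)
          * ((qpoch qvar (qvar ^ (2 * d)) k * qpoch (qvar ^ (d - 1)) (qvar ^ d) k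
              * (qpoch qvar (qvar ^ d) k)\<^sup>2)
             / (qpoch (qvar ^ d) (qvar ^ d) k * qpoch (qvar ^ (d + 2)) (qvar ^ (2 * d)) k
              * (qpoch (qvar ^ (2 * d)) (qvar ^ (2 * d)) k)\<^sup>2))
          * qvar ^ (d * (k\<^sup>2 + k) div 2))
       (qpoch (qvar ^ d) (qvar ^ (2 * d)) ((n - 1) div (2 * d))
          / qpoch (qvar ^ (d + 2)) (qvar ^ (2 * d)) ((n - 1) div (2 * d))
          * qint qvar n
          * qvar powi (- int ((n - 1) * (d - 1) div (2 * d))))
       (cyclotomic n ^ 3)"
proof -
  define m where "m = (n - 1) div (2 * d)"
  have "2 * d dvd n - 1" using assms(2,3) cong_altdef_nat[of 1 n "2 * d"] by (simp add: cong_sym_eq)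
  then have nm: "n - 1 = 2 * d * m" by (simp add: m_def)
  then have n_eq: "n = 2 * d * m + 1" using assms(2) by simp
  have m1: "1 \<le> m" using nm assms(2) by (cases m) auto
  interpret cyclo_ring "cyclotomic_local_ring n" qvar n d m
    unfolding n_eq using assms(1) m1 by (intro cyclo_ring_cyclotomic) auto
  have n0: "n > 0" using assms(2) by simp
  \<comment> \<open>\<open>n > 1\<close> makes \<open>1 - qvar\<close> a unit, so the denominator
    \<open>1 - q\<close> that the q-integers put on both sides does not disturb the
    congruence.\<close>
  have u1: "unit (1 - qvar)" using unit_one_minus[of 1] assms(2) by simp
  define T where "T = qpoch (qvar ^ d) (qvar ^ (2 * d)) ((n - 1) div (2 * d))
          / qpoch (qvar ^ (d + 2)) (qvar ^ (2 * d)) ((n - 1) div (2 * d))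
          * qint qvar n
          * qvar powi (- int ((n - 1) * (d - 1) div (2 * d)))"
  have T: "T = target / (1 - qvar)"
  proof -
    have d1: "(n - 1) div (2 * d) = m" by (simp add: m_def)
    have d2: "(n - 1) * (d - 1) div (2 * d) = m * (d - 1)"
      unfolding nm using assms(1) by (simp add: mult.assoc)
    have pw: "qvar powi (- int (m * (d - 1))) = qvar ^ m / p ^ m"
    proof -
      have "m * d = m + m * (d - 1)" using assms(1) by (cases d) auto
      then have "p ^ m = qvar ^ m * qvar ^ (m * (d - 1))"
        by (simp add: p_def mult.commute flip: power_mult power_add)
      moreover have "qvar powi (- int e) = 1 / qvar ^ e" for e by (simp add: power_int_minus divide_inverse)
      ultimately show ?thesis using q_nonzero by (simp del: of_nat_mult)
    qed
    have e1: "qvar ^ d * (qvar ^ (2 * d)) ^ j = p ^ (2 * j + 1)" for j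
      by (simp add: p_def mult_ac flip: power_mult)
    have e2: "qvar ^ (d + 2) * (qvar ^ (2 * d)) ^ j = qvar * qvar * p ^ (2 * j + 1)" for j
      by (simp add: p_def power_add power2_eq_square mult_ac flip: power_mult)
    show ?thesis
      unfolding T_def d1 d2 pw target_def qpoch_def qint_def e1 e2 prod_dividef Y_def by (simp add: mult_ac)
  qed
  have S: "(\<Sum>k = 0..N.
          qint qvar (3 * d * k + 1)
          * ((qpoch qvar (qvar ^ (2 * d)) k * qpoch (qvar ^ (d - 1)) (qvar ^ d) k
              * (qpoch qvar (qvar ^ d) k)\<^sup>2)
             / (qpoch (qvar ^ d) (qvar ^ d) k * qpoch (qvar ^ (d + 2)) (qvar ^ (2 * d)) k
              * (qpoch (qvar ^ (2 * d)) (qvar ^ (2 * d)) k)\<^sup>2))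
          * qvar ^ (d * (k\<^sup>2 + k) div 2)) = (\<Sum>k<Suc N. rterm p qvar qvar qvar k) / (1 - qvar)" for N
    unfolding sum_divide_distrib p_def atLeast0AtMost lessThan_Suc_atMost
    using assms(1) q_nonzero by (intro sum.cong rterm_eq_qpoch refl) auto
  have fin: "ratfun_cong (x / (1 - qvar)) T (cyclotomic n ^ 3)" if x: "cong_mod 3 x target" for x
  proof -
    obtain r where r: "r \<in> cyclotomic_local_ring n" "x - target = (1 - qvar ^ n) ^ 3 * r"
      using x unfolding cong_mod_def by blast
    show ?thesis
    proof (rule ratfun_cong_of_local_ring[OF n0])
      show "r / (1 - qvar) \<in> cyclotomic_local_ring n" by (rule divide_in[OF r(1) u1])
      show "x / (1 - qvar) - T = (1 - qvar ^ n) ^ 3 * (r / (1 - qvar))"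
        unfolding T using r(2) by (simp flip: diff_divide_distrib)
    qed
  qed
  have N1: "Suc ((n - 1) div d) = 2 * m + 1"
    unfolding nm using assms(1) by (simp add: mult.commute mult.left_commute)
  have N2: "Suc (n - 1) = n" using n0 by simp
  show ?thesis
    unfolding S T_def[symmetric] N1 N2
    using fin[OF rterm_sum_cong_target] fin[OF rterm_full_sum_cong_target] by blast
qed

end
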